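(* Let $N\ge 1$ be an integer, and let $f$ and $g$ be normalised eigenforms for $\Gamma_0(N)$, both with character $\chi$, of respective positive integer weights $k_1 \le k_2$. Let $R$ be the ring of integers of a number field, and assume that $R$ contains the Fourier coefficients of $f$ and $g$. Let $\mathfrak p$ be a nonzero prime ideal in $R$, define the prime number $p$ by $p\mathbb Z=\mathfrak p\cap\mathbb Z$, and assume that $p\in\{2,3\}$ and that $f\not\equiv g\mod\mathfrak p$. Define an integer $M$ as follows: (a) if $p=3$ and $N$ is not a power of $3$ (that is, $N\ne 3^a$ for every integer $a\ge 0$), then $M=N$; (b) if $p=3$ and $N=3^a$ for some integer $a\ge 0$, then $M=2N$; (c) if $p=2$ and $N$ is divisible by $5$, $7$ or $11$, then $M=N$; (d) if $p=2$ and $N$ is not divisible by any of $5$, $7$, $11$, then $M=5N$. Then there exists $$n\le\max\left\{g^*(p,N)^2,\ \frac{k_2}{12}[SL_2(\mathbb Z):\Gamma_0(M)]\right\}$$ such that $a_n(f)\not\equiv a_n(g)\mod\mathfrak p$, where $g^*(p,N)$ is the least prime primitive root modulo $p$ that does not divide $N$.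
   Context: A modular form of weight $k$ and character $\chi$ for $\Gamma_0(N)$ satisfies $f\left(\frac{az+b}{cz+d}\right)=\chi(d)(cz+d)^k f(z)$ for all $\begin{pmatrix}a&b\\c&d\end{pmatrix}\in\Gamma_0(N)$ (with the usual holomorphy conditions, including at the cusps); here $\chi$ is a Dirichlet character modulo $N$. An eigenform is an eigenvector for the full Hecke algebra, and it is normalised if its first Fourier coefficient is $a_1=1$. For a modular form $f$, $a_n(f)$ denotes the $n$th Fourier coefficient: $f(z)=\sum_{n\ge 0} a_n(f)e^{2\pi i nz}$; the $n$ in the claim is a nonnegative integer. $f\equiv g \mod \mathfrak p$ means $a_n(f)\equiv a_n(g)\mod\mathfrak p$ for all $n$. A prime primitive root modulo $p$ is a prime number that is also a primitive root modulo $p$ (a generator of $(\mathbb Z/p\mathbb Z)^\times$, in particular coprime to $p$). *)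

theory Defs
  imports
    "HOL-Analysis.Analysis"
    "HOL-Algebra.Embedded_Algebras"
    "HOL-Algebra.Algebraic_Closure_Type"
    "HOL-Number_Theory.Residue_Primitive_Roots"
begin

section \<open>The modular group and its congruence subgroups\<close>

definition SL2Z :: "(int ^ 2 ^ 2) monoid" where
  "SL2Z = \<lparr>carrier = {A. det A = 1}, mult = (\<lambda>A B. A ** B), one = mat 1\<rparr>"

definition Gamma0 :: "nat \<Rightarrow> (int ^ 2 ^ 2) set" where
  "Gamma0 N = {A \<in> carrier SL2Z. int N dvd A $ 2 $ 1}"

definition Gamma0_index :: "nat \<Rightarrow> nat" where
  "Gamma0_index N = card (rcosets\<^bsub>SL2Z\<^esub> (Gamma0 N))"

lemma SL2Z_simps [simp]:
  "A \<in> carrier SL2Z \<longleftrightarrow> det A = 1" "mult SL2Z A B = A ** B" "one SL2Z = mat 1"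
  by (simp_all add: SL2Z_def)

lemma SL2Z_left_inverse:
  fixes A :: "int ^ 2 ^ 2"
  assumes "det A = 1"
  defines "B \<equiv> vector [vector [A $ 2 $ 2, - A $ 1 $ 2], vector [- A $ 2 $ 1, A $ 1 $ 1]]"
  shows "det B = 1" "B ** A = mat 1"
proof -
  have A: "A $ 1 $ 1 * A $ 2 $ 2 - A $ 1 $ 2 * A $ 2 $ 1 = 1"
    using assms by (simp add: det_2)
  thus "det B = 1"
    by (simp add: B_def det_2 algebra_simps)
  show "B ** A = mat 1"
    using A by (simp add: B_def matrix_matrix_mult_def mat_def vec_eq_iff forall_2 sum_2
        algebra_simps)
qed

lemma group_SL2Z: "group SL2Z"
proof (rule groupI)
  fix A
  assume "A \<in> carrier SL2Z"
  thus "\<exists>B\<in>carrier SL2Z. mult SL2Z B A = one SL2Z"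
    using SL2Z_left_inverse[of A] by auto
qed (auto simp: det_mul matrix_mul_assoc)

lemma subgroup_Gamma0: "subgroup (Gamma0 N) SL2Z"
proof -
  interpret group SL2Z by (rule group_SL2Z)
  show ?thesis
  proof (rule subgroupI)
    fix A
    assume A: "A \<in> Gamma0 N"
    define B :: "int ^ 2 ^ 2" where
      "B = vector [vector [A $ 2 $ 2, - A $ 1 $ 2], vector [- A $ 2 $ 1, A $ 1 $ 1]]"
    have B: "det B = 1" "B ** A = mat 1"
      using SL2Z_left_inverse[of A] A by (simp_all add: B_def Gamma0_def)
    hence "m_inv SL2Z A = B"
      using A by (intro inv_equality) (auto simp: Gamma0_def)
    thus "m_inv SL2Z A \<in> Gamma0 N"
      using A B by (simp add: Gamma0_def) (simp add: B_def)
  next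
    have "mat 1 \<in> Gamma0 N"
      by (simp add: Gamma0_def) (simp add: mat_def)
    thus "Gamma0 N \<noteq> {}" by blast
  next
    fix A B
    assume "A \<in> Gamma0 N" "B \<in> Gamma0 N"
    moreover have "(A ** B) $ 2 $ 1 = A $ 2 $ 1 * B $ 1 $ 1 + A $ 2 $ 2 * B $ 2 $ 1"
      by (simp add: matrix_matrix_mult_def sum_2)
    ultimately show "mult SL2Z A B \<in> Gamma0 N"
      by (simp add: Gamma0_def det_mul)
  qed (simp add: Gamma0_def subset_iff)
qed

section \<open>Modular forms\<close>

definition upper_half_plane :: "complex set" where
  "upper_half_plane = {z. Im z > 0}"

definition moebius_num :: "int ^ 2 ^ 2 \<Rightarrow> complex \<Rightarrow> complex" where
  "moebius_num A z = of_int (A $ 1 $ 1) * z + of_int (A $ 1 $ 2)"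

definition moebius_den :: "int ^ 2 ^ 2 \<Rightarrow> complex \<Rightarrow> complex" where
  "moebius_den A z = of_int (A $ 2 $ 1) * z + of_int (A $ 2 $ 2)"

definition dirichlet_character :: "nat \<Rightarrow> (int \<Rightarrow> complex) \<Rightarrow> bool" where
  "dirichlet_character N chi \<longleftrightarrow>
     (\<forall>a. chi (a + int N) = chi a) \<and>
     (\<forall>a b. chi (a * b) = chi a * chi b) \<and>
     (\<forall>a. chi a \<noteq> 0 \<longleftrightarrow> coprime a (int N))"

definition slash :: "nat \<Rightarrow> (complex \<Rightarrow> complex) \<Rightarrow> int ^ 2 ^ 2 \<Rightarrow> complex \<Rightarrow> complex" where
  "slash k f A z = f (moebius_num A z / moebius_den A z) / moebius_den A z ^ k"

definition bounded_at_i_infinity :: "(complex \<Rightarrow> complex) \<Rightarrow> bool" where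
  "bounded_at_i_infinity f \<longleftrightarrow> (\<exists>B C. \<forall>z. Im z > max 0 B \<longrightarrow> norm (f z) \<le> C)"

text \<open>
  Every cusp is of the form \<open>A \<infinity>\<close> with \<open>A\<close> in \<open>SL\<^sub>2(\<int>)\<close>; holomorphy of \<open>f\<close> at that cusp
  is the boundedness of \<open>slash k f A\<close> at \<open>i\<infinity>\<close>. Only the values of \<open>f\<close> on the upper half
  plane matter.
\<close>

definition modular_form :: "nat \<Rightarrow> nat \<Rightarrow> (int \<Rightarrow> complex) \<Rightarrow> (complex \<Rightarrow> complex) \<Rightarrow> bool" where
  "modular_form k N chi f \<longleftrightarrow>
     f holomorphic_on upper_half_plane \<and>
     (\<forall>A\<in>Gamma0 N. \<forall>z\<in>upper_half_plane.
        f (moebius_num A z / moebius_den A z) = chi (A $ 2 $ 2) * moebius_den A z ^ k * f z) \<and>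
     (\<forall>A\<in>carrier SL2Z. bounded_at_i_infinity (slash k f A))"

definition fourier_coeff :: "(complex \<Rightarrow> complex) \<Rightarrow> nat \<Rightarrow> complex" where
  "fourier_coeff f = (THE a. \<forall>z\<in>upper_half_plane.
     (\<lambda>n. a n * exp (2 * of_real pi * \<i> * of_nat n * z)) sums f z)"

section \<open>Hecke operators and eigenforms\<close>

text \<open>
  The \<open>m\<close>-th Hecke operator on forms of weight \<open>k\<close> and character \<open>chi\<close> modulo \<open>N\<close> is
  \<open>T\<^sub>m f(z) = m\<^sup>k\<^sup>-\<^sup>1 \<Sum>\<^sub>a\<^sub>d\<^sub>=\<^sub>m chi(a) d\<^sup>-\<^sup>k \<Sum>\<^sub>0\<^sub>\<le>\<^sub>b\<^sub><\<^sub>d f((az+b)/d)\<close>, for every \<open>m \<ge> 1\<close>: since \<open>chi(a) = 0\<close>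
  when \<open>a\<close> is not coprime to \<open>N\<close>, this includes the operators \<open>U\<^sub>\<ell>\<close> at primes \<open>\<ell>\<close> dividing \<open>N\<close>.
  These operators generate the full Hecke algebra together with the diamond operators, and the
  latter act on the space of forms of character \<open>chi\<close> as scalars.
\<close>

definition hecke_operator ::
    "nat \<Rightarrow> (int \<Rightarrow> complex) \<Rightarrow> nat \<Rightarrow> (complex \<Rightarrow> complex) \<Rightarrow> complex \<Rightarrow> complex" where
  "hecke_operator k chi m f z =
     of_nat m ^ k / of_nat m *
     (\<Sum>d | d dvd m. chi (int (m div d)) / of_nat d ^ k *
        (\<Sum>b<d. f ((of_nat (m div d) * z + of_nat b) / of_nat d)))"

definition eigenform :: "nat \<Rightarrow> nat \<Rightarrow> (int \<Rightarrow> complex) \<Rightarrow> (complex \<Rightarrow> complex) \<Rightarrow> bool" where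
  "eigenform k N chi f \<longleftrightarrow>
     modular_form k N chi f \<and>
     (\<exists>z\<in>upper_half_plane. f z \<noteq> 0) \<and>
     (\<forall>m>0. \<exists>c. \<forall>z\<in>upper_half_plane. hecke_operator k chi m f z = c * f z)"

definition normalised_eigenform ::
    "nat \<Rightarrow> nat \<Rightarrow> (int \<Rightarrow> complex) \<Rightarrow> (complex \<Rightarrow> complex) \<Rightarrow> bool" where
  "normalised_eigenform k N chi f \<longleftrightarrow> eigenform k N chi f \<and> fourier_coeff f 1 = 1"

section \<open>Number fields and congruences\<close>

text \<open>Number fields are taken inside \<open>\<complex>\<close>, since their integers are compared with Fourier coefficients.\<close>

definition number_field :: "complex set \<Rightarrow> bool" where
  "number_field K \<longleftrightarrow>
     subfield K ring_of_type_algebra \<and> ring.finite_dimension ring_of_type_algebra \<rat> K"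

definition ring_of_integers :: "complex set \<Rightarrow> complex ring" where
  "ring_of_integers K = ring_of_type_algebra\<lparr>carrier := {x \<in> K. algebraic_int x}\<rparr>"

definition forms_congruent ::
    "complex set \<Rightarrow> (complex \<Rightarrow> complex) \<Rightarrow> (complex \<Rightarrow> complex) \<Rightarrow> bool" where
  "forms_congruent P f g \<longleftrightarrow> (\<forall>n. fourier_coeff f n - fourier_coeff g n \<in> P)"

definition least_prime_primroot :: "nat \<Rightarrow> nat \<Rightarrow> nat" where
  "least_prime_primroot p N = (LEAST q. Factorial_Ring.prime q \<and> residue_primroot p q \<and> \<not> q dvd N)"

end

theory Submission
  imports Defs "HOL-Complex_Analysis.Complex_Analysis"
begin

text \<open>
  Since \<open>p\<close> is 2 or 3, passing to a \<open>p\<close>-power makes the missing Hasse invariant in weight \<open>p - 1\<close>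
  unnecessary: \<open>f\<^sup>4 E\<^sub>4\<^sup>r - g\<^sup>4\<close> with \<open>r = k\<^sub>2 - k\<^sub>1\<close> for \<open>p = 2\<close>, and \<open>f\<^sup>3 E\<^sub>6\<^bsup>r/2\<^esup> - g\<^sup>3\<close> for \<open>p = 3\<close>
  (where \<open>r\<close> is even because both forms have the same character), are forms of level \<open>M\<close> and of
  weight \<open>4k\<^sub>2\<close>, respectively \<open>3k\<^sub>2\<close>, congruent to \<open>(f - g)\<^sup>4\<close>, respectively \<open>(f - g)\<^sup>3\<close>, because
  \<open>E\<^sub>4\<close> and \<open>E\<^sub>6\<close> are congruent to 1.

  It remains to bound the order \<open>m\<close> modulo \<open>P\<close> of a form \<open>F\<close> of weight \<open>k\<close> by \<open>k/12\<close> times the index,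
  without the \<open>q\<close>-expansion principle. The forms \<open>F\<^sup>i \<Delta>\<^sup>j E\<^sub>4\<^sup>l\<close> of a large weight \<open>W\<close> have all orders
  up to about \<open>Wm/k\<close> modulo \<open>P\<close>, so by elimination some combination of them has at least that
  order over \<open>\<complex>\<close>, whereas the valence bound over \<open>\<complex>\<close> gives at most \<open>W/12\<close> times the index.
  The latter follows from the maximum principle, applied to the norm down to level one divided
  by a power of \<open>\<Delta>\<close>.
\<close>

section \<open>The cotangent series\<close>

text \<open>The classical argument reduces the product of all conjugates of F modulo P, which
  requires integral expansions at every cusp. Here only boundedness is known at the other cusps.
  That suffices for a valence bound over \<complex>, so the order modulo P is traded for an order
  over \<complex>: the auxiliary factors cost a fixed amount of weight, while a violation of the
  bound gains with every further power of F, so a large W is contradictory. The exponents are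
  dictated by the weights of the correcting factors: 4k_1 + 4r = 4k_2 with E_4, and 3k_1 + 6(r/2) =
  3k_2 with E_6. They are also powers of p, which makes the binomial expansions collapse. All
  classical input comes from a single lattice sum, the behaviour of E_2 under z -> -1/z. Integrating
  it gives the law of \<Delta>, differentiating it gives E_4 and E_6 through Ramanujan's equations.
  Integrality is inherited from Euler's product, and since only congruences modulo 2 and 3 matter,
  divisor sums never have to be computed.\<close>

lemma not_Ints_imp_not_nonpos:
  fixes w :: complex
  assumes "w \<notin> \<int>"
  shows "w \<notin> \<int>\<^sub>\<le>\<^sub>0" "1 - w \<notin> \<int>\<^sub>\<le>\<^sub>0" "1 + w \<notin> \<int>\<^sub>\<le>\<^sub>0"
proof -
  have *: "\<int>\<^sub>\<le>\<^sub>0 \<subseteq> (\<int> :: complex set)"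
    by (auto simp: nonpos_Ints_def)
  have "w \<in> \<int>" if "1 - w \<in> \<int>"
    using Ints_diff[OF Ints_1 that] by simp
  moreover have "w \<in> \<int>" if "1 + w \<in> \<int>"
    using Ints_diff[OF that Ints_1] by simp
  ultimately show "w \<notin> \<int>\<^sub>\<le>\<^sub>0" "1 - w \<notin> \<int>\<^sub>\<le>\<^sub>0" "1 + w \<notin> \<int>\<^sub>\<le>\<^sub>0"
    using assms * by blast+
qed

lemma sin_pi_nonzero: "w \<notin> \<int> \<Longrightarrow> sin (of_real pi * w :: complex) \<noteq> 0"
proof
  assume w: "w \<notin> \<int>" and "sin (of_real pi * w) = 0"
  then obtain n :: int where "of_real pi * w = of_real (of_int n * pi)"
    by (auto simp: sin_eq_0)
  hence "w = of_int n" by (simp add: mult.commute)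
  with w show False by simp
qed

text \<open>The logarithmic derivative of the reflection formula rGamma(w) rGamma(1 - w) = sin(pi w)
  / pi.\<close>

lemma Digamma_reflection:
  fixes w :: complex
  assumes "w \<notin> \<int>"
  shows "Digamma (1 - w) - Digamma w = of_real pi * cot (of_real pi * w)"
proof -
  note ni = not_Ints_imp_not_nonpos[OF assms]
  have d1: "(rGamma has_field_derivative - rGamma w * Digamma w) (at w)"
    by (rule has_field_derivative_rGamma_no_nonpos_int) (use ni in simp)
  have "((\<lambda>w. 1 - w) has_field_derivative - 1) (at w)"
    by (auto intro!: derivative_eq_intros)
  note d2 = DERIV_chain2[OF has_field_derivative_rGamma_no_nonpos_int this, OF ni(2)]
  have "((\<lambda>w. rGamma w * rGamma (1 - w)) has_field_derivative
      rGamma w * rGamma (1 - w) * (Digamma (1 - w) - Digamma w)) (at w)"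
    using DERIV_mult[OF d1 d2] by (simp add: algebra_simps)
  moreover have "((\<lambda>w. rGamma w * rGamma (1 - w)) has_field_derivative cos (of_real pi * w)) (at w)"
    unfolding rGamma_reflection_complex by (auto intro!: derivative_eq_intros)
  ultimately have "sin (of_real pi * w) / of_real pi * (Digamma (1 - w) - Digamma w) = cos (of_real pi * w)"
    unfolding rGamma_reflection_complex by (rule DERIV_unique)
  hence "of_real pi * cos (of_real pi * w) / sin (of_real pi * w) =
      of_real pi * (sin (of_real pi * w) / of_real pi * (Digamma (1 - w) - Digamma w)) / sin (of_real pi * w)"
    by metis
  also have "\<dots> = Digamma (1 - w) - Digamma w"
    using sin_pi_nonzero[OF assms] by simp
  finally show ?thesis
    unfolding cot_def by simp
qed

text \<open>One more differentiation of \<open>Digamma_reflection\<close>, which holds in a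
  neighbourhood of w because \<int> is closed.\<close>

lemma Polygamma_reflection:
  fixes w :: complex
  assumes "w \<notin> \<int>"
  shows "Polygamma 1 w + Polygamma 1 (1 - w) = of_real pi ^ 2 / sin (of_real pi * w) ^ 2"
proof -
  note ni = not_Ints_imp_not_nonpos[OF assms]
  have "open (- \<int> :: complex set)"
    using closed_Ints by (simp add: open_Compl)
  hence ev: "eventually (\<lambda>w. w \<in> - \<int>) (nhds w)"
    using assms by (intro eventually_nhds_in_open) auto
  have "((\<lambda>w. Digamma (1 - w) - Digamma w) has_field_derivative
      - (Polygamma 1 w + Polygamma 1 (1 - w))) (at w)"
  proof -
    have "((\<lambda>w. 1 - w) has_field_derivative - 1) (at w)"
      by (auto intro!: derivative_eq_intros)
    note d2 = DERIV_chain2[OF has_field_derivative_Polygamma this, OF ni(2), of 0]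
    have eq: "- (Polygamma 1 w + Polygamma 1 (1 - w)) = - Polygamma 1 (1 - w) - Polygamma 1 w"
      by simp
    show ?thesis
      unfolding eq using DERIV_diff[OF d2 has_field_derivative_Polygamma[OF ni(1), of 0]] by simp
  qed
  moreover have "((\<lambda>w. Digamma (1 - w) - Digamma w) has_field_derivative
      - (of_real pi ^ 2 / sin (of_real pi * w) ^ 2)) (at w)"
  proof (subst DERIV_cong_ev[OF refl _ refl])
    show "\<forall>\<^sub>F w in nhds w. Digamma (1 - w) - Digamma w = of_real pi * cot (of_real pi * w)"
      using ev by eventually_elim (rule Digamma_reflection, simp)
    have aux: "(- a * s * a) * s - a * c * (c * a) = - (a ^ 2 * (s ^ 2 + c ^ 2))" for a s c :: complex
      by (simp add: power2_eq_square algebra_simps)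
    have "((\<lambda>w. of_real pi * cos (of_real pi * w) / sin (of_real pi * w)) has_field_derivative
       ((- of_real pi * sin (of_real pi * w) * of_real pi) * sin (of_real pi * w) -
         of_real pi * cos (of_real pi * w) * (cos (of_real pi * w) * of_real pi)) / (sin (of_real pi * w) * sin (of_real pi * w))) (at w)"
    proof (rule DERIV_divide)
      show "((\<lambda>w. of_real pi * cos (of_real pi * w)) has_field_derivative
        - of_real pi * sin (of_real pi * w) * of_real pi) (at w)"
        by (auto intro!: derivative_eq_intros)
      show "((\<lambda>w. sin (of_real pi * w)) has_field_derivative cos (of_real pi * w) * of_real pi) (at w)"
        by (auto intro!: derivative_eq_intros)
    qed (rule sin_pi_nonzero[OF assms])
    also have "(- of_real pi * sin (of_real pi * w) * of_real pi) * sin (of_real pi * w) -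
         of_real pi * cos (of_real pi * w) * (cos (of_real pi * w) * of_real pi) =
         - (of_real pi ^ 2 * (sin (of_real pi * w) ^ 2 + cos (of_real pi * w) ^ 2))"
      by (rule aux)
    also have "sin (of_real pi * w) ^ 2 + cos (of_real pi * w) ^ 2 = 1"
      by (rule sin_cos_squared_add)
    also have "sin (of_real pi * w) * sin (of_real pi * w) = sin (of_real pi * w) ^ 2"
      by (simp add: power2_eq_square)
    finally show "((\<lambda>w. of_real pi * cot (of_real pi * w)) has_field_derivative
      - (of_real pi ^ 2 / sin (of_real pi * w) ^ 2)) (at w)"
      by (simp add: cot_def)
  qed
  ultimately have "- (Polygamma 1 w + Polygamma 1 (1 - w)) = - (of_real pi ^ 2 / sin (of_real pi * w) ^ 2)"
    by (rule DERIV_unique)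
  thus ?thesis by (metis minus_minus)
qed

text \<open>The series for Digamma(1 - w) and Digamma(1 + w) are subtracted termwise, so that the
  harmonic terms and Euler's constant cancel. The recurrence Digamma(1 + w) = Digamma(w) + 1/w
  accounts for the isolated term 1/w.\<close>

lemma cot_partial_fractions:
  fixes w :: complex
  assumes "w \<notin> \<int>"
  shows "(\<lambda>k. 1 / (w + of_nat (Suc k)) + 1 / (w - of_nat (Suc k))) sums
           (of_real pi * cot (of_real pi * w) - 1 / w)"
proof -
  have w0: "w \<noteq> 0" "1 + w \<noteq> 0" "1 - w \<noteq> 0" using not_Ints_imp_not_nonpos[OF assms] assms by auto
  have s: "(\<lambda>k. inverse (of_nat (Suc k)) - inverse (z + of_nat k)) sums (Digamma z + euler_mascheroni)"
    if "z \<noteq> 0" for z :: complex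
    using summable_Digamma[OF that] by (simp add: Digamma_def summable_sums)
  have "(\<lambda>k. (inverse (of_nat (Suc k)) - inverse (1 - w + of_nat k)) -
       (inverse (of_nat (Suc k)) - inverse (1 + w + of_nat k))) sums
       (Digamma (1 - w) + euler_mascheroni - (Digamma (1 + w) + euler_mascheroni))"
    by (intro sums_diff s w0)
  moreover have "inverse (1 + w + of_nat k) = 1 / (w + of_nat (Suc k))" for k
    by (simp add: add_ac divide_inverse)
  moreover have "- inverse (1 - w + of_nat k) = 1 / (w - of_nat (Suc k))" for k
    by (simp add: inverse_minus_eq [symmetric] divide_inverse algebra_simps)
  hence "inverse (1 - w + of_nat k) = - (1 / (w - of_nat (Suc k)))" for k
    by (metis minus_minus)
  ultimately show ?thesis
    using Digamma_reflection[OF assms] Digamma_plus1[OF w0(1)] by (simp add: algebra_simps)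
qed

lemma square_partial_fractions:
  fixes w :: complex
  assumes "w \<notin> \<int>"
  shows "(\<lambda>k. 1 / (w + of_nat (Suc k)) ^ 2 + 1 / (w - of_nat (Suc k)) ^ 2) sums
           (of_real pi ^ 2 / sin (of_real pi * w) ^ 2 - 1 / w ^ 2)"
proof -
  have w0: "w \<noteq> 0" "w + 1 \<noteq> 0" "1 - w \<noteq> 0" using not_Ints_imp_not_nonpos[OF assms] assms 
    by (auto simp: add.commute)
  have s: "(\<lambda>k. inverse ((z + of_nat k) ^ 2)) sums Polygamma 1 z" if "z \<noteq> 0" for z :: complex
    using Polygamma_LIMSEQ[OF that, of 1] by (simp add: numeral_2_eq_2)
  have "(\<lambda>k. inverse ((w + 1 + of_nat k) ^ 2) + inverse ((1 - w + of_nat k) ^ 2)) sums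
          (Polygamma 1 (w + 1) + Polygamma 1 (1 - w))"
    by (intro sums_add s w0)
  moreover have "inverse ((1 - w + of_nat k) ^ 2) = 1 / (w - of_nat (Suc k)) ^ 2" for k
    by (subst power2_commute) (simp add: divide_inverse algebra_simps)
  moreover have "inverse ((w + 1 + of_nat k) ^ 2) = 1 / (w + of_nat (Suc k)) ^ 2" for k
    by (simp add: divide_inverse add_ac)
  moreover have "of_real pi ^ 2 / sin (of_real pi * w) ^ 2 - 1 / w ^ 2 =
      Polygamma 1 (w + 1) + Polygamma 1 (1 - w)"
    unfolding Polygamma_reflection[OF assms, symmetric]
    using Polygamma_plus1[OF w0(1), of 1] by (simp add: power2_eq_square)
  ultimately show ?thesis
    by simp
qed

section \<open>A dominated double series over the lattice\<close>

text \<open>A majorant of product form makes the double family absolutely summable, so Fubini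
  applies. Row and column sums enter as given limits because the applications know both in closed
  form.\<close>

lemma suminf_swap_dominated:
  fixes d :: "nat \<Rightarrow> nat \<Rightarrow> complex"
  assumes bound: "\<And>m n. norm (d m n) \<le> a m * b n"
    and a: "summable a" "\<And>m. 0 \<le> a m" and b: "summable b" "\<And>n. 0 \<le> b n"
    and r: "\<And>m. (\<lambda>n. d m n) sums r m" and c: "\<And>n. (\<lambda>m. d m n) sums c n"
  shows "summable r" "summable c" "suminf r = suminf c"
proof -
  have sd: "summable (\<lambda>n. norm (d m n))" for m
    by (rule summable_comparison_test'[of "\<lambda>n. a m * b n" 0])
       (use b bound in \<open>auto intro: summable_mult\<close>)
  have sd': "summable (\<lambda>m. norm (d m n))" for n
    by (rule summable_comparison_test'[of "\<lambda>m. a m * b n" 0])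
       (use a bound in \<open>auto intro: summable_mult2\<close>)
  have "norm (r m) \<le> a m * suminf b" for m
  proof -
    have "norm (r m) \<le> (\<Sum>n. norm (d m n))"
      using summable_norm[OF sd[of m]] r[of m] by (simp add: sums_iff)
    also have "\<dots> \<le> (\<Sum>n. a m * b n)"
      by (intro suminf_le bound sd summable_mult b)
    finally show ?thesis using b by (simp add: suminf_mult)
  qed
  thus "summable r"
    by (intro summable_comparison_test'[OF summable_mult2[OF a(1), of "suminf b"], of 0])
  have "norm (c n) \<le> suminf a * b n" for n
  proof -
    have "norm (c n) \<le> (\<Sum>m. norm (d m n))"
      using summable_norm[OF sd'[of n]] c[of n] by (simp add: sums_iff)
    also have "\<dots> \<le> (\<Sum>m. a m * b n)"
      by (intro suminf_le bound sd' summable_mult2 a)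
    finally show ?thesis using a by (simp add: suminf_mult2)
  qed
  thus "summable c"
    by (intro summable_comparison_test'[OF summable_mult[OF b(1), of "suminf a"], of 0])
  have sa: "a summable_on UNIV" "b summable_on UNIV"
    using a b by (auto intro!: norm_summable_imp_summable_on)
  have "(\<lambda>(m, n). a m * b n) summable_on UNIV \<times> UNIV"
    using sa a b by (intro summable_on_SigmaI[where g = "\<lambda>m. a m * infsum b UNIV"])
      (auto intro!: has_sum_cmult_right summable_on_cmult_left has_sum_infsum)
  hence "(\<lambda>x. norm ((\<lambda>(m, n). d m n) x)) summable_on UNIV \<times> UNIV"
    by (rule Infinite_Sum.abs_summable_on_comparison_test') (use bound in auto)
  hence s: "(\<lambda>(m, n). d m n) summable_on UNIV \<times> UNIV"
    by (rule abs_summable_summable)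
  have ir: "infsum (\<lambda>n. d m n) UNIV = r m" for m
    using norm_summable_imp_has_sum[OF sd r] by (simp add: infsumI)
  have ic: "infsum (\<lambda>m. d m n) UNIV = c n" for n
    using norm_summable_imp_has_sum[OF sd' c] by (simp add: infsumI)
  have sr: "summable (\<lambda>m. norm (r m))"
    by (rule summable_comparison_test'[OF summable_mult2[OF a(1), of "suminf b"], of 0])
       (simp add: \<open>\<And>m. norm (r m) \<le> a m * suminf b\<close>)
  have sc: "summable (\<lambda>n. norm (c n))"
    by (rule summable_comparison_test'[OF summable_mult[OF b(1), of "suminf a"], of 0])
       (simp add: \<open>\<And>n. norm (c n) \<le> suminf a * b n\<close>)
  have "infsum r UNIV = infsum c UNIV"
    using infsum_swap_banach[OF s] by (simp add: ir ic)
  moreover have "infsum r UNIV = suminf r" "infsum c UNIV = suminf c"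
    using norm_summable_imp_has_sum[OF sr summable_sums[OF \<open>summable r\<close>]]
      norm_summable_imp_has_sum[OF sc summable_sums[OF \<open>summable c\<close>]] by (auto simp: infsumI)
  ultimately show "suminf r = suminf c" by simp
qed

section \<open>The variable q = exp(2 pi i z), the square of the classical nome, and the lattice
  terms\<close>

definition nome :: "complex \<Rightarrow> complex" where
  "nome z = exp (2 * of_real pi * \<i> * z)"

lemma nome_nonzero [simp]: "nome z \<noteq> 0"
  by (simp add: nome_def)

lemma norm_nome: "norm (nome z) = exp (- 2 * pi * Im z)"
  by (simp add: nome_def)

lemma norm_nome_less_1: "Im z > 0 \<Longrightarrow> norm (nome z) < 1"
  by (simp add: norm_nome)

lemma nome_neq_1: "Im z > 0 \<Longrightarrow> nome z \<noteq> 1"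
  using norm_nome_less_1[of z] by force

lemma nome_add: "nome (z + w) = nome z * nome w"
  by (simp add: nome_def ring_distribs exp_add)

lemma nome_of_nat_mult: "nome (of_nat n * z) = nome z ^ n"
  by (simp add: nome_def exp_of_nat_mult[symmetric] mult_ac)

lemma Im_pos_imp_not_Ints: "Im w \<noteq> 0 \<Longrightarrow> w \<notin> \<int>"
  by (auto elim!: Ints_cases)

text \<open>With u = exp(i pi w) the sine is a rational function of u. This turns the row sums of
  the lattice series into the terms of \<open>eisenstein2\<close>.\<close>

lemma sin_pi_nome:
  assumes "Im w > 0"
  shows "of_real pi ^ 2 / sin (of_real pi * w) ^ 2 = - 4 * of_real pi ^ 2 * (nome w / (1 - nome w) ^ 2)"
proof -
  define u where "u = exp (\<i> * (of_real pi * w))"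
  have [simp]: "u \<noteq> 0" by (simp add: u_def)
  have q: "nome w = u ^ 2"
    by (simp add: nome_def u_def exp_double[symmetric] mult_ac)
  have u1: "1 - u ^ 2 \<noteq> 0" using nome_neq_1[OF assms] q by simp
  have "sin (of_real pi * w) = (u - 1 / u) / (2 * \<i>)"
    unfolding sin_exp_eq u_def by (simp add: exp_minus inverse_eq_divide)
  also have "\<dots> = - (1 - u ^ 2) / (2 * \<i> * u)"
    by (simp add: field_simps power2_eq_square)
  finally have s: "sin (of_real pi * w) = - (1 - u ^ 2) / (2 * \<i> * u)" .
  have "sin (of_real pi * w) ^ 2 = - ((1 - u ^ 2) ^ 2 / (4 * u ^ 2))"
    unfolding s power_divide power_mult_distrib power2_minus by simp
  thus ?thesis
    using u1 unfolding q by (simp only:) (simp add: field_simps)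
qed

text \<open>The sign is chosen for the use at s/z, the negative of a point of the upper half plane.
  The right-hand side tends to i when q tends to 0.\<close>

lemma cot_pi_nome:
  assumes "Im w > 0"
  shows "cot (of_real pi * (- w)) = \<i> * (1 + nome w) / (1 - nome w)"
proof -
  define u where "u = exp (\<i> * (of_real pi * w))"
  have [simp]: "u \<noteq> 0" by (simp add: u_def)
  have q: "nome w = u ^ 2"
    by (simp add: nome_def u_def exp_double[symmetric] mult_ac)
  have u1: "1 - u ^ 2 \<noteq> 0" using nome_neq_1[OF assms] q by simp
  have sc: "sin (of_real pi * w) = (u - 1 / u) / (2 * \<i>)" "cos (of_real pi * w) = (u + 1 / u) / 2"
    unfolding sin_exp_eq cos_exp_eq u_def by (simp_all add: exp_minus inverse_eq_divide)
  have e: "(u - 1 / u) / (2 * \<i>) = - (1 - u ^ 2) / (2 * \<i> * u)"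
    by (simp add: field_simps power2_eq_square)
  have e': "(u + 1 / u) / 2 = (1 + u ^ 2) / (2 * u)"
    by (simp add: add_divide_distrib power2_eq_square)
  note s = trans[OF sc(1) e] and c = trans[OF sc(2) e']
  have "cot (of_real pi * (- w)) = - cos (of_real pi * w) / sin (of_real pi * w)"
    by (simp add: cot_def)
  also have "\<dots> = \<i> * (1 + u ^ 2) / (1 - u ^ 2)"
  proof -
    have "- ((1 + t) / (2 * u)) / (- (1 - t) / (2 * \<i> * u)) = \<i> * (1 + t) / (1 - t)" if "1 - t \<noteq> 0" for t
      using that by (simp add: divide_simps) (simp add: algebra_simps)
    thus ?thesis using u1 unfolding s c by blast
  qed
  finally show ?thesis unfolding q .
qed

text \<open>Equivalence of norms on the real plane with basis z, 1: the imaginary part controls s,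
  and then t = y - s z is controlled by the triangle inequality.\<close>

lemma norm_lattice_ge:
  assumes z: "Im z > 0"
  obtains K where "K > 0" "\<And>s t :: real. s \<ge> 0 \<Longrightarrow> (s + \<bar>t\<bar>) / K \<le> norm (of_real s * z + of_real t)"
proof
  define K where "K = 1 / Im z + 1 + norm z / Im z"
  show "K > 0" using z by (simp add: K_def add_pos_nonneg)
  fix s t :: real assume s: "s \<ge> 0"
  define y where "y = of_real s * z + of_real t"
  have "s * Im z = Im y" by (simp add: y_def)
  also have "\<dots> \<le> norm y" using abs_Im_le_cmod[of y] by linarith
  finally have 1: "s \<le> norm y / Im z" using z by (simp add: field_simps)
  have "\<bar>t\<bar> = norm (y - of_real s * z)" by (simp add: y_def)
  also have "\<dots> \<le> norm y + s * norm z"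
    using norm_triangle_ineq4[of y "of_real s * z"] s by (simp add: norm_mult)
  also have "\<dots> \<le> norm y + norm y / Im z * norm z"
    using 1 by (intro add_left_mono mult_right_mono) auto
  finally have "s + \<bar>t\<bar> \<le> norm y * K"
    using 1 by (simp add: K_def algebra_simps)
  thus "(s + \<bar>t\<bar>) / K \<le> norm (of_real s * z + of_real t)"
    using \<open>K > 0\<close> by (simp add: y_def divide_simps mult.commute)
qed

text \<open>The correction removes the leading term: 1/y^2 - 1/(y^2 - 1/4) has order y^-4. Since |y|
  and |y +- 1/2| are at least a constant times m + n, and (m + n)^4 \<ge> m^2 n^2, a majorant of
  product form results. The sign \<open>e\<close> treats n and -n together.\<close>

lemma lattice_term_bound:
  assumes z: "Im z > 0"
  obtains C where "C > 0" "\<And>m n :: nat. \<And>e :: real. m > 0 \<Longrightarrow> n > 0 \<Longrightarrow> \<bar>e\<bar> = 1 \<Longrightarrow>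
     (let y = of_nat m * z + of_real e * of_nat n in
       norm (1 / y ^ 2 - (1 / (y - 1/2) - 1 / (y + 1/2))) \<le> C / real m ^ 2 * (1 / real n ^ 2))"
proof -
  obtain K where K: "K > 0" "\<And>s t :: real. s \<ge> 0 \<Longrightarrow> (s + \<bar>t\<bar>) / K \<le> norm (of_real s * z + of_real t)"
    using norm_lattice_ge[OF z] by blast
  show ?thesis
  proof
    show "K ^ 4 > 0" using K by simp
    fix m n :: nat and e :: real assume m: "m > 0" and n: "n > 0" and e: "\<bar>e\<bar> = 1"
    define y where "y = of_nat m * z + of_real e * of_nat n"
    define T where "T = real m + real n"
    have T: "T > 0" using m by (simp add: T_def)
    have "T / K \<le> norm (of_real (real m) * z + of_real (e * real n))"
      using K(2)[of "real m" "e * real n"] e by (simp add: T_def abs_mult)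
    hence y1: "T / K \<le> norm y" by (simp add: y_def)
    have h: "(T / 2) / K \<le> norm (y + of_real h)" if "\<bar>h\<bar> = 1/2" for h :: real
    proof -
      have "\<bar>e * real n\<bar> = real n" using e by (simp add: abs_mult)
      hence "\<bar>e * real n + h\<bar> \<ge> real n - 1/2" using that by linarith
      hence "\<bar>e * real n + h\<bar> \<ge> real n / 2" using n by linarith
      hence "(T / 2) / K \<le> (real m + \<bar>e * real n + h\<bar>) / K"
        using K(1) by (intro divide_right_mono) (auto simp: T_def)
      also have "\<dots> \<le> norm (of_real (real m) * z + of_real (e * real n + h))"
        by (intro K) auto
      finally show ?thesis by (simp add: y_def add_ac)
    qed
    have y2: "(T / 2) / K \<le> norm (y - 1/2)" "(T / 2) / K \<le> norm (y + 1/2)"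
      using h[of "-1/2"] h[of "1/2"] by simp_all
    have pos: "T / K > 0" "T / 2 / K > 0" using T K by simp_all
    have npos: "0 < norm y" "0 < norm (y - 1/2)" "0 < norm (y + 1/2)" using y1 y2 pos by linarith+
    hence nz: "y \<noteq> 0" "y - 1/2 \<noteq> 0" "y + 1/2 \<noteq> 0" by simp_all
    have "1 / y ^ 2 - (1 / (y - 1/2) - 1 / (y + 1/2)) = - 1 / (4 * (y * y * ((y - 1/2) * (y + 1/2))))"
    proof -
      define a where "a = (y - 1/2) * (y + 1/2)"
      have a: "y ^ 2 = a + 1/4" "a \<noteq> 0" "a + 1/4 \<noteq> 0"
        using nz by (simp_all add: a_def) (simp_all add: algebra_simps power2_eq_square)
      have "1 / (y - 1/2) = (y + 1/2) / a" "1 / (y + 1/2) = (y - 1/2) / a"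
        unfolding a_def using nonzero_divide_mult_cancel_right[OF nz(3)] nonzero_divide_mult_cancel_left[OF nz(2)]
        by simp_all
      hence "1 / (y - 1/2) - 1 / (y + 1/2) = ((y + 1/2) - (y - 1/2)) / a"
        by (simp only: diff_divide_distrib)
      also have "(y + 1/2) - (y - 1/2) = 1" by simp
      finally have "1 / y ^ 2 - (1 / (y - 1/2) - 1 / (y + 1/2)) = 1 / (a + 1/4) - 1 / a"
        unfolding a(1) by simp
      also have "\<dots> = - 1 / (4 * ((a + 1/4) * a))"
        by (simp add: diff_frac_eq[OF a(3,2)] del: div_diff)
      also have "a + 1/4 = y * y" using a(1) by (simp add: power2_eq_square)
      finally show ?thesis unfolding a_def .
    qed
    also have "norm \<dots> = 1 / (4 * (norm y * norm y * (norm (y - 1/2) * norm (y + 1/2))))"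
      by (simp only: norm_divide norm_mult norm_minus_cancel) simp
    also have "\<dots> \<le> 1 / (4 * ((T / K) * (T / K) * ((T / 2 / K) * (T / 2 / K))))"
    proof (rule divide_left_mono)
      show "4 * ((T / K) * (T / K) * ((T / 2 / K) * (T / 2 / K))) \<le>
          4 * (norm y * norm y * (norm (y - 1/2) * norm (y + 1/2)))"
        by (intro mult_left_mono mult_mono y1 y2 mult_nonneg_nonneg less_imp_le[OF pos(1)] less_imp_le[OF pos(2)]) simp_all
      show "0 < 4 * (norm y * norm y * (norm (y - 1/2) * norm (y + 1/2))) *
          (4 * ((T / K) * (T / K) * ((T / 2 / K) * (T / 2 / K))))"
        by (intro mult_pos_pos pos npos) simp_all
    qed simp
    also have "\<dots> = K ^ 4 / T ^ 4"
      using T K by (simp add: field_simps power4_eq_xxxx)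
    also have "\<dots> \<le> K ^ 4 / (real m ^ 2 * real n ^ 2)"
    proof (rule divide_left_mono)
      have "real m ^ 2 * real n ^ 2 \<le> T ^ 2 * T ^ 2"
        by (intro mult_mono power_mono) (auto simp: T_def)
      thus "real m ^ 2 * real n ^ 2 \<le> T ^ 4" by (simp add: power_add[symmetric])
    qed (use m n T K in auto)
    finally show "let y = of_nat m * z + of_real e * of_nat n in
       norm (1 / y ^ 2 - (1 / (y - 1/2) - 1 / (y + 1/2))) \<le> K ^ 4 / real m ^ 2 * (1 / real n ^ 2)"
      by (simp add: y_def)
  qed
qed

text \<open>The partial fractions of the cotangent at s/z, divided by z. At half-integers s this
  evaluates the column sums of the telescoping correction.\<close>

lemma cot_lattice_sum:
  assumes z: "Im z > 0" and s: "s > 0"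
  shows "(\<lambda>m. 1 / (of_nat (Suc m) * z + of_real s) - 1 / (of_nat (Suc m) * z - of_real s)) sums
           (of_real pi / z * cot (of_real pi * (of_real s / z)) - 1 / of_real s)"
proof -
  have z0: "z \<noteq> 0" using z by auto
  have "Im (of_real s / z) = - s * Im z / (norm z)\<^sup>2"
    by (simp add: Im_divide cmod_power2)
  hence im: "Im (of_real s / z) \<noteq> 0" using z s z0 by simp
  have nz: "of_nat (Suc m) * z + of_real s \<noteq> 0" "of_nat (Suc m) * z - of_real s \<noteq> 0" for m
    using z by (auto simp: complex_eq_iff simp del: of_nat_Suc)
  have "(\<lambda>m. (1 / (of_real s / z + of_nat (Suc m)) + 1 / (of_real s / z - of_nat (Suc m))) / z) sums
     ((of_real pi * cot (of_real pi * (of_real s / z)) - 1 / (of_real s / z)) / z)"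
    by (intro sums_divide cot_partial_fractions Im_pos_imp_not_Ints im)
  moreover have "(1 / (of_real s / z + of_nat (Suc m)) + 1 / (of_real s / z - of_nat (Suc m))) / z =
     1 / (of_nat (Suc m) * z + of_real s) - 1 / (of_nat (Suc m) * z - of_real s)" for m
  proof -
    define M :: complex where "M = of_nat (Suc m)"
    have a: "M * z + of_real s \<noteq> 0" "M * z - of_real s \<noteq> 0" using nz[of m] by (simp_all add: M_def)
    have 1: "of_real s / z + M = (M * z + of_real s) / z" "of_real s / z - M = - (M * z - of_real s) / z"
      using z0 by (simp_all add: add_divide_distrib diff_divide_distrib)
    have "(1 / (a / z) + 1 / (- b / z)) / z = 1 / a - 1 / b" if "a \<noteq> 0" "b \<noteq> 0" for a b
      using that z0 by (simp add: field_simps)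
    thus ?thesis unfolding M_def[symmetric] 1 using a by blast
  qed
  moreover have "(of_real pi * cot (of_real pi * (of_real s / z)) - 1 / (of_real s / z)) / z =
    of_real pi / z * cot (of_real pi * (of_real s / z)) - 1 / of_real s"
    using z0 s by (simp add: diff_divide_distrib)
  ultimately show ?thesis by (simp only:)
qed

section \<open>The action of the modular group\<close>

abbreviation moebius :: "int ^ 2 ^ 2 \<Rightarrow> complex \<Rightarrow> complex" where
  "moebius A z \<equiv> moebius_num A z / moebius_den A z"

lemma mem_uhp [simp]: "z \<in> upper_half_plane \<longleftrightarrow> Im z > 0"
  by (simp add: upper_half_plane_def)

lemma open_uhp: "open upper_half_plane"
  unfolding upper_half_plane_def by (rule open_halfspace_Im_gt)

lemma convex_uhp: "convex upper_half_plane"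
  unfolding upper_half_plane_def by (rule convex_halfspace_Im_gt)

lemma moebius_den_nonzero:
  assumes "det A = 1" "Im z > 0"
  shows "moebius_den A z \<noteq> 0"
proof
  assume 0: "moebius_den A z = 0"
  hence "of_int (A $ 2 $ 1) * Im z = 0"
    by (simp add: moebius_den_def complex_eq_iff)
  hence c: "A $ 2 $ 1 = 0" using assms by simp
  with 0 have "A $ 2 $ 2 = 0" by (simp add: moebius_den_def)
  with c assms(1) show False by (simp add: det_2)
qed

lemma Im_moebius:
  assumes "det A = 1" "Im z > 0"
  shows "Im (moebius A z) = Im z / norm (moebius_den A z) ^ 2"
proof -
  have "Im (moebius A z) = Im (moebius_num A z * cnj (moebius_den A z)) / norm (moebius_den A z) ^ 2"
    by (subst complex_div_cnj) (simp flip: of_real_power)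
  also have "Im (moebius_num A z * cnj (moebius_den A z)) = of_int (det A) * Im z"
    by (simp add: moebius_num_def moebius_den_def det_2 algebra_simps)
  finally show ?thesis using assms by simp
qed

lemma Im_moebius_pos:
  assumes "det A = 1" "Im z > 0"
  shows "Im (moebius A z) > 0"
  using Im_moebius[OF assms] moebius_den_nonzero[OF assms] assms by simp

lemma moebius_den_mult:
  assumes "det B = 1" "Im z > 0"
  shows "moebius_den (A ** B) z = moebius_den A (moebius B z) * moebius_den B z"
  using moebius_den_nonzero[OF assms]
  by (simp add: moebius_den_def moebius_num_def matrix_matrix_mult_def sum_2 field_simps)

lemma moebius_mult:
  assumes "det A = 1" "det B = 1" "Im z > 0"
  shows "moebius (A ** B) z = moebius A (moebius B z)"
proof -
  have n: "moebius_num (A ** B) z = moebius_num A (moebius B z) * moebius_den B z"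
    using moebius_den_nonzero[OF assms(2,3)]
    by (simp add: moebius_den_def moebius_num_def matrix_matrix_mult_def sum_2 field_simps)
  show ?thesis
    unfolding n moebius_den_mult[OF assms(2,3)] using moebius_den_nonzero[OF assms(2,3)] by simp
qed

lemma slash_mult:
  assumes "det A = 1" "det B = 1" "Im z > 0"
  shows "slash k f (A ** B) z = slash k (slash k f A) B z"
  using moebius_mult[OF assms] moebius_den_mult[OF assms(2,3), of A]
  by (simp add: slash_def power_mult_distrib)

section \<open>Generators of the modular group, and reduction to imaginary part at least 1/5\<close>

definition S_mat :: "int ^ 2 ^ 2" where
  "S_mat = vector [vector [0, - 1], vector [1, 0]]"

definition T_mat :: "int \<Rightarrow> int ^ 2 ^ 2" where
  "T_mat n = vector [vector [1, n], vector [0, 1]]"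

lemma det_S_mat [simp]: "det S_mat = 1" and det_T_mat [simp]: "det (T_mat n) = 1"
  by (simp_all add: S_mat_def T_mat_def det_2)

lemma moebius_S_mat: "moebius_num S_mat z = - 1" "moebius_den S_mat z = z"
  and moebius_T_mat: "moebius_num (T_mat n) z = z + of_int n" "moebius_den (T_mat n) z = 1"
  by (simp_all add: S_mat_def T_mat_def moebius_num_def moebius_den_def)

text \<open>Euclid's algorithm on the first column: multiplication by S T^(-q) replaces the lower
  left entry c by a mod c. No case for inverses is needed, since the inverse of S is S^3 and the
  family T^n is closed under inversion.\<close>

lemma SL2Z_induct [consumes 1, case_names S T mult]:
  fixes A :: "int ^ 2 ^ 2"
  assumes "det A = 1" and S: "P S_mat" and T: "\<And>n. P (T_mat n)"
    and mult: "\<And>A B. det A = 1 \<Longrightarrow> det B = 1 \<Longrightarrow> P A \<Longrightarrow> P B \<Longrightarrow> P (A ** B)"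
  shows "P A"
  using assms(1)
proof (induction "nat \<bar>A $ 2 $ 1\<bar>" arbitrary: A rule: less_induct)
  case less
  note simps = vec_eq_iff forall_2 sum_2 matrix_matrix_mult_def S_mat_def T_mat_def
  show ?case
  proof (cases "A $ 2 $ 1 = 0")
    case True
    \<comment> \<open>S^2 = -1 takes care of the upper triangular matrices with diagonal entries
      -1.\<close>
    have SS: "P (S_mat ** S_mat)" "det (S_mat ** S_mat) = 1" by (auto intro!: mult S simp: det_mul)
    from True less.prems have ad: "A $ 1 $ 1 * A $ 2 $ 2 = 1" by (simp add: det_2)
    hence "A $ 1 $ 1 = 1 \<or> A $ 1 $ 1 = -1" by (metis zmult_eq_1_iff)
    thus ?thesis
    proof
      assume "A $ 1 $ 1 = 1"
      hence "A = T_mat (A $ 1 $ 2)" using ad True by (simp add: simps)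
      thus ?thesis using T by metis
    next
      assume "A $ 1 $ 1 = - 1"
      hence "A = (S_mat ** S_mat) ** T_mat (- A $ 1 $ 2)" using ad True by (simp add: simps)
      moreover have "P ((S_mat ** S_mat) ** T_mat (- A $ 1 $ 2))" by (intro mult SS T) auto
      ultimately show ?thesis by metis
    qed
  next
    case False
    define q where "q = A $ 1 $ 1 div A $ 2 $ 1"
    define B where "B = S_mat ** (T_mat (- q) ** A)"
    have "B $ 2 $ 1 = A $ 1 $ 1 mod A $ 2 $ 1"
      by (simp add: B_def simps q_def minus_div_mult_eq_mod[symmetric])
    moreover have "\<bar>A $ 1 $ 1 mod A $ 2 $ 1\<bar> < \<bar>A $ 2 $ 1\<bar>"
      using False by (rule abs_mod_less)
    ultimately have "nat \<bar>B $ 2 $ 1\<bar> < nat \<bar>A $ 2 $ 1\<bar>" by simp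
    moreover have B: "det B = 1" using less.prems by (simp add: B_def det_mul)
    ultimately have "P B" by (rule less.hyps)
    hence "P (T_mat q ** (S_mat ** (S_mat ** (S_mat ** B))))"
      using B by (intro mult S T) (auto simp: det_mul)
    moreover have "A = T_mat q ** (S_mat ** (S_mat ** (S_mat ** B)))"
      by (simp add: B_def simps algebra_simps)
    ultimately show ?thesis by metis
  qed
qed

text \<open>Only the transformation law; holomorphy and growth at the cusp are supplied separately,
  through \<open>q_expansion\<close> or by explicit estimates.\<close>

definition level_one :: "nat \<Rightarrow> (complex \<Rightarrow> complex) \<Rightarrow> bool" where
  "level_one k f \<longleftrightarrow> (\<forall>A z. det A = 1 \<longrightarrow> Im z > 0 \<longrightarrow> f (moebius A z) = moebius_den A z ^ k * f z)"

lemma level_oneI: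
  assumes T: "\<And>z. Im z > 0 \<Longrightarrow> f (z + 1) = f z"
    and S: "\<And>z. Im z > 0 \<Longrightarrow> f (- 1 / z) = z ^ k * f z"
  shows "level_one k f"
proof -
  have T1: "f (z + of_nat n) = f z" if "Im z > 0" for z n
  proof (induction n)
    case (Suc n)
    have "f (z + of_nat (Suc n)) = f ((z + of_nat n) + 1)" by (simp add: add_ac)
    also have "\<dots> = f z" using T[of "z + of_nat n"] that Suc by simp
    finally show ?case .
  qed simp
  have T2: "f (z + of_int n) = f z" if "Im z > 0" for z n
  proof (cases "n \<ge> 0")
    case True
    thus ?thesis using T1[OF that, of "nat n"] by simp
  next
    case False
    thus ?thesis using T1[of "z + of_int n" "nat (- n)"] that by simp
  qed
  have "\<forall>z. Im z > 0 \<longrightarrow> f (moebius A z) = moebius_den A z ^ k * f z" if "det A = 1" for A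
    using that
  proof (induction A rule: SL2Z_induct)
    case (mult A B)
    show ?case
    proof (intro allI impI)
      fix z :: complex assume z: "Im z > 0"
      have "f (moebius (A ** B) z) = moebius_den A (moebius B z) ^ k * f (moebius B z)"
        using mult Im_moebius_pos[OF mult(2) z] by (subst moebius_mult[OF mult(1,2) z]) auto
      thus "f (moebius (A ** B) z) = moebius_den (A ** B) z ^ k * f z"
        using mult z by (simp add: moebius_den_mult[OF mult(2) z] power_mult_distrib)
    qed
  qed (use S T2 in \<open>auto simp: moebius_S_mat moebius_T_mat\<close>)
  thus ?thesis by (auto simp: level_one_def)
qed

text \<open>Dirichlet approximation replaces the fundamental domain. With y = Im z and k at most
  about 1/sqrt y, the lower row (k, -h), completed by Bezout, gives |kz - h|^2 \<le> y + (2 sqrt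
  y)^2 = 5y. Any positive constant would serve for the compactness argument.\<close>

lemma exists_moebius_Im_ge:
  assumes z: "Im z > 0"
  obtains A where "det A = 1" "Im (moebius A z) \<ge> 1 / 5"
proof (cases "Im z \<ge> 1")
  case True
  thus ?thesis using that[of "T_mat 0"] by (simp add: moebius_T_mat)
next
  case False
  define y where "y = Im z"
  define n where "n = nat \<lceil>1 / sqrt y\<rceil>"
  have y: "0 < y" "y < 1" using z False by (auto simp: y_def)
  have n1: "real n \<ge> 1 / sqrt y" unfolding n_def by (rule real_nat_ceiling_ge)
  have n2: "real n \<le> 1 / sqrt y + 1" unfolding n_def using y
    by (smt (verit) of_nat_ceiling real_nat_ceiling_ge ceiling_correct divide_nonneg_nonneg nat_0_le of_int_of_nat_eq real_sqrt_ge_0_iff zero_le_ceiling)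
  have n0: "n > 0" using n1 y by (metis not_gr_zero of_nat_0 real_sqrt_gt_zero zero_less_divide_1_iff not_less)
  obtain h k where hk: "coprime h k" "0 < k" "k \<le> int n" "\<bar>of_int k * Re z - of_int h\<bar> < 1 / real n"
    using Dirichlet_approx_coprime[OF n0] by metis
  obtain u v where uv: "u * h + v * k = 1"
    using bezout_int[of h k] hk(1) by (metis coprime_imp_gcd_eq_1)
  define A :: "int ^ 2 ^ 2" where "A = vector [vector [- u, - v], vector [k, - h]]"
  have A: "det A = 1" using uv by (simp add: A_def det_2 algebra_simps)
  have den: "moebius_den A z = of_int k * z - of_int h" by (simp add: A_def moebius_den_def)
  have "norm (moebius_den A z) ^ 2 = (of_int k * Re z - of_int h) ^ 2 + (of_int k * y) ^ 2"
    by (simp add: den cmod_power2 y_def)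
  also have "(of_int k * Re z - of_int h) ^ 2 \<le> y"
  proof -
    have "1 / real n \<le> sqrt y" using n1 n0 y by (simp add: field_simps)
    hence "\<bar>of_int k * Re z - of_int h\<bar> \<le> sqrt y" using hk(4) by linarith
    hence "\<bar>of_int k * Re z - of_int h\<bar> ^ 2 \<le> sqrt y ^ 2" by (intro power_mono) auto
    thus ?thesis using y by simp
  qed
  also have "(of_int k * y) ^ 2 \<le> (2 * sqrt y) ^ 2"
  proof (rule power_mono)
    have "of_int k * y \<le> real n * y" using hk y by (intro mult_right_mono) auto
    also have "\<dots> \<le> (1 / sqrt y + 1) * y" using n2 y by (intro mult_right_mono) auto
    also have "\<dots> = sqrt y + sqrt y * sqrt y"
      using y by (simp add: distrib_right real_div_sqrt)
    also have "sqrt y * sqrt y \<le> sqrt y * 1" using y by (intro mult_left_mono) auto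
    finally show "of_int k * y \<le> 2 * sqrt y" by simp
  qed (use hk y in auto)
  finally have "norm (moebius_den A z) ^ 2 \<le> 5 * y" using y by (simp add: power_mult_distrib)
  moreover have "norm (moebius_den A z) ^ 2 > 0" using moebius_den_nonzero[OF A z] by simp
  ultimately have "1 / 5 \<le> y / norm (moebius_den A z) ^ 2" by (simp add: field_simps)
  thus ?thesis using that[OF A] Im_moebius[OF A z] by (simp add: y_def)
qed

section \<open>The Eisenstein series of weight 2\<close>

text \<open>The series is that of the divisor sums \<sigma>(n) q^n, kept in the shape in which the
  rows of the lattice sum produce it.\<close>

definition eisenstein2 :: "complex \<Rightarrow> complex" where
  "eisenstein2 z = 1 - 24 * (\<Sum>m. nome z ^ Suc m / (1 - nome z ^ Suc m) ^ 2)"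

lemma inverse_squares_sums_complex: "(\<lambda>n. 1 / (of_nat (Suc n)) ^ 2 :: complex) sums (of_real pi ^ 2 / 6)"
proof -
  have "(\<lambda>n. complex_of_real (1 / (real n + 1)\<^sup>2)) sums of_real (pi\<^sup>2 / 6)"
    by (rule sums_of_real) (use inverse_squares_sums in \<open>simp add: add.commute\<close>)
  thus ?thesis by (simp add: add.commute)
qed

text \<open>
  The double series of \<open>1/(mz+n)\<^sup>2\<close> gives \<open>E\<^sub>2(z)\<close> when summed over \<open>n\<close> first and \<open>z\<^sup>-\<^sup>2 E\<^sub>2(-1/z)\<close> when
  summed over \<open>m\<close> first, but it converges only conditionally. Subtracting the telescoping terms
  \<open>1/(mz+n-1/2) - 1/(mz+n+1/2)\<close> makes it absolutely convergent; the inhomogeneous term is the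
  limit of \<open>(\<pi>/z) cot(\<pi>s/z)\<close> as \<open>s\<close> tends to infinity.
\<close>

lemma eisenstein2_inversion:
  assumes z: "Im z > 0"
  shows "eisenstein2 (- 1 / z) = z ^ 2 * eisenstein2 z + 6 * z / (of_real pi * \<i>)"
proof -
  have z0: "z \<noteq> 0" using z by auto
  define z' where "z' = - 1 / z"
  have z': "Im z' > 0"
    using z by (simp add: z'_def Im_divide zero_less_divide_iff)
      (metis Im_complex_of_real complex_Re_le_cmod order.strict_iff_not sum_power2_gt_zero_iff less_irrefl)
  define g :: "complex \<Rightarrow> complex" where "g = (\<lambda>y. 1 / y ^ 2 - (1 / (y - 1/2) - 1 / (y + 1/2)))"
  define xm where "xm = (\<lambda>m. of_nat (Suc m) * z)"
  define N :: "nat \<Rightarrow> complex" where "N = (\<lambda>n. of_nat (Suc n))"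
  define d where "d = (\<lambda>m n. g (xm m + N n) + g (xm m - N n))"
  define lam where "lam = (\<lambda>q m. q ^ Suc m / (1 - q ^ Suc m) ^ 2 :: complex)"
  define C where "C = (\<lambda>s. of_real pi / z * cot (of_real pi * (of_real s / z)) - 1 / of_real s)"
  define r where "r = (\<lambda>m. (- 4 * of_real pi ^ 2 * lam (nome z) m - 1 / xm m ^ 2) -
     (1 / (xm m + of_real (1/2)) - 1 / (xm m - of_real (1/2))))"
  define c where "c = (\<lambda>n. (- 4 * of_real pi ^ 2 * lam (nome z') n - 1 / (N n / z) ^ 2) / z ^ 2
     - (C (real n + 1/2) - C (real (Suc n) + 1/2)))"
  have lamS: "of_real pi ^ 2 / sin (of_real pi * (of_nat (Suc m) * w)) ^ 2 = 
      - 4 * of_real pi ^ 2 * lam (nome w) m" if "Im w > 0" for w m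
    using that by (subst sin_pi_nome) (simp_all add: lam_def nome_of_nat_mult del: of_nat_Suc)
  obtain K where K: "K > 0" "\<And>m n :: nat. \<And>e :: real. m > 0 \<Longrightarrow> n > 0 \<Longrightarrow> \<bar>e\<bar> = 1 \<Longrightarrow>
     (let y = of_nat m * z + of_real e * of_nat n in
       norm (1 / y ^ 2 - (1 / (y - 1/2) - 1 / (y + 1/2))) \<le> K / real m ^ 2 * (1 / real n ^ 2))"
    using lattice_term_bound[OF z] by blast
  have bound: "norm (d m n) \<le> (2 * K / real (Suc m) ^ 2) * (1 / real (Suc n) ^ 2)" for m n
  proof -
    have "norm (g (xm m + N n)) \<le> K / real (Suc m) ^ 2 * (1 / real (Suc n) ^ 2)"
      using K(2)[of "Suc m" "Suc n" 1] by (simp add: g_def xm_def N_def Let_def del: of_nat_Suc)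
    moreover have "norm (g (xm m - N n)) \<le> K / real (Suc m) ^ 2 * (1 / real (Suc n) ^ 2)"
      using K(2)[of "Suc m" "Suc n" "-1"] by (simp add: g_def xm_def N_def Let_def del: of_nat_Suc)
    ultimately show ?thesis
      unfolding d_def by (intro order.trans[OF norm_triangle_ineq]) (simp del: of_nat_Suc add: field_simps)
  qed
  have sq: "summable (\<lambda>n. 1 / real (Suc n) ^ 2)"
    using inverse_squares_sums by (simp add: sums_iff add.commute)
  have rows: "(\<lambda>n. d m n) sums r m" for m
  proof -
    \<comment> \<open>Within a row the corrections at n and at -n both telescope; their sum is
      \<open>b n - b (Suc n)\<close>, and \<open>b\<close> tends to 0.\<close>
    define b where "b = (\<lambda>n. inverse ((xm m + 1/2) + of_nat n) + inverse ((1/2 - xm m) + of_nat n))"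
    have "b \<longlonglongrightarrow> 0 + 0" unfolding b_def
      by (intro tendsto_add filterlim_compose[OF tendsto_inverse_0]
              tendsto_add_filterlim_at_infinity[OF tendsto_const] tendsto_of_nat)
    hence b: "(\<lambda>n. b n - b (Suc n)) sums (b 0 - 0)"
      by (intro telescope_sums') simp
    have "Im (xm m) > 0" using z by (simp add: xm_def)
    hence nI: "xm m \<notin> \<int>" by (intro Im_pos_imp_not_Ints) simp
    have "(\<lambda>n. 1 / (xm m + N n) ^ 2 + 1 / (xm m - N n) ^ 2) sums
           (- 4 * of_real pi ^ 2 * lam (nome z) m - 1 / xm m ^ 2)"
      using square_partial_fractions[OF nI] lamS[OF z, of m]
      by (simp add: N_def xm_def del: of_nat_Suc)
    hence "(\<lambda>n. 1 / (xm m + N n) ^ 2 + 1 / (xm m - N n) ^ 2 - (b n - b (Suc n))) sums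
       (- 4 * of_real pi ^ 2 * lam (nome z) m - 1 / xm m ^ 2 - (b 0 - 0))"
      using b by (rule sums_diff)
    moreover have "1 / (xm m + N n) ^ 2 + 1 / (xm m - N n) ^ 2 - (b n - b (Suc n)) = d m n" for n
    proof -
      have "inverse ((1/2 - xm m) + of_nat k) = - (1 / (xm m - of_nat k - 1/2))" for k
        by (metis (no_types, opaque_lifting) add_diff_eq diff_diff_eq2 inverse_eq_divide inverse_minus_eq minus_diff_eq add.commute diff_diff_add)
      thus ?thesis
        by (simp add: b_def d_def g_def N_def inverse_eq_divide algebra_simps)
    qed
    moreover have "b 0 = 1 / (xm m + of_real (1/2)) - 1 / (xm m - of_real (1/2))"
      by (simp add: b_def inverse_eq_divide) (metis minus_diff_eq minus_divide_right)
    ultimately show ?thesis by (simp add: r_def)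
  qed
  have Csum: "(\<lambda>m. 1 / (xm m + of_real s) - 1 / (xm m - of_real s)) sums C s" if "s > 0" for s
    unfolding xm_def C_def by (rule cot_lattice_sum[OF z that])
  \<comment> \<open>Factoring out z turns a column into the square series at n/z, divided by z^2.
    The corrections are two cotangent sums, at the half-integers n + 1/2 and n + 3/2.\<close>
  have cols: "(\<lambda>m. d m n) sums c n" for n
  proof -
    have imw: "Im (N n / z) \<noteq> 0"
      using z z0 by (simp add: N_def Im_divide complex_eq_iff)
    have "sin (of_real pi * (N n / z)) = - sin (of_real pi * (of_nat (Suc n) * z'))"
      by (simp add: N_def z'_def flip: sin_minus)
    hence "of_real pi ^ 2 / sin (of_real pi * (N n / z)) ^ 2 = - 4 * of_real pi ^ 2 * lam (nome z') n"
      using lamS[OF z', of n] by simp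
    hence "(\<lambda>k. (1 / (N n / z + of_nat (Suc k)) ^ 2 + 1 / (N n / z - of_nat (Suc k)) ^ 2) / z ^ 2) sums
       ((- 4 * of_real pi ^ 2 * lam (nome z') n - 1 / (N n / z) ^ 2) / z ^ 2)"
      using sums_divide[OF square_partial_fractions[OF Im_pos_imp_not_Ints[OF imw]], of "z ^ 2"] by (simp only:)
    hence "(\<lambda>k. (1 / (N n / z + of_nat (Suc k)) ^ 2 + 1 / (N n / z - of_nat (Suc k)) ^ 2) / z ^ 2 -
        ((1 / (xm k + of_real (real n + 1/2)) - 1 / (xm k - of_real (real n + 1/2))) -
         (1 / (xm k + of_real (real (Suc n) + 1/2)) - 1 / (xm k - of_real (real (Suc n) + 1/2))))) sums c n"
      unfolding c_def by (intro sums_diff Csum) auto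
    moreover have "(1 / (N n / z + of_nat (Suc k)) ^ 2 + 1 / (N n / z - of_nat (Suc k)) ^ 2) / z ^ 2 -
        ((1 / (xm k + of_real (real n + 1/2)) - 1 / (xm k - of_real (real n + 1/2))) -
         (1 / (xm k + of_real (real (Suc n) + 1/2)) - 1 / (xm k - of_real (real (Suc n) + 1/2)))) = d k n" for k
    proof -
      have "(N n / z + of_nat (Suc k)) ^ 2 * z ^ 2 = (xm k + N n) ^ 2"
           "(N n / z - of_nat (Suc k)) ^ 2 * z ^ 2 = (xm k - N n) ^ 2"
      proof -
        have "(N n / z + of_nat (Suc k)) * z = xm k + N n" "(N n / z - of_nat (Suc k)) * z = - (xm k - N n)"
          using z0 by (simp_all add: xm_def distrib_right left_diff_distrib del: of_nat_Suc)
        thus "(N n / z + of_nat (Suc k)) ^ 2 * z ^ 2 = (xm k + N n) ^ 2"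
             "(N n / z - of_nat (Suc k)) ^ 2 * z ^ 2 = (xm k - N n) ^ 2"
          unfolding power_mult_distrib[symmetric] by (simp_all only: power2_minus)
      qed
      hence 1: "(1 / (N n / z + of_nat (Suc k)) ^ 2 + 1 / (N n / z - of_nat (Suc k)) ^ 2) / z ^ 2 =
        1 / (xm k + N n) ^ 2 + 1 / (xm k - N n) ^ 2"
        by (simp add: add_divide_distrib)
      have 2: "xm k + of_real (real n + 1/2) = xm k + N n - 1/2" "xm k - of_real (real n + 1/2) = xm k - N n + 1/2"
          "xm k + of_real (real (Suc n) + 1/2) = xm k + N n + 1/2" "xm k - of_real (real (Suc n) + 1/2) = xm k - N n - 1/2"
        by (simp_all add: N_def)
      show ?thesis unfolding 1 2 by (simp add: d_def g_def)
    qed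
    ultimately show ?thesis by (simp only:)
  qed
  note swap = suminf_swap_dominated[of d "\<lambda>m. 2 * K / real (Suc m) ^ 2" "\<lambda>n. 1 / real (Suc n) ^ 2" r c,
     OF bound _ _ sq _ rows cols]
  have "summable (\<lambda>m. 2 * K * (1 / real (Suc m) ^ 2))"
    by (intro summable_mult sq)
  hence sr: "summable r" and sc: "summable c" and eq: "suminf r = suminf c"
    using swap K(1) by (simp_all add: mult.assoc)
  have sX: "(\<lambda>m. 1 / xm m ^ 2) sums (of_real pi ^ 2 / 6 / z ^ 2)"
    using sums_divide[OF inverse_squares_sums_complex, of "z ^ 2"] by (simp add: xm_def power_mult_distrib del: of_nat_Suc)
  have "(\<lambda>m. r m + 1 / xm m ^ 2 + (1 / (xm m + of_real (1/2)) - 1 / (xm m - of_real (1/2)))) sums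
     (suminf r + of_real pi ^ 2 / 6 / z ^ 2 + C (1/2))"
    by (intro sums_add summable_sums sr sX Csum) simp
  hence 1: "(\<lambda>m. - 4 * of_real pi ^ 2 * lam (nome z) m) sums (suminf r + of_real pi ^ 2 / 6 / z ^ 2 + C (1/2))"
    unfolding r_def by simp
  from sums_divide[OF this, of "- 4 * of_real pi ^ 2"]
  have L1: "(\<lambda>m. lam (nome z) m) sums ((suminf r + of_real pi ^ 2 / 6 / z ^ 2 + C (1/2)) / (- 4 * of_real pi ^ 2))"
    by simp
  have "(\<lambda>n. C (real n + 1/2)) \<longlonglongrightarrow> of_real pi / z * (\<i> * (1 + 0) / (1 - 0)) - 0"
  proof -
    have nm: "(\<lambda>n. nome (z' / 2) * nome z' ^ n) \<longlonglongrightarrow> nome (z' / 2) * 0"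
      by (intro tendsto_mult tendsto_const LIMSEQ_power_zero norm_nome_less_1 z')
    have ct: "cot (of_real pi * (of_real (real n + 1/2) / z)) =
       \<i> * (1 + nome (z' / 2) * nome z' ^ n) / (1 - nome (z' / 2) * nome z' ^ n)" for n
    proof -
      have w: "of_real (real n + 1/2) / z = - (z' / 2 + of_nat n * z')"
        unfolding z'_def by (simp add: add_divide_distrib)
      have "Im (z' / 2 + of_nat n * z') > 0"
        using z' by (simp add: add_pos_nonneg)
      thus ?thesis
        unfolding w by (subst cot_pi_nome) (auto simp: nome_add nome_of_nat_mult)
    qed
    have inv: "(\<lambda>n. 1 / complex_of_real (real n + 1/2)) \<longlonglongrightarrow> 0"
    proof -
      have "(\<lambda>n. inverse (1/2 + of_nat n :: complex)) \<longlonglongrightarrow> 0"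
        by (intro filterlim_compose[OF tendsto_inverse_0]
              tendsto_add_filterlim_at_infinity[OF tendsto_const] tendsto_of_nat)
      thus ?thesis by (simp add: inverse_eq_divide add.commute)
    qed
    show ?thesis unfolding C_def ct
      by (intro tendsto_intros inv) (use nm in auto)
  qed
  hence "(\<lambda>n. C (real n + 1/2) - C (real (Suc n) + 1/2)) sums (C (real 0 + 1/2) - of_real pi * \<i> / z)"
    by (intro telescope_sums') simp
  hence Cs: "(\<lambda>n. C (real n + 1/2) - C (real (Suc n) + 1/2)) sums (C (1/2) - of_real pi * \<i> / z)"
    by simp
  have sN: "(\<lambda>n. 1 / (N n / z) ^ 2 / z ^ 2) sums (of_real pi ^ 2 / 6)"
    using inverse_squares_sums_complex z0 by (simp add: N_def power_divide del: of_nat_Suc)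
  have "(\<lambda>n. c n + (C (real n + 1/2) - C (real (Suc n) + 1/2)) + 1 / (N n / z) ^ 2 / z ^ 2) sums
    (suminf c + (C (1/2) - of_real pi * \<i> / z) + of_real pi ^ 2 / 6)"
    by (intro sums_add summable_sums sc Cs sN)
  hence "(\<lambda>n. - 4 * of_real pi ^ 2 * lam (nome z') n / z ^ 2) sums
    (suminf c + (C (1/2) - of_real pi * \<i> / z) + of_real pi ^ 2 / 6)"
    unfolding c_def by (simp add: diff_divide_distrib)
  from sums_divide[OF this, of "- 4 * of_real pi ^ 2 / z ^ 2"]
  have L2: "(\<lambda>n. lam (nome z') n) sums
    ((suminf c + (C (1/2) - of_real pi * \<i> / z) + of_real pi ^ 2 / 6) / (- 4 * of_real pi ^ 2 / z ^ 2))"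
    using z0 by simp
  \<comment> \<open>When the two expressions are compared, \<open>C (1/2)\<close> and the
    contributions of zeta(2) cancel. Only the limit pi i / z survives, as -6 i z / pi.\<close>
  have e1: "eisenstein2 z = 1 - 24 * ((suminf r + of_real pi ^ 2 / 6 / z ^ 2 + C (1/2)) / (- 4 * of_real pi ^ 2))"
    unfolding eisenstein2_def sums_unique[OF L1, unfolded lam_def] ..
  have e2: "eisenstein2 z' = 1 - 24 * ((suminf r + (C (1/2) - of_real pi * \<i> / z) + of_real pi ^ 2 / 6) / (- 4 * of_real pi ^ 2 / z ^ 2))"
    unfolding eisenstein2_def eq sums_unique[OF L2, unfolded lam_def] ..
  have pi0: "of_real pi \<noteq> (0 :: complex)" by simp
  have ii: "\<i> * \<i> = - 1" by simp
  have "6 * z / (of_real pi * \<i>) = - 6 * z * \<i> / of_real pi"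
    by (simp add: field_simps)
  hence "eisenstein2 z' = z ^ 2 * eisenstein2 z + 6 * z / (of_real pi * \<i>)"
    unfolding e1 e2 using z0 pi0 by (simp add: field_simps power2_eq_square)
  thus "eisenstein2 (- 1 / z) = z ^ 2 * eisenstein2 z + 6 * z / (of_real pi * \<i>)"
    by (simp add: z'_def)
qed

section \<open>Fourier expansions and the discriminant\<close>

text \<open>The coefficients are complex numbers that lie in \<int>: the same series can be summed
  as an analytic function and reduced modulo a prime ideal, since every subring contains
  \<int>.\<close>

definition integral_fps :: "complex fps \<Rightarrow> bool" where
  "integral_fps A \<longleftrightarrow> (\<forall>n. fps_nth A n \<in> \<int>)"

lemma integral_fps_add: "integral_fps A \<Longrightarrow> integral_fps B \<Longrightarrow> integral_fps (A + B)"
  and integral_fps_diff: "integral_fps A \<Longrightarrow> integral_fps B \<Longrightarrow> integral_fps (A - B)"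
  and integral_fps_mult: "integral_fps A \<Longrightarrow> integral_fps B \<Longrightarrow> integral_fps (A * B)"
  and integral_fps_deriv: "integral_fps A \<Longrightarrow> integral_fps (fps_deriv A)"
  and integral_fps_1: "integral_fps 1"
  and integral_fps_X: "integral_fps fps_X"
  and integral_fps_numeral: "integral_fps (numeral v)"
  by (auto simp: integral_fps_def fps_mult_nth fps_numeral_nth intro!: Ints_add Ints_diff Ints_mult Ints_sum)

lemma integral_fps_power: "integral_fps A \<Longrightarrow> integral_fps (A ^ n)"
  by (induction n) (auto intro: integral_fps_mult integral_fps_1)

lemma integral_fps_prod: "(\<And>i. i \<in> I \<Longrightarrow> integral_fps (A i)) \<Longrightarrow> integral_fps (\<Prod>i\<in>I. A i)"
  by (induction I rule: infinite_finite_induct) (auto intro: integral_fps_mult integral_fps_1)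

lemma integral_fps_inverse:
  assumes "integral_fps A" "fps_nth A 0 = 1"
  shows "integral_fps (inverse A)"
proof -
  have "fps_nth (inverse A) n \<in> \<int>" for n
  proof (induction n rule: less_induct)
    case (less n)
    show ?case
    proof (cases "n = 0")
      case False
      have "0 = fps_nth (inverse A * A) n"
        using assms(2) False by (subst inverse_mult_eq_1) auto
      also have "\<dots> = fps_nth (inverse A) n * fps_nth A 0 + (\<Sum>i<n. fps_nth (inverse A) i * fps_nth A (n - i))"
        by (simp add: fps_mult_nth atLeast0AtMost lessThan_Suc_atMost[symmetric])
      finally have "fps_nth (inverse A) n = - (\<Sum>i<n. fps_nth (inverse A) i * fps_nth A (n - i))"
        using assms(2) by (simp add: eq_neg_iff_add_eq_0)
      also have "\<dots> \<in> \<int>"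
        using less assms(1) by (intro Ints_minus Ints_sum Ints_mult) (auto simp: integral_fps_def)
      finally show ?thesis .
    qed (use assms(2) in simp)
  qed
  thus ?thesis by (simp add: integral_fps_def)
qed

text \<open>A relation rather than an operator: expansions are built by algebra and calculus on
  power series, and \<open>q_expansion_fourier_coeff\<close> identifies them with
  \<open>fourier_coeff\<close>. The radius condition makes \<open>eval_fps\<close> legitimate on the
  whole unit disc.\<close>

definition q_expansion :: "(complex \<Rightarrow> complex) \<Rightarrow> complex fps \<Rightarrow> bool" where
  "q_expansion f A \<longleftrightarrow> fps_conv_radius A \<ge> 1 \<and> (\<forall>z. Im z > 0 \<longrightarrow> f z = eval_fps A (nome z))"

lemma q_expansion_conv:
  assumes "q_expansion f A" "Im z > 0"
  shows "ereal (norm (nome z)) < fps_conv_radius A"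
proof -
  have "ereal (norm (nome z)) < 1" using norm_nome_less_1[OF assms(2)] by simp
  also have "1 \<le> fps_conv_radius A" using assms by (simp add: q_expansion_def)
  finally show ?thesis .
qed

lemma q_expansion_eval: "q_expansion f A \<Longrightarrow> Im z > 0 \<Longrightarrow> f z = eval_fps A (nome z)"
  by (simp add: q_expansion_def)

lemma q_expansion_add: "q_expansion f A \<Longrightarrow> q_expansion g B \<Longrightarrow> q_expansion (\<lambda>z. f z + g z) (A + B)"
  and q_expansion_diff: "q_expansion f A \<Longrightarrow> q_expansion g B \<Longrightarrow> q_expansion (\<lambda>z. f z - g z) (A - B)"
  and q_expansion_mult: "q_expansion f A \<Longrightarrow> q_expansion g B \<Longrightarrow> q_expansion (\<lambda>z. f z * g z) (A * B)"
  using order.trans[OF _ fps_conv_radius_add[of A B], of 1] order.trans[OF _ fps_conv_radius_diff[of A B], of 1]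
    order.trans[OF _ fps_conv_radius_mult[of A B], of 1] q_expansion_conv[of f A] q_expansion_conv[of g B]
  by (auto simp: q_expansion_def eval_fps_add eval_fps_diff eval_fps_mult)

lemma q_expansion_const: "q_expansion (\<lambda>z. c) (fps_const c)"
  by (simp add: q_expansion_def)

lemma q_expansion_numeral: "q_expansion (\<lambda>z. numeral n) (numeral n)"
  by (simp add: q_expansion_def)

lemma q_expansion_1: "q_expansion (\<lambda>z. 1) 1"
  by (simp add: q_expansion_def)

lemma q_expansion_nome: "q_expansion nome fps_X"
  by (simp add: q_expansion_def)

lemma q_expansion_power: "q_expansion f A \<Longrightarrow> q_expansion (\<lambda>z. f z ^ n) (A ^ n)"
  by (induction n) (auto intro: q_expansion_1 q_expansion_mult)

lemma q_expansion_cong: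
  assumes "q_expansion f A" "\<And>z. Im z > 0 \<Longrightarrow> g z = f z" "A = B"
  shows "q_expansion g B"
  using assms by (simp add: q_expansion_def)

lemma q_expansion_DERIV:
  assumes "q_expansion f A" "Im z > 0"
  shows "(f has_field_derivative 2 * of_real pi * \<i> * eval_fps (fps_X * fps_deriv A) (nome z)) (at z)"
proof -
  have conv: "ereal (norm (nome z)) < fps_conv_radius A"
    using assms by (rule q_expansion_conv)
  have conv': "ereal (norm (nome z)) < fps_conv_radius (fps_deriv A)"
    using conv fps_conv_radius_deriv[of A] by (rule less_le_trans)
  have "(nome has_field_derivative 2 * of_real pi * \<i> * nome z) (at z)"
    unfolding nome_def by (auto intro!: derivative_eq_intros)
  moreover have "(eval_fps A has_field_derivative eval_fps (fps_deriv A) (nome z)) (at (nome z))"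
    by (rule has_field_derivative_eval_fps[OF conv])
  ultimately have "((\<lambda>z. eval_fps A (nome z)) has_field_derivative
      eval_fps (fps_deriv A) (nome z) * (2 * of_real pi * \<i> * nome z)) (at z)"
    by (rule DERIV_chain2[rotated])
  also have "?this \<longleftrightarrow> (f has_field_derivative
      eval_fps (fps_deriv A) (nome z) * (2 * of_real pi * \<i> * nome z)) (at z)"
  proof (rule DERIV_cong_ev[OF refl _ refl])
    have "eventually (\<lambda>w. w \<in> {w. Im w > 0}) (nhds z)"
      using assms by (intro eventually_nhds_in_open open_halfspace_Im_gt) auto
    thus "\<forall>\<^sub>F w in nhds z. eval_fps A (nome w) = f w"
      by eventually_elim (use assms in \<open>simp add: q_expansion_def\<close>)
  qed
  finally show ?thesis
    using conv' by (simp add: eval_fps_mult mult_ac)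
qed

lemma q_expansion_holomorphic:
  assumes "q_expansion f A"
  shows "f holomorphic_on upper_half_plane"
  unfolding holomorphic_on_open[OF open_uhp]
  by (intro ballI exI, rule q_expansion_DERIV[OF assms]) simp

text \<open>\<open>qderiv\<close> is \<open>q d/dq = (2\<pi>i)\<^sup>-\<^sup>1 d/dz\<close>.\<close>

definition qderiv :: "(complex \<Rightarrow> complex) \<Rightarrow> complex \<Rightarrow> complex" where
  "qderiv f z = deriv f z / (2 * of_real pi * \<i>)"

lemma q_expansion_qderiv:
  assumes "q_expansion f A"
  shows "q_expansion (qderiv f) (fps_X * fps_deriv A)"
proof -
  have "1 \<le> min (fps_conv_radius fps_X) (fps_conv_radius (fps_deriv A))"
    using assms fps_conv_radius_deriv[of A] by (auto simp: q_expansion_def)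
  hence "1 \<le> fps_conv_radius (fps_X * fps_deriv A)"
    using fps_conv_radius_mult order.trans by blast
  moreover have "qderiv f z = eval_fps (fps_X * fps_deriv A) (nome z)" if "Im z > 0" for z
    using DERIV_imp_deriv[OF q_expansion_DERIV[OF assms that]] by (simp add: qderiv_def)
  ultimately show ?thesis by (simp add: q_expansion_def)
qed

lemma holomorphic_imp_q_expansion:
  assumes "F holomorphic_on ball 0 1"
  shows "q_expansion (\<lambda>z. F (nome z)) (fps_expansion F 0)"
proof -
  have *: "F holomorphic_on eball 0 1" using assms by (simp add: one_ereal_def)
  show ?thesis
    using conv_radius_fps_expansion[OF *] eval_fps_expansion'[OF *] norm_nome_less_1
    by (auto simp: q_expansion_def)
qed

section \<open>Euler's product over 1 - q^n on the unit disc (not the totient), and E_2 in terms of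
  it\<close>

definition euler_phi :: "complex \<Rightarrow> complex" where
  "euler_phi q = (\<Prod>k. 1 - q ^ Suc k)"

lemma one_minus_power_nonzero:
  fixes q :: complex
  assumes "norm q < 1"
  shows "1 - q ^ Suc i \<noteq> 0"
proof
  assume "1 - q ^ Suc i = 0"
  hence "norm q ^ Suc i = 1" by (metis eq_iff_diff_eq_0 norm_one norm_power)
  moreover have "norm q ^ Suc i < 1" using assms by (intro power_less_one_iff[THEN iffD2]) auto
  ultimately show False by simp
qed

text \<open>A geometric majorant on closed discs. Holomorphy, Taylor coefficients and logarithmic
  derivative of the product are all obtained from this as limits over the partial products.\<close>

lemma uniform_limit_euler_phi:
  assumes "0 \<le> r" "r < 1"
  shows "uniform_limit (cball 0 r) (\<lambda>n q. \<Prod>k<n. 1 - q ^ Suc k) euler_phi sequentially"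
proof -
  have uc: "uniformly_convergent_on (cball 0 r) (\<lambda>n q :: complex. \<Prod>k<n. 1 - q ^ Suc k)"
  proof (rule uniformly_convergent_on_prod')
    have "uniformly_convergent_on (cball 0 r) (\<lambda>n q :: complex. \<Sum>k<n. norm q ^ Suc k)"
    proof (rule uniformly_convergentI[OF Weierstrass_m_test])
      show "norm (norm q ^ Suc n) \<le> r ^ Suc n" if "q \<in> cball 0 r" for n and q :: complex
        using that by (simp del: power_Suc add: power_mono)
      show "summable (\<lambda>n. r ^ Suc n)" 
        using assms by (subst summable_Suc_iff) (simp add: summable_geometric)
    qed
    thus "uniformly_convergent_on (cball 0 r) (\<lambda>n q :: complex. \<Sum>k<n. norm (1 - q ^ Suc k - 1))"
      by (simp add: norm_power norm_mult)
  qed (auto intro!: continuous_intros)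
  have ul: "uniform_limit (cball 0 r) (\<lambda>n q :: complex. \<Prod>k<n. 1 - q ^ Suc k)
      (\<lambda>q. lim (\<lambda>n. \<Prod>k<n. 1 - q ^ Suc k)) sequentially"
    using uc uniformly_convergent_uniform_limit_iff by blast
  have conv: "convergent_prod (\<lambda>k. 1 - q ^ Suc k)" if "q \<in> cball 0 r" for q :: complex
  proof -
    have "norm q < 1" using that assms by simp
    hence "summable (\<lambda>k. norm ((1 - q ^ Suc k) - 1))"
      by (simp add: norm_mult norm_power summable_mult summable_geometric)
    hence "abs_convergent_prod (\<lambda>k. 1 - q ^ Suc k)"
      by (rule summable_imp_abs_convergent_prod)
    thus ?thesis by (rule abs_convergent_prod_imp_convergent_prod)
  qed
  have eq: "lim (\<lambda>n. \<Prod>k<n. 1 - q ^ Suc k) = euler_phi q" if "q \<in> cball 0 r" for q :: complex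
    unfolding euler_phi_def
    by (rule prodinf_eq_lim'[OF conv[OF that] one_minus_power_nonzero, symmetric]) (use that assms in auto)
  show ?thesis
    by (rule uniform_limit_cong'[THEN iffD1, OF _ _ ul]) (use eq in simp_all)
qed

lemma euler_phi_nonzero:
  assumes "norm q < 1"
  shows "euler_phi q \<noteq> 0"
  unfolding euler_phi_def
proof (rule prodinf_nonzero)
  have "summable (\<lambda>k. norm ((1 - q ^ Suc k) - 1))"
    using assms by (simp add: norm_mult norm_power summable_mult summable_geometric)
  hence "abs_convergent_prod (\<lambda>k. 1 - q ^ Suc k)"
    by (rule summable_imp_abs_convergent_prod)
  thus "convergent_prod (\<lambda>k. 1 - q ^ Suc k)" by (rule abs_convergent_prod_imp_convergent_prod)
qed (rule one_minus_power_nonzero[OF assms])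

lemma holomorphic_euler_phi: "euler_phi holomorphic_on ball 0 1"
proof (rule holomorphic_uniform_sequence)
  show "(\<lambda>q. \<Prod>k<n. 1 - q ^ Suc k) holomorphic_on ball 0 1" for n
    by (intro holomorphic_intros)
  fix x :: complex assume x: "x \<in> ball 0 1"
  define d where "d = (1 - norm x) / 2"
  define r where "r = (1 + norm x) / 2"
  have d: "d > 0" and r: "0 \<le> r" "r < 1" using x by (auto simp: d_def r_def add_nonneg_nonneg)
  have sub: "cball x d \<subseteq> cball 0 r"
  proof
    fix y assume "y \<in> cball x d"
    hence "norm (y - x) \<le> d" by (simp add: dist_norm norm_minus_commute)
    hence "norm y \<le> norm x + d" using norm_triangle_ineq2[of y x] by linarith
    also have "\<dots> = r" by (simp add: d_def r_def field_simps)
    finally show "y \<in> cball 0 r" by simp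
  qed
  have ul: "uniform_limit (cball x d) (\<lambda>n q. \<Prod>k<n. 1 - q ^ Suc k) euler_phi sequentially"
    by (rule uniform_limit_on_subset[OF uniform_limit_euler_phi[OF r] sub])
  have "cball x d \<subseteq> ball 0 1" using sub r(2) by (force simp: subset_iff)
  thus "\<exists>d>0. cball x d \<subseteq> ball 0 1 \<and>
      uniform_limit (cball x d) (\<lambda>n q. \<Prod>k<n. 1 - q ^ Suc k) euler_phi sequentially"
    using d ul by blast
qed auto

definition euler_fps :: "complex fps" where
  "euler_fps = fps_expansion euler_phi 0"

lemma euler_fps_nth_0: "fps_nth euler_fps 0 = 1"
  by (simp add: euler_fps_def fps_expansion_def euler_phi_def)

lemma uniform_limit_euler_phi_half:
  "uniform_limit (ball 0 (1/2)) (\<lambda>n q. \<Prod>k<n. 1 - q ^ Suc k) euler_phi sequentially"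
  by (rule uniform_limit_on_subset[OF uniform_limit_euler_phi[of "1/2"]]) auto

text \<open>The partial products are polynomials over \<int>, their Taylor coefficients converge to
  those of the product, and \<int> is closed in \<complex>.\<close>

lemma integral_euler_fps: "integral_fps euler_fps"
  unfolding integral_fps_def
proof
  fix m
  define a where "a = (\<lambda>n. (deriv ^^ m) (\<lambda>q. \<Prod>k<n. 1 - q ^ Suc k) (0 :: complex) / fact m)"
  have lim: "a \<longlonglongrightarrow> (deriv ^^ m) euler_phi 0 / fact m"
    unfolding a_def
  proof (rule tendsto_divide[OF higher_deriv_complex_uniform_limit[OF uniform_limit_euler_phi_half]])
    show "\<forall>\<^sub>F n in sequentially. (\<lambda>q. \<Prod>k<n. 1 - q ^ Suc k) holomorphic_on (ball 0 (1/2) :: complex set)"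
      by (intro always_eventually allI holomorphic_intros)
  qed auto
  have "a n \<in> \<int>" for n
  proof -
    define A :: "complex fps" where "A = (\<Prod>k<n. 1 - fps_X ^ Suc k)"
    have "(\<lambda>q. \<Prod>k<n. 1 - q ^ Suc k) has_fps_expansion A"
      unfolding A_def by (intro fps_expansion_intros)
    hence "fps_expansion (\<lambda>q. \<Prod>k<n. 1 - q ^ Suc k) 0 = A" by (rule fps_expansion_eqI)
    hence "a n = fps_nth A m" by (auto simp: a_def fps_expansion_def)
    moreover have "integral_fps A"
      unfolding A_def by (intro integral_fps_prod integral_fps_diff integral_fps_1 integral_fps_power integral_fps_X)
    ultimately show ?thesis by (simp add: integral_fps_def)
  qed
  hence "(deriv ^^ m) euler_phi 0 / fact m \<in> \<int>"
    by (rule closed_sequentially[OF closed_Ints _ lim])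
  thus "fps_nth euler_fps m \<in> \<int>"
    by (simp add: euler_fps_def fps_expansion_def)
qed

lemma euler_phi_logderiv:
  assumes "norm q < 1"
  shows "(\<lambda>k. - (of_nat (Suc k) * q ^ k) / (1 - q ^ Suc k)) sums (deriv euler_phi q / euler_phi q)"
proof -
  obtain r where r: "norm q < r" "r < 1" using assms dense by blast
  have ul: "uniform_limit (ball 0 r) (\<lambda>n q. \<Prod>k<n. 1 - q ^ Suc k) euler_phi sequentially"
    using r order.trans[OF norm_ge_zero[of q] less_imp_le[OF r(1)]]
    by (intro uniform_limit_on_subset[OF uniform_limit_euler_phi[of r]]) auto
  have "(\<lambda>k. deriv (\<lambda>q. 1 - q ^ Suc k) q / (1 - q ^ Suc k)) sums (deriv euler_phi q / euler_phi q)"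
    using r by (intro logderiv_prodinf_complex_uniform_limit[OF ul] euler_phi_nonzero assms holomorphic_intros) auto
  moreover have "deriv (\<lambda>q. 1 - q ^ Suc k) q = - (of_nat (Suc k) * q ^ k)" for k
    by (rule DERIV_imp_deriv) (auto intro!: derivative_eq_intros simp del: power_Suc)
  ultimately show ?thesis by simp
qed

text \<open>Both sides are the double series of n q^(mn), summed over n first or over m first. The
  majorant uses (m + 1)(n + 1) \<ge> m + n.\<close>

lemma lambert_swap:
  fixes q :: complex
  assumes q: "norm q < 1"
  shows "(\<Sum>m. q ^ Suc m / (1 - q ^ Suc m) ^ 2) = (\<Sum>n. of_nat (Suc n) * q ^ Suc n / (1 - q ^ Suc n))"
proof (rule suminf_swap_dominated(3))
  define d where "d = (\<lambda>m n. of_nat (Suc n) * q ^ (Suc m * Suc n))"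
  have small: "norm (q ^ Suc m) < 1" for m
    using q by (simp only: norm_power) (intro power_less_one_iff[THEN iffD2], auto)
  show "norm (d m n) \<le> norm q ^ m * (real (Suc n) * norm q ^ n)" for m n
  proof -
    have "norm q ^ (Suc m * Suc n) \<le> norm q ^ (m + n)"
      using q by (intro power_decreasing) auto
    hence "real (Suc n) * norm q ^ (Suc m * Suc n) \<le> real (Suc n) * norm q ^ (m + n)"
      by (intro mult_left_mono) auto
    thus ?thesis by (simp only: d_def norm_mult norm_power norm_of_nat power_add mult_ac)
  qed
  show "summable (\<lambda>m. norm q ^ m)" using q by (simp add: summable_geometric)
  show "summable (\<lambda>n. real (Suc n) * norm q ^ n)"
    using geometric_deriv_sums[of "norm q"] q by (auto simp: sums_iff)
  show "(\<lambda>n. d m n) sums (q ^ Suc m / (1 - q ^ Suc m) ^ 2)" for m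
  proof -
    have "(\<lambda>n. q ^ Suc m * (of_nat (Suc n) * (q ^ Suc m) ^ n)) sums (q ^ Suc m * (1 / (1 - q ^ Suc m) ^ 2))"
      by (intro sums_mult geometric_deriv_sums small)
    moreover have "q ^ Suc m * (of_nat (Suc n) * (q ^ Suc m) ^ n) = d m n" for n
    proof -
      have "q ^ (Suc m * Suc n) = q ^ (Suc m + Suc m * n)" by simp
      also have "\<dots> = q ^ Suc m * (q ^ Suc m) ^ n" by (simp only: power_add power_mult)
      finally show ?thesis unfolding d_def by (simp only: mult.left_commute)
    qed
    ultimately show ?thesis by (simp only: times_divide_eq_right mult_1_right)
  qed
  show "(\<lambda>m. d m n) sums (of_nat (Suc n) * q ^ Suc n / (1 - q ^ Suc n))" for n
  proof -
    have "(\<lambda>m. of_nat (Suc n) * q ^ Suc n * (q ^ Suc n) ^ m) sums (of_nat (Suc n) * q ^ Suc n * (1 / (1 - q ^ Suc n)))"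
      by (intro sums_mult geometric_sums small)
    moreover have "of_nat (Suc n) * q ^ Suc n * (q ^ Suc n) ^ m = d m n" for m
    proof -
      have "Suc m * Suc n = Suc n + Suc n * m" by simp
      hence "q ^ (Suc m * Suc n) = q ^ (Suc n + Suc n * m)" by (rule arg_cong)
      also have "\<dots> = q ^ Suc n * (q ^ Suc n) ^ m" by (simp only: power_add power_mult)
      finally show ?thesis unfolding d_def by (simp only: mult.assoc)
    qed
    ultimately show ?thesis by (simp only: times_divide_eq_right mult_1_right)
  qed
qed auto

text \<open>After \<open>lambert_swap\<close> the series is the one in
  \<open>euler_phi_logderiv\<close>, up to the factor -q. Hence E_2 is the logarithmic q-derivative
  of q times the 24th power of Euler's product.\<close>

lemma eisenstein2_euler_phi:
  assumes "Im z > 0"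
  shows "eisenstein2 z = 1 + 24 * (nome z * deriv euler_phi (nome z) / euler_phi (nome z))"
proof -
  define q where "q = nome z"
  have q: "norm q < 1" using norm_nome_less_1[OF assms] by (simp add: q_def)
  have "(\<lambda>k. - q * (- (of_nat (Suc k) * q ^ k) / (1 - q ^ Suc k))) sums (- q * (deriv euler_phi q / euler_phi q))"
    by (intro sums_mult euler_phi_logderiv q)
  hence "(\<lambda>k. of_nat (Suc k) * q ^ Suc k / (1 - q ^ Suc k)) sums (- q * (deriv euler_phi q / euler_phi q))"
    by (simp add: mult_ac)
  hence "(\<Sum>m. q ^ Suc m / (1 - q ^ Suc m) ^ 2) = - q * (deriv euler_phi q / euler_phi q)"
    unfolding lambert_swap[OF q] by (rule sums_unique[symmetric])
  thus ?thesis unfolding eisenstein2_def q_def by simp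
qed

text \<open>\<open>euler_fps\<close> is integral with constant term 1, so its inverse and its
  logarithmic derivative are integral too.\<close>

lemma eisenstein2_q_expansion:
  obtains A where "integral_fps A" "q_expansion eisenstein2 (1 + 24 * A)"
proof
  define F where "F = (\<lambda>q. q * deriv euler_phi q * inverse (euler_phi q))"
  have hol: "F holomorphic_on ball 0 1"
    unfolding F_def using euler_phi_nonzero by (intro holomorphic_intros holomorphic_euler_phi) auto
  have "euler_phi has_fps_expansion euler_fps"
    unfolding euler_fps_def
    by (rule has_fps_expansion_fps_expansion[OF _ _ holomorphic_euler_phi]) auto
  hence "F has_fps_expansion (fps_X * fps_deriv euler_fps * inverse euler_fps)"
    unfolding F_def by (intro fps_expansion_intros) (auto simp: euler_fps_nth_0)
  hence "fps_expansion F 0 = fps_X * fps_deriv euler_fps * inverse euler_fps"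
    by (rule fps_expansion_eqI)
  thus "integral_fps (fps_expansion F 0)"
    by (simp add: integral_fps_mult integral_fps_X integral_fps_deriv integral_fps_inverse
          integral_euler_fps euler_fps_nth_0)
  show "q_expansion eisenstein2 (1 + 24 * fps_expansion F 0)"
  proof (rule q_expansion_cong)
    show "q_expansion (\<lambda>z. 1 + 24 * F (nome z)) (1 + 24 * fps_expansion F 0)"
      by (intro q_expansion_add q_expansion_mult q_expansion_1 q_expansion_numeral
          holomorphic_imp_q_expansion hol)
  qed (simp_all add: eisenstein2_euler_phi F_def divide_inverse)
qed

section \<open>The discriminant as a product, and its transformation law\<close>

definition discriminant :: "complex \<Rightarrow> complex" where
  "discriminant z = nome z * euler_phi (nome z) ^ 24"

lemma discriminant_nonzero: "Im z > 0 \<Longrightarrow> discriminant z \<noteq> 0"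
  using euler_phi_nonzero[OF norm_nome_less_1] by (simp add: discriminant_def)

lemma discriminant_q_expansion: "q_expansion discriminant (fps_X * euler_fps ^ 24)"
  unfolding discriminant_def[abs_def] euler_fps_def
  by (intro q_expansion_mult q_expansion_nome q_expansion_power holomorphic_imp_q_expansion holomorphic_euler_phi)

lemma DERIV_discriminant:
  assumes "Im z > 0"
  shows "(discriminant has_field_derivative 2 * of_real pi * \<i> * eisenstein2 z * discriminant z) (at z)"
proof -
  define P where "P = euler_phi (nome z)"
  have P: "P \<noteq> 0" using euler_phi_nonzero[OF norm_nome_less_1[OF assms]] by (simp add: P_def)
  have n: "(nome has_field_derivative 2 * of_real pi * \<i> * nome z) (at z)"
    unfolding nome_def by (auto intro!: derivative_eq_intros)
  have "(euler_phi has_field_derivative deriv euler_phi (nome z)) (at (nome z))"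
    using norm_nome_less_1[OF assms] by (intro holomorphic_derivI[OF holomorphic_euler_phi]) auto
  from DERIV_chain2[OF this n]
  have e: "((\<lambda>z. euler_phi (nome z)) has_field_derivative
      deriv euler_phi (nome z) * (2 * of_real pi * \<i> * nome z)) (at z)" .
  have "(discriminant has_field_derivative
     2 * of_real pi * \<i> * nome z * P ^ 24 + (24 * P ^ 23 * (deriv euler_phi (nome z) * (2 * of_real pi * \<i> * nome z))) * nome z) (at z)"
    unfolding discriminant_def[abs_def] using DERIV_mult[OF n DERIV_power[OF e, of 24]]
    by (simp add: P_def mult_ac)
  moreover have "P ^ 24 = P * P ^ 23" by (simp flip: power_Suc)
  ultimately show ?thesis
    unfolding eisenstein2_euler_phi[OF assms] discriminant_def P_def[symmetric]
    using P by (simp add: field_simps)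
qed

lemma nome_plus_1: "nome (z + 1) = nome z"
  by (simp add: nome_add) (simp add: nome_def)

lemma q_expansion_periodic: "q_expansion f A \<Longrightarrow> Im z > 0 \<Longrightarrow> f (z + 1) = f z"
  by (simp add: q_expansion_def nome_plus_1)

lemma Im_inversion_pos: "Im z > 0 \<Longrightarrow> Im (- 1 / z) > 0"
  using Im_moebius_pos[of S_mat z] by (simp add: moebius_S_mat)

lemma DERIV_inversion:
  assumes "z \<noteq> (0 :: complex)"
  shows "((\<lambda>z. - 1 / z) has_field_derivative 1 / z ^ 2) (at z)"
  using assms by (auto intro!: derivative_eq_intros simp: power2_eq_square field_simps)

text \<open>The quotient \<open>R\<close> of the two sides has derivative 0: 2 pi i times the
  inhomogeneous term of \<open>eisenstein2_inversion\<close> is 12 z, which matches the derivative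
  of z^12. The constant is read off at the fixed point z = i, where i^12 = 1.\<close>

lemma discriminant_inversion:
  assumes "Im z > 0"
  shows "discriminant (- 1 / z) = z ^ 12 * discriminant z"
proof -
  define R where "R = (\<lambda>z. discriminant (- 1 / z) / (z ^ 12 * discriminant z))"
  have "(R has_field_derivative 0) (at z)" if z: "Im z > 0" for z
  proof -
    have z0: "z \<noteq> 0" using z by auto
    define a where "a = discriminant (- 1 / z)"
    define b where "b = discriminant z"
    define c where "c = 2 * of_real pi * \<i>"
    have c: "c * (6 * z / (of_real pi * \<i>)) = 12 * z" by (simp add: c_def)
    have b: "b \<noteq> 0" using discriminant_nonzero[OF z] by (simp add: b_def)
    have 1: "((\<lambda>z. discriminant (- 1 / z)) has_field_derivative c * eisenstein2 (- 1 / z) * a * (1 / z ^ 2)) (at z)"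
      unfolding c_def a_def
      by (rule DERIV_chain2[OF DERIV_discriminant[OF Im_inversion_pos[OF z]] DERIV_inversion[OF z0]])
    have 2: "((\<lambda>z. z ^ 12 * discriminant z) has_field_derivative 12 * z ^ 11 * b + c * eisenstein2 z * b * z ^ 12) (at z)"
      using DERIV_mult[OF DERIV_power[OF DERIV_ident, of 12] DERIV_discriminant[OF z]] by (simp add: b_def c_def mult_ac)
    have "c * eisenstein2 (- 1 / z) * a * (1 / z ^ 2) * (z ^ 12 * b) -
        a * (12 * z ^ 11 * b + c * eisenstein2 z * b * z ^ 12) = 0"
    proof -
      have "c * eisenstein2 (- 1 / z) = c * z ^ 2 * eisenstein2 z + 12 * z"
        unfolding eisenstein2_inversion[OF z] ring_distribs c by simp
      hence "c * eisenstein2 (- 1 / z) * a * (1 / z ^ 2) * (z ^ 12 * b) =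
        (c * z ^ 2 * eisenstein2 z + 12 * z) * a * b * (z ^ 12 / z ^ 2)" by simp
      also have "z ^ 12 / z ^ 2 = z ^ 10" using z0 by (simp add: power_diff[symmetric])
      finally show ?thesis by (simp add: algebra_simps power_add[symmetric] flip: power_Suc)
    qed
    hence "((c * eisenstein2 (- 1 / z) * a * (1 / z ^ 2)) * (z ^ 12 * b) -
        a * (12 * z ^ 11 * b + c * eisenstein2 z * b * z ^ 12)) / ((z ^ 12 * b) * (z ^ 12 * b)) = 0" by simp
    thus ?thesis
      unfolding R_def using DERIV_divide[OF 1 2] z0 b by (simp add: a_def b_def)
  qed
  then obtain K where K: "\<And>z. Im z > 0 \<Longrightarrow> R z = K"
    using has_field_derivative_zero_constant[OF convex_uhp, of R] has_field_derivative_at_within by (metis mem_uhp)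
  have "R \<i> = 1" using discriminant_nonzero[of \<i>] by (simp add: R_def)
  hence "R z = 1" using K assms by (metis imaginary_unit.sel(2) zero_less_one)
  thus ?thesis using discriminant_nonzero[OF assms] assms by (auto simp: R_def)
qed

lemma level_one_discriminant: "level_one 12 discriminant"
  by (rule level_oneI[OF q_expansion_periodic[OF discriminant_q_expansion] discriminant_inversion])

section \<open>Eisenstein series of weights 4 and 6\<close>

text \<open>The transformation law is differentiated. The term c z is there for the quasimodular
  E_2, with k = 2; for E_4 it is used with c = 0.\<close>

lemma qderiv_inversion:
  assumes f: "q_expansion f A" and z: "Im z > 0"
    and inv: "\<And>z. Im z > 0 \<Longrightarrow> f (- 1 / z) = z ^ k * f z + c * z"
  shows "qderiv f (- 1 / z) = z ^ (k + 2) * qderiv f z +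
           (of_nat k * z ^ (k + 1) * f z + c * z ^ 2) / (2 * of_real pi * \<i>)"
proof -
  have z0: "z \<noteq> 0" using z by auto
  define D where "D = (\<lambda>z. deriv f z)"
  have D: "(f has_field_derivative D z) (at z)" if "Im z > 0" for z
    using DERIV_imp_deriv[OF q_expansion_DERIV[OF f that]] q_expansion_DERIV[OF f that] by (simp add: D_def)
  have "((\<lambda>z. f (- 1 / z)) has_field_derivative D (- 1 / z) * (1 / z ^ 2)) (at z)"
    by (rule DERIV_chain2[OF D[OF Im_inversion_pos[OF z]] DERIV_inversion[OF z0]])
  moreover have "((\<lambda>z. f (- 1 / z)) has_field_derivative
      (of_nat k * z ^ (k - 1) * f z + D z * z ^ k) + c) (at z)"
  proof (subst DERIV_cong_ev[OF refl _ refl])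
    have "eventually (\<lambda>w. w \<in> {w. Im w > 0}) (nhds z)"
      using z by (intro eventually_nhds_in_open open_halfspace_Im_gt) auto
    thus "\<forall>\<^sub>F w in nhds z. f (- 1 / w) = w ^ k * f w + c * w"
      by eventually_elim (use inv in simp)
    have 1: "((\<lambda>z. z ^ k) has_field_derivative of_nat k * z ^ (k - 1)) (at z)"
      by (auto intro!: derivative_eq_intros)
    have 2: "((\<lambda>z. c * z) has_field_derivative c) (at z)"
      by (auto intro!: derivative_eq_intros)
    show "((\<lambda>w. w ^ k * f w + c * w) has_field_derivative
        (of_nat k * z ^ (k - 1) * f z + D z * z ^ k) + c) (at z)"
      by (rule DERIV_add[OF DERIV_mult[OF 1 D[OF z]] 2])
  qed
  ultimately have "D (- 1 / z) * (1 / z ^ 2) = of_nat k * z ^ (k - 1) * f z + D z * z ^ k + c"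
    by (rule DERIV_unique)
  hence "D (- 1 / z) * (1 / z ^ 2) * z ^ 2 = (of_nat k * z ^ (k - 1) * f z + D z * z ^ k + c) * z ^ 2"
    by simp
  hence "D (- 1 / z) = of_nat k * (z ^ (k - 1) * z ^ 2) * f z + D z * (z ^ k * z ^ 2) + c * z ^ 2"
    using z0 by (simp add: algebra_simps)
  also have "of_nat k * (z ^ (k - 1) * z ^ 2) = of_nat k * z ^ (k + 1)"
    by (cases k) (simp_all add: power2_eq_square)
  finally show ?thesis
    unfolding qderiv_def D_def by (simp add: add_divide_distrib power_add power2_eq_square mult_ac)
qed

text \<open>Ramanujan's differential equation for E_2, turned into the definition of E_4: modularity
  and integrality then follow from those of E_2 without a second lattice sum.\<close>

definition eisenstein4 :: "complex \<Rightarrow> complex" where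
  "eisenstein4 z = eisenstein2 z ^ 2 - 12 * qderiv eisenstein2 z"

text \<open>Four times the normalised Eisenstein series of weight 6: a Serre derivative.\<close>

definition eisenstein6 :: "complex \<Rightarrow> complex" where
  "eisenstein6 z = 4 * eisenstein2 z * eisenstein4 z - 12 * qderiv eisenstein4 z"

lemma eisenstein4_inversion:
  assumes "Im z > 0"
  shows "eisenstein4 (- 1 / z) = z ^ 4 * eisenstein4 z"
proof -
  obtain A where A: "q_expansion eisenstein2 (1 + 24 * A)" by (rule eisenstein2_q_expansion)
  define t where "t = 2 * of_real pi * \<i>"
  define c where "c = 6 / (of_real pi * \<i>)"
  define e where "e = eisenstein2 z"
  define d where "d = qderiv eisenstein2 z"
  have inv: "eisenstein2 (- 1 / z) = z ^ 2 * eisenstein2 z + c * z" if "Im z > 0" for z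
    using eisenstein2_inversion[OF that] by (simp add: c_def)
  \<comment> \<open>The factor 12 in the definition is forced by 12 / (2 pi i) = c: it makes the
    inhomogeneous terms cancel.\<close>
  have t: "12 * (x / t) = c * x" for x by (simp add: t_def c_def)
  have "eisenstein4 (- 1 / z) = (z ^ 2 * e + c * z) ^ 2 - 12 * (z ^ 4 * d + (2 * z ^ 3 * e + c * z ^ 2) / t)"
    unfolding eisenstein4_def using inv[OF assms] qderiv_inversion[OF A assms inv]
    by (simp add: t_def e_def d_def numeral_eq_Suc)
  also have "\<dots> = (z ^ 2 * e + c * z) ^ 2 - 12 * z ^ 4 * d - 12 * ((2 * z ^ 3 * e + c * z ^ 2) / t)"
    by (simp add: algebra_simps)
  also have "\<dots> = z ^ 4 * (e ^ 2 - 12 * d)"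
    unfolding t by (simp add: power2_eq_square power3_eq_cube power4_eq_xxxx algebra_simps)
  finally show ?thesis by (simp add: eisenstein4_def e_def d_def)
qed

text \<open>48 is what the squaring of 1 + 24 A yields directly. It divides the true constant 240,
  and it is divisible by 2 and by 3.\<close>

lemma eisenstein4_q_expansion:
  obtains A B where "integral_fps A" "integral_fps B" "q_expansion eisenstein2 (1 + 24 * A)"
    "q_expansion eisenstein4 (1 + 48 * B)"
proof -
  obtain A where A: "integral_fps A" "q_expansion eisenstein2 (1 + 24 * A)" by (rule eisenstein2_q_expansion)
  define B where "B = A + 12 * A ^ 2 - 6 * (fps_X * fps_deriv A)"
  have "integral_fps B"
    unfolding B_def by (intro integral_fps_add integral_fps_diff integral_fps_mult integral_fps_power
        integral_fps_numeral integral_fps_X integral_fps_deriv A)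
  moreover have "q_expansion eisenstein4 (1 + 48 * B)"
  proof (rule q_expansion_cong)
    show "q_expansion (\<lambda>z. eisenstein2 z ^ 2 - 12 * qderiv eisenstein2 z)
       ((1 + 24 * A) ^ 2 - 12 * (fps_X * fps_deriv (1 + 24 * A)))"
      by (intro q_expansion_diff q_expansion_power q_expansion_mult q_expansion_numeral q_expansion_qderiv A)
    have "fps_deriv (1 + 24 * A) = 24 * fps_deriv A" by (simp add: fps_deriv_mult)
    thus "(1 + 24 * A) ^ 2 - 12 * (fps_X * fps_deriv (1 + 24 * A)) = 1 + 48 * B"
      unfolding B_def by (simp add: power2_eq_square algebra_simps)
  qed (simp add: eisenstein4_def)
  ultimately show ?thesis using that A by blast
qed

lemma eisenstein6_inversion:
  assumes "Im z > 0"
  shows "eisenstein6 (- 1 / z) = z ^ 6 * eisenstein6 z"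
proof -
  obtain A B where B: "q_expansion eisenstein4 (1 + 48 * B)" by (rule eisenstein4_q_expansion)
  define t where "t = 2 * of_real pi * \<i>"
  define c where "c = 6 / (of_real pi * \<i>)"
  define e where "e = eisenstein2 z"
  define h where "h = eisenstein4 z"
  define d where "d = qderiv eisenstein4 z"
  have inv2: "eisenstein2 (- 1 / z) = z ^ 2 * e + c * z"
    using eisenstein2_inversion[OF assms] by (simp add: c_def e_def)
  have inv: "eisenstein4 (- 1 / z) = z ^ 4 * eisenstein4 z + 0 * z" if "Im z > 0" for z
    using eisenstein4_inversion[OF that] by simp
  have t: "12 * (x / t) = c * x" for x by (simp add: t_def c_def)
  have "eisenstein6 (- 1 / z) = 4 * (z ^ 2 * e + c * z) * (z ^ 4 * h) - 12 * (z ^ 6 * d + 4 * z ^ 5 * h / t)"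
    unfolding eisenstein6_def inv2 eisenstein4_inversion[OF assms] using qderiv_inversion[OF B assms inv]
    by (simp add: t_def h_def d_def numeral_eq_Suc)
  also have "\<dots> = 4 * (z ^ 2 * e + c * z) * (z ^ 4 * h) - 12 * z ^ 6 * d - 12 * (4 * z ^ 5 * h / t)"
    by (simp add: algebra_simps)
  also have "\<dots> = z ^ 6 * (4 * e * h - 12 * d)"
    unfolding t by (simp add: numeral_eq_Suc algebra_simps)
  finally show ?thesis by (simp add: eisenstein6_def e_def h_def d_def)
qed

text \<open>The constant term 4 = 1 + 3 is absorbed into \<open>C\<close>; the multiple of E_6 is
  normalised only modulo 3.\<close>

lemma eisenstein6_q_expansion:
  obtains C where "integral_fps C" "q_expansion eisenstein6 (1 + 3 * C)"
proof -
  obtain A B where A: "integral_fps A" "q_expansion eisenstein2 (1 + 24 * A)"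
    and B: "integral_fps B" "q_expansion eisenstein4 (1 + 48 * B)" by (rule eisenstein4_q_expansion)
  define C where "C = 1 + 32 * A + 64 * B + 1536 * A * B - 192 * (fps_X * fps_deriv B)"
  have "integral_fps C"
    unfolding C_def by (intro integral_fps_add integral_fps_diff integral_fps_mult integral_fps_1
        integral_fps_numeral integral_fps_X integral_fps_deriv A B)
  moreover have "q_expansion eisenstein6 (1 + 3 * C)"
  proof (rule q_expansion_cong)
    show "q_expansion (\<lambda>z. 4 * eisenstein2 z * eisenstein4 z - 12 * qderiv eisenstein4 z)
       (4 * (1 + 24 * A) * (1 + 48 * B) - 12 * (fps_X * fps_deriv (1 + 48 * B)))"
      by (intro q_expansion_diff q_expansion_mult q_expansion_numeral q_expansion_qderiv A B)
    have "fps_deriv (1 + 48 * B) = 48 * fps_deriv B" by (simp add: fps_deriv_mult)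
    thus "4 * (1 + 24 * A) * (1 + 48 * B) - 12 * (fps_X * fps_deriv (1 + 48 * B)) = 1 + 3 * C"
      unfolding C_def by (simp add: algebra_simps)
  qed (simp add: eisenstein6_def)
  ultimately show ?thesis using that by blast
qed

lemma level_one_eisenstein4: "level_one 4 eisenstein4"
  and level_one_eisenstein6: "level_one 6 eisenstein6"
proof -
  obtain A B where B: "q_expansion eisenstein4 (1 + 48 * B)" by (rule eisenstein4_q_expansion)
  show "level_one 4 eisenstein4"
    by (rule level_oneI[OF q_expansion_periodic[OF B] eisenstein4_inversion])
  obtain C where C: "q_expansion eisenstein6 (1 + 3 * C)" by (rule eisenstein6_q_expansion)
  show "level_one 6 eisenstein6"
    by (rule level_oneI[OF q_expansion_periodic[OF C] eisenstein6_inversion])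
qed

section \<open>Modular forms with character\<close>

lemma bounded_at_i_infinity_mult:
  assumes "bounded_at_i_infinity f" "bounded_at_i_infinity g"
  shows "bounded_at_i_infinity (\<lambda>z. f z * g z)"
proof -
  obtain B C where 1: "\<And>z. Im z > max 0 B \<Longrightarrow> norm (f z) \<le> C"
    using assms(1) by (auto simp: bounded_at_i_infinity_def)
  obtain B' C' where 2: "\<And>z. Im z > max 0 B' \<Longrightarrow> norm (g z) \<le> C'"
    using assms(2) by (auto simp: bounded_at_i_infinity_def)
  have "norm (f z * g z) \<le> C * C'" if "Im z > max 0 (max B B')" for z
    unfolding norm_mult using 1[of z] 2[of z] that order.trans[OF norm_ge_zero[of "f z"], of C]
    by (intro mult_mono) auto
  thus ?thesis unfolding bounded_at_i_infinity_def by blast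
qed

lemma bounded_at_i_infinity_add:
  assumes "bounded_at_i_infinity f" "bounded_at_i_infinity g"
  shows "bounded_at_i_infinity (\<lambda>z. f z + g z)"
proof -
  obtain B C where 1: "\<And>z. Im z > max 0 B \<Longrightarrow> norm (f z) \<le> C"
    using assms(1) by (auto simp: bounded_at_i_infinity_def)
  obtain B' C' where 2: "\<And>z. Im z > max 0 B' \<Longrightarrow> norm (g z) \<le> C'"
    using assms(2) by (auto simp: bounded_at_i_infinity_def)
  have "norm (f z + g z) \<le> C + C'" if "Im z > max 0 (max B B')" for z
    using 1[of z] 2[of z] that norm_triangle_ineq[of "f z" "g z"] by auto
  thus ?thesis unfolding bounded_at_i_infinity_def by blast
qed

lemma bounded_at_i_infinity_const: "bounded_at_i_infinity (\<lambda>z. c)"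
  by (auto simp: bounded_at_i_infinity_def)

lemma bounded_at_i_infinity_cong:
  assumes "bounded_at_i_infinity f" "\<And>z. Im z > 0 \<Longrightarrow> g z = f z"
  shows "bounded_at_i_infinity g"
  using assms unfolding bounded_at_i_infinity_def by (metis max.strict_boundedE)

lemma bounded_at_i_infinity_prod:
  "(\<And>i. i \<in> I \<Longrightarrow> bounded_at_i_infinity (f i)) \<Longrightarrow> bounded_at_i_infinity (\<lambda>z. \<Prod>i\<in>I. f i z)"
  by (induction I rule: infinite_finite_induct)
     (auto intro: bounded_at_i_infinity_mult bounded_at_i_infinity_const)

lemma Gamma0_det: "A \<in> Gamma0 N \<Longrightarrow> det A = 1"
  by (simp add: Gamma0_def)

lemma Gamma0_coprime:
  fixes A :: "int ^ 2 ^ 2"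
  assumes "A \<in> Gamma0 N"
  shows "coprime (A $ 2 $ 2) (int N)"
proof (rule coprimeI)
  fix d assume d: "d dvd A $ 2 $ 2" "d dvd int N"
  hence "d dvd A $ 2 $ 1" using assms by (auto simp: Gamma0_def)
  hence "d dvd A $ 1 $ 1 * A $ 2 $ 2 - A $ 1 $ 2 * A $ 2 $ 1" using d by simp
  thus "is_unit d" using Gamma0_det[OF assms] by (simp add: det_2)
qed

lemma modular_formD:
  fixes f :: "complex \<Rightarrow> complex"
  assumes "modular_form k N chi f"
  shows "f holomorphic_on upper_half_plane"
    and "\<And>(A :: int ^ 2 ^ 2) z. A \<in> Gamma0 N \<Longrightarrow> Im z > 0 \<Longrightarrow>
           f (moebius A z) = chi (A $ 2 $ 2) * moebius_den A z ^ k * f z"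
    and "\<And>A. det A = 1 \<Longrightarrow> bounded_at_i_infinity (slash k f A)"
  using assms by (auto simp: modular_form_def)

lemma modular_form_mult:
  assumes f: "modular_form k N chi f" and g: "modular_form l N psi g"
  shows "modular_form (k + l) N (\<lambda>d. chi d * psi d) (\<lambda>z. f z * g z)"
proof -
  have "slash (k + l) (\<lambda>z. f z * g z) A = (\<lambda>z. slash k f A z * slash l g A z)" for A
    by (simp add: slash_def power_add fun_eq_iff)
  thus ?thesis
    using modular_formD[OF f] modular_formD[OF g] unfolding modular_form_def
    by (auto intro!: holomorphic_on_mult bounded_at_i_infinity_mult simp: power_add)
qed

lemma modular_form_add:
  assumes f: "modular_form k N chi f" and g: "modular_form k N chi g"
  shows "modular_form k N chi (\<lambda>z. f z + g z)"
proof -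
  have "slash k (\<lambda>z. f z + g z) A = (\<lambda>z. slash k f A z + slash k g A z)" for A
    by (simp add: slash_def add_divide_distrib fun_eq_iff)
  thus ?thesis
    using modular_formD[OF f] modular_formD[OF g] unfolding modular_form_def
    by (auto intro!: holomorphic_on_add bounded_at_i_infinity_add simp: ring_distribs)
qed

lemma modular_form_cmult:
  assumes f: "modular_form k N chi f"
  shows "modular_form k N chi (\<lambda>z. c * f z)"
proof -
  have "slash k (\<lambda>z. c * f z) A = (\<lambda>z. c * slash k f A z)" for A
    by (simp add: slash_def fun_eq_iff)
  thus ?thesis
    using modular_formD[OF f] unfolding modular_form_def
    by (auto intro!: holomorphic_intros bounded_at_i_infinity_mult bounded_at_i_infinity_const)
qed

lemma modular_form_diff:
  assumes "modular_form k N chi f" "modular_form k N chi g"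
  shows "modular_form k N chi (\<lambda>z. f z - g z)"
  using modular_form_add[OF assms(1) modular_form_cmult[OF assms(2), of "-1"]] by simp

lemma modular_form_one: "modular_form 0 N (\<lambda>_. 1) (\<lambda>_. 1)"
proof -
  have "slash 0 (\<lambda>_. 1) A = (\<lambda>_. 1)" for A
    by (simp add: slash_def fun_eq_iff)
  thus ?thesis by (simp add: modular_form_def bounded_at_i_infinity_const)
qed

lemma modular_form_power:
  assumes f: "modular_form k N chi f"
  shows "modular_form (n * k) N (\<lambda>d. chi d ^ n) (\<lambda>z. f z ^ n)"
proof (induction n)
  case (Suc n)
  show ?case using modular_form_mult[OF f Suc] by simp
qed (simp add: modular_form_one)

text \<open>Lower right entries of matrices in \<open>Gamma0 N\<close> are prime to N, so only the
  values on units matter. A power of a character that is trivial on the units may thus be replaced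
  by the constant 1.\<close>

lemma modular_form_cong_character:
  assumes "modular_form k N chi f" "\<And>d. coprime d (int N) \<Longrightarrow> chi d = psi d"
  shows "modular_form k N psi f"
  using assms Gamma0_coprime unfolding modular_form_def by metis

lemma modular_form_level_mono:
  assumes "modular_form k N chi f" "N dvd M"
  shows "modular_form k M chi f"
proof -
  have "Gamma0 M \<subseteq> Gamma0 N"
    using assms(2) by (auto simp: Gamma0_def)
  thus ?thesis using assms unfolding modular_form_def by blast
qed

lemma eval_fps_bounded:
  assumes "1 \<le> fps_conv_radius A" "r < 1"
  obtains C where "\<And>q :: complex. norm q \<le> r \<Longrightarrow> norm (eval_fps A q) \<le> C"
proof -
  have "ereal r < fps_conv_radius A" using assms by (metis ereal_less(3) less_le_trans)
  hence "continuous_on (cball 0 r) (eval_fps A)"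
    by (intro continuous_on_subset[OF continuous_on_eval_fps])
       (auto simp: eball_def intro: le_less_trans[of _ "ereal r"])
  hence "bounded (eval_fps A ` cball 0 r)"
    by (intro compact_imp_bounded compact_continuous_image) auto
  then obtain C where "\<forall>x\<in>eval_fps A ` cball 0 r. norm x \<le> C" unfolding bounded_iff by blast
  thus ?thesis by (intro that[of C]) auto
qed

lemma norm_nome_le: "Im z \<ge> y \<Longrightarrow> norm (nome z) \<le> exp (- 2 * pi * y)"
  by (simp add: norm_nome)

lemma q_expansion_bounded:
  assumes "q_expansion f A"
  shows "bounded_at_i_infinity f"
proof -
  obtain C where C: "\<And>q. norm q \<le> exp (- 2 * pi) \<Longrightarrow> norm (eval_fps A q) \<le> C"
    using eval_fps_bounded[of A "exp (- 2 * pi)"] assms by (auto simp: q_expansion_def)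
  have "norm (f z) \<le> C" if "Im z > max 0 1" for z
    using C[of "nome z"] norm_nome_le[of 1 z] that q_expansion_eval[OF assms, of z] by simp
  thus ?thesis unfolding bounded_at_i_infinity_def by blast
qed

text \<open>Every slash of f is f itself, so boundedness at infinity is boundedness at all
  cusps.\<close>

lemma level_one_imp_modular_form:
  assumes "level_one k f" "q_expansion f A"
  shows "modular_form k N (\<lambda>_. 1) f"
  unfolding modular_form_def
proof (intro conjI ballI)
  fix B assume "B \<in> carrier SL2Z"
  hence B: "det B = 1" by simp
  show "bounded_at_i_infinity (slash k f B)"
  proof (rule bounded_at_i_infinity_cong[OF q_expansion_bounded[OF assms(2)]])
    fix z assume "Im z > 0"
    thus "slash k f B z = f z"
      using assms(1) B moebius_den_nonzero[OF B] by (simp add: level_one_def slash_def)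
  qed
qed (use assms in \<open>auto simp: level_one_def Gamma0_det intro: q_expansion_holomorphic\<close>)

section \<open>Existence and uniqueness of q-expansions\<close>

lemma nome_eq_imp:
  assumes "nome z = nome w"
  obtains n :: int where "z = w + of_int n"
proof -
  obtain n :: int where n: "2 * of_real pi * \<i> * z = 2 * of_real pi * \<i> * w + (of_int (2 * n) * pi) * \<i>"
    using assms by (auto simp: nome_def exp_eq)
  hence "2 * of_real pi * \<i> * z = 2 * of_real pi * \<i> * (w + of_int n)"
    by (simp add: algebra_simps)
  hence "z = w + of_int n" by simp
  thus ?thesis using that by blast
qed

lemma nome_Ln: "q \<noteq> 0 \<Longrightarrow> nome (Ln q / (2 * of_real pi * \<i>)) = q"
  by (simp add: nome_def)

lemma Im_nome_pos:
  assumes "norm (nome w) < 1"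
  shows "Im w > 0"
  using assms by (simp add: norm_nome mult_less_0_iff zero_less_mult_iff)

text \<open>By periodicity f factors through q. The factor \<open>g\<close> is written with the
  principal logarithm but is holomorphic across the cut as well; boundedness removes the singularity
  at 0, and the Taylor series of the extension is the expansion.\<close>

lemma periodic_holomorphic_q_expansion:
  assumes hol: "f holomorphic_on upper_half_plane"
    and per: "\<And>z (n :: int). Im z > 0 \<Longrightarrow> f (z + of_int n) = f z"
    and bd: "bounded_at_i_infinity f"
  obtains A where "q_expansion f A"
proof -
  define t where "t = 2 * of_real pi * \<i>"
  have t: "t \<noteq> 0" by (simp add: t_def)
  define g where "g = (\<lambda>q. f (Ln q / t))"
  have eq: "f z = f w" if "nome z = nome w" "Im w > 0" for z w
    using nome_eq_imp[OF that(1)] per[OF that(2)] by metis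
  have gn: "g (nome z) = f z" if "Im z > 0" for z
    unfolding g_def t_def by (rule eq) (use that in \<open>simp_all add: nome_Ln\<close>)
  have "g field_differentiable at q within ball 0 1 - {0}" if q: "q \<in> ball 0 1 - {0}" for q
  proof -
    \<comment> \<open>A local inverse of \<open>nome\<close> near q: the quotient x / q is close to
      1 and stays away from the cut of \<open>Ln\<close>.\<close>
    define L where "L = (\<lambda>x. (Ln (x / q) + Ln q) / t)"
    have q0: "q \<noteq> 0" "norm q < 1" using q by auto
    have nL: "nome (L x) = x" if "x \<noteq> 0" for x
      using that q0 t by (simp add: L_def nome_def t_def[symmetric] exp_add)
    have "L field_differentiable at q"
      unfolding L_def using q0 t
      by (intro derivative_intros field_differentiable_compose_within) (auto simp: field_differentiable_def intro!: exI derivative_eq_intros)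
    moreover have "f field_differentiable at (L q)"
      using nL[OF q0(1)] q0 Im_nome_pos[of "L q"]
      by (intro holomorphic_on_imp_differentiable_at[OF hol open_uhp]) auto
    ultimately have "(f \<circ> L) field_differentiable at q"
      by (rule field_differentiable_compose)
    then obtain D where D: "((f \<circ> L) has_field_derivative D) (at q)"
      by (auto simp: field_differentiable_def)
    have "eventually (\<lambda>x. x \<in> ball 0 1 - {0}) (nhds q)"
      using q by (intro eventually_nhds_in_open) auto
    hence ev: "eventually (\<lambda>x. (f \<circ> L) x = g x) (nhds q)"
    proof eventually_elim
      case (elim x)
      hence "nome (L x) = x" using nL by auto
      thus ?case using gn[of "L x"] Im_nome_pos[of "L x"] elim by simp
    qed
    have "g field_differentiable at q"
      unfolding field_differentiable_def using D DERIV_cong_ev[OF refl ev refl] by blast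
    thus ?thesis by (rule field_differentiable_at_within)
  qed
  hence hol_g: "g holomorphic_on ball 0 1 - {0}"
    by (simp add: holomorphic_on_def)
  obtain B C where BC: "\<And>z. Im z > max 0 B \<Longrightarrow> norm (f z) \<le> C"
    using bd by (auto simp: bounded_at_i_infinity_def)
  define r where "r = exp (- 2 * pi * max 0 B)"
  have "eventually (\<lambda>q. q \<in> ball 0 r - {0}) (at 0)"
    by (rule eventually_at_in_open) (auto simp: r_def)
  hence "eventually (\<lambda>q. norm (g q) \<le> C) (at 0)"
  proof eventually_elim
    case (elim q)
    define z where "z = Ln q / t"
    have z: "nome z = q" using elim by (simp add: z_def t_def nome_Ln)
    have "exp (- 2 * pi * Im z) < exp (- 2 * pi * max 0 B)"
      using elim z norm_nome[of z] by (simp add: r_def)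
    hence "Im z > max 0 B" by (simp add: mult_less_cancel_left)
    thus ?case using BC[of z] by (simp add: g_def z_def)
  qed
  hence "\<exists>B. eventually (\<lambda>q. norm (g q) \<le> B) (at 0)" by blast
  moreover have "0 \<in> interior (ball 0 1 :: complex set)" by (simp add: interior_open)
  ultimately have "\<exists>h. h holomorphic_on ball 0 1 \<and> (\<forall>q\<in>ball 0 1 - {0}. h q = g q)"
    using holomorphic_on_extend_bounded[OF hol_g] by blast
  then obtain h where h: "h holomorphic_on ball 0 1" "\<And>q. q \<in> ball 0 1 - {0} \<Longrightarrow> h q = g q"
    by blast
  have "q_expansion f (fps_expansion h 0)"
    by (rule q_expansion_cong[OF holomorphic_imp_q_expansion[OF h(1)]])
       (use h(2) gn norm_nome_less_1 in auto)
  thus ?thesis using that by blast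
qed

lemma modular_form_q_expansion:
  assumes f: "modular_form k N chi f" and chi: "chi 1 = 1"
  obtains A where "q_expansion f A"
proof (rule periodic_holomorphic_q_expansion)
  show "f holomorphic_on upper_half_plane" by (rule modular_formD[OF f])
  show "f (z + of_int n) = f z" if "Im z > 0" for z n
  proof -
    have "T_mat n \<in> Gamma0 N" by (simp add: Gamma0_def) (simp add: T_mat_def)
    moreover have "T_mat n $ 2 $ 2 = 1" by (simp add: T_mat_def)
    ultimately show ?thesis using modular_formD(2)[OF f, of "T_mat n" z] that chi by (simp add: moebius_T_mat)
  qed
  have "bounded_at_i_infinity (slash k f (T_mat 0))"
    by (rule modular_formD(3)[OF f]) simp
  moreover have "slash k f (T_mat 0) = f"
    by (simp add: slash_def moebius_T_mat fun_eq_iff)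
  ultimately show "bounded_at_i_infinity f" by simp
qed

text \<open>The definite description needs uniqueness. The values of \<open>nome\<close> fill only
  the punctured disc, so the constant terms are compared by continuity at 0 before the identity
  theorem applies.\<close>

lemma q_expansion_fourier_coeff:
  assumes f: "q_expansion f A"
  shows "fourier_coeff f = fps_nth A"
  unfolding fourier_coeff_def
proof (rule the_equality)
  have e: "exp (2 * of_real pi * \<i> * of_nat n * z) = nome z ^ n" for n z
    by (simp add: nome_def exp_of_nat_mult[symmetric] mult_ac)
  show "\<forall>z\<in>upper_half_plane. (\<lambda>n. fps_nth A n * exp (2 * of_real pi * \<i> * of_nat n * z)) sums f z"
    unfolding e using q_expansion_conv[OF f] q_expansion_eval[OF f] by (simp add: sums_eval_fps)
  fix a assume "\<forall>z\<in>upper_half_plane. (\<lambda>n. a n * exp (2 * of_real pi * \<i> * of_nat n * z)) sums f z"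
  hence a: "(\<lambda>n. a n * nome z ^ n) sums f z" if "Im z > 0" for z
    using that by (simp add: e)
  have sums: "(\<lambda>n. a n * q ^ n) sums eval_fps A q" if "norm q < 1" "q \<noteq> 0" for q
  proof -
    define z where "z = Ln q / (2 * of_real pi * \<i>)"
    have "nome z = q" using that by (simp add: z_def nome_Ln)
    thus ?thesis using a[of z] Im_nome_pos[of z] that q_expansion_eval[OF f, of z] by simp
  qed
  define F where "F = Abs_fps a"
  have conv: "fps_conv_radius F \<ge> 1"
    unfolding F_def fps_conv_radius_def
  proof (rule conv_radius_geI_ex')
    fix r :: real assume r: "0 < r" "ereal r < 1"
    thus "summable (\<lambda>n. fps_nth (Abs_fps a) n * of_real r ^ n)"
      using sums[of "of_real r"] by (auto simp: sums_iff)
  qed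
  have conv': "fps_conv_radius A \<ge> 1" using f by (simp add: q_expansion_def)
  have ev: "eval_fps F q = eval_fps A q" if "norm q < 1" "q \<noteq> 0" for q
    using sums[OF that] by (simp add: eval_fps_def F_def sums_iff)
  have "fps_nth F 0 = fps_nth A 0"
  proof -
    have pos: "0 < fps_conv_radius F" "0 < fps_conv_radius A"
      using conv conv' by (auto intro: less_le_trans[of 0 1])
    have "isCont (eval_fps F) 0" "isCont (eval_fps A) 0"
      using pos by (auto intro!: continuous_eval_fps simp: zero_ereal_def)
    hence lims: "(eval_fps F \<longlongrightarrow> fps_nth F 0) (at 0)" "(eval_fps A \<longlongrightarrow> fps_nth A 0) (at 0)"
      by (auto simp: isCont_def eval_fps_at_0)
    have "eventually (\<lambda>q :: complex. q \<in> ball 0 1 - {0}) (at 0)"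
      by (rule eventually_at_in_open) auto
    hence "eventually (\<lambda>q. eval_fps F q = eval_fps A q) (at 0)"
      by eventually_elim (use ev in auto)
    from Lim_transform_eventually[OF lims(1) this] show ?thesis
      by (rule tendsto_unique[rotated, OF _ lims(2)]) simp
  qed
  hence ev0: "eval_fps F q = eval_fps A q" if "norm q < 1" for q
    using ev[OF that] by (cases "q = 0") (auto simp: eval_fps_at_0)
  have "F = A"
  proof (rule eval_fps_eqD)
    show "0 < fps_conv_radius F" "0 < fps_conv_radius A"
      using conv conv' by (auto intro: less_le_trans[of 0 1])
    have "eventually (\<lambda>q :: complex. q \<in> ball 0 1) (nhds 0)"
      by (intro eventually_nhds_in_open) auto
    thus "eventually (\<lambda>q. eval_fps F q = eval_fps A q) (nhds 0)"
      by eventually_elim (use ev0 in auto)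
  qed
  thus "a = fps_nth A" by (auto simp: F_def fps_eq_iff fun_eq_iff)
qed

section \<open>The valence bound\<close>

text \<open>Points where |U| is at least |U(z1)| can be moved into a compact box, because U is small
  high up. The maximum over the box is then a global one, so U is constant, and its decay at the
  cusp contradicts U(z1) \<noteq> 0.\<close>

lemma level_zero_vanishes:
  assumes hol: "U holomorphic_on upper_half_plane" and inv: "level_one 0 U"
    and small: "\<And>e. e > 0 \<Longrightarrow> \<exists>Y. \<forall>z. Im z > Y \<longrightarrow> norm (U z) < e"
    and z1: "Im z1 > 0"
  shows "U z1 = 0"
proof (rule ccontr)
  assume nz: "U z1 \<noteq> 0"
  define e where "e = norm (U z1)"
  have e: "e > 0" using nz by (simp add: e_def)
  obtain Y where Y: "\<And>z. Im z > Y \<Longrightarrow> norm (U z) < e" using small[OF e] by blast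
  define K where "K = cbox (Complex (- 1) (1/5)) (Complex 1 (max Y 1))"
  have K: "z \<in> K \<longleftrightarrow> - 1 \<le> Re z \<and> Re z \<le> 1 \<and> 1/5 \<le> Im z \<and> Im z \<le> max Y 1" for z
    by (auto simp: K_def in_cbox_complex_iff)
  have inv': "U (moebius A z) = U z" if "det A = 1" "Im z > 0" for A z
    using inv that by (simp add: level_one_def)
  have rep: "\<exists>k\<in>K. U k = U w" if w: "Im w > 0" "norm (U w) \<ge> e" for w
  proof -
    obtain A where A: "det A = 1" "Im (moebius A w) \<ge> 1 / 5"
      using exists_moebius_Im_ge[OF w(1)] by blast
    define v where "v = moebius A w"
    define k where "k = v + of_int (- \<lfloor>Re v\<rfloor>)"
    have v: "Im v \<ge> 1 / 5" "U v = U w" using A inv'[OF A(1) w(1)] by (auto simp: v_def)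
    have "moebius (T_mat (- \<lfloor>Re v\<rfloor>)) v = k" by (simp add: moebius_T_mat k_def)
    hence "U k = U v" using inv'[of "T_mat (- \<lfloor>Re v\<rfloor>)" v] v(1) by simp
    moreover have "Im v \<le> Y" using Y[of v] w(2) v(2) by force
    hence "k \<in> K" using v(1) by (auto simp: K k_def) linarith+
    ultimately show ?thesis using v(2) by auto
  qed
  have "compact K" by (simp add: K_def)
  moreover have "K \<noteq> {}" using rep[OF z1] by (auto simp: e_def)
  moreover have sub: "K \<subseteq> upper_half_plane" by (auto simp: K)
  hence "continuous_on K (\<lambda>z. norm (U z))"
    by (intro continuous_intros holomorphic_on_imp_continuous_on[OF holomorphic_on_subset[OF hol]])
  ultimately obtain k0 where k0: "k0 \<in> K" "\<And>k. k \<in> K \<Longrightarrow> norm (U k) \<le> norm (U k0)"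
    using continuous_attains_sup[of K "\<lambda>z. norm (U z)"] by blast
  have ge: "e \<le> norm (U k0)" using rep[OF z1] k0(2) by (force simp: e_def)
  have "U constant_on upper_half_plane"
  proof (rule maximum_modulus_principle[OF hol open_uhp _ open_uhp order.refl])
    show "connected upper_half_plane" using convex_uhp by (rule convex_connected)
    show "k0 \<in> upper_half_plane" using k0 sub by blast
    fix w assume "w \<in> upper_half_plane"
    thus "norm (U w) \<le> norm (U k0)"
      using rep[of w] k0(2) ge by (cases "norm (U w) \<ge> e") force+
  qed
  then obtain c where c: "\<And>z. Im z > 0 \<Longrightarrow> U z = c" by (auto simp: constant_on_def)
  define w where "w = Complex 0 (max Y 1 + 1)"
  have "norm (U w) < e" by (rule Y) (simp add: w_def)
  moreover have "U w = U z1" using c[of w] c[OF z1] by (simp add: w_def)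
  ultimately show False by (simp add: e_def)
qed

section \<open>Cosets of the congruence subgroup and the norm to level one\<close>

lemma moebius_mat_1: "moebius_num (mat 1) z = z" "moebius_den (mat 1) z = 1"
  by (simp_all add: moebius_num_def moebius_den_def mat_def)

lemma SL2Z_right_inverse:
  fixes A :: "int ^ 2 ^ 2"
  assumes "det A = 1"
  obtains B :: "int ^ 2 ^ 2" where "det B = 1" "A ** B = mat 1" "B ** A = mat 1"
    "B $ 1 $ 1 = A $ 2 $ 2" "B $ 2 $ 1 = - A $ 2 $ 1"
proof -
  define B :: "int ^ 2 ^ 2" where "B = vector [vector [A $ 2 $ 2, - A $ 1 $ 2], vector [- A $ 2 $ 1, A $ 1 $ 1]]"
  have "A $ 1 $ 1 * A $ 2 $ 2 - A $ 1 $ 2 * A $ 2 $ 1 = 1"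
    using assms by (simp add: det_2)
  hence "A ** B = mat 1"
    by (simp add: B_def matrix_matrix_mult_def mat_def vec_eq_iff forall_2 sum_2 algebra_simps)
  thus ?thesis using SL2Z_left_inverse[OF assms] by (intro that[of B]) (simp_all add: B_def)
qed

text \<open>The lower row modulo N determines the coset: the lower left entry of A B^(-1) is the 2x2
  determinant formed by the lower rows of A and B, and it vanishes modulo N when these rows
  agree.\<close>

lemma finite_rcosets_Gamma0:
  assumes N: "N > 0"
  shows "finite (rcosets\<^bsub>SL2Z\<^esub> (Gamma0 N))"
proof -
  interpret group SL2Z by (rule group_SL2Z)
  define Q where "Q = (\<lambda>(c, d) (A :: int ^ 2 ^ 2). det A = 1 \<and> A $ 2 $ 1 mod int N = c \<and> A $ 2 $ 2 mod int N = d)"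
  have "rcosets\<^bsub>SL2Z\<^esub> (Gamma0 N) \<subseteq>
    (\<lambda>p. Gamma0 N #>\<^bsub>SL2Z\<^esub> (SOME A. Q p A)) ` ({0..<int N} \<times> {0..<int N})"
  proof
    fix Y assume "Y \<in> rcosets\<^bsub>SL2Z\<^esub> (Gamma0 N)"
    then obtain A :: "int ^ 2 ^ 2" where A: "det A = 1" "Y = Gamma0 N #>\<^bsub>SL2Z\<^esub> A" by (auto simp: RCOSETS_def)
    define p where "p = (A $ 2 $ 1 mod int N, A $ 2 $ 2 mod int N)"
    define B :: "int ^ 2 ^ 2" where "B = (SOME B. Q p B)"
    have "Q p A" by (simp add: Q_def p_def A)
    hence "Q p B" unfolding B_def by (rule someI)
    hence B: "det B = 1" "B $ 2 $ 1 mod int N = A $ 2 $ 1 mod int N" "B $ 2 $ 2 mod int N = A $ 2 $ 2 mod int N"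
      by (simp_all add: Q_def p_def)
    obtain B' :: "int ^ 2 ^ 2" where B': "det B' = 1" "B ** B' = mat 1" "B' ** B = mat 1"
      "B' $ 1 $ 1 = B $ 2 $ 2" "B' $ 2 $ 1 = - B $ 2 $ 1" using SL2Z_right_inverse[OF B(1)] by blast
    define C :: "int ^ 2 ^ 2" where "C = A ** B'"
    have "C $ 2 $ 1 = A $ 2 $ 1 * B $ 2 $ 2 - A $ 2 $ 2 * B $ 2 $ 1"
      using B' by (simp add: C_def matrix_matrix_mult_def sum_2)
    moreover have "(A $ 2 $ 1 * B $ 2 $ 2) mod int N = (A $ 2 $ 2 * B $ 2 $ 1) mod int N"
      using B by (metis mod_mult_cong mult.commute)
    ultimately have "int N dvd C $ 2 $ 1" by (simp add: mod_eq_dvd_iff)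
    hence C: "C \<in> Gamma0 N" using A B' by (simp add: Gamma0_def C_def det_mul)
    have "A = C ** B" by (simp add: C_def B' flip: matrix_mul_assoc)
    hence "A \<in> Gamma0 N #>\<^bsub>SL2Z\<^esub> B" using C by (auto simp: r_coset_def)
    hence "Y = Gamma0 N #>\<^bsub>SL2Z\<^esub> B"
      using repr_independence[OF _ _ subgroup_Gamma0] A B by simp
    moreover have "p \<in> {0..<int N} \<times> {0..<int N}" using N by (simp add: p_def)
    ultimately show "Y \<in> (\<lambda>p. Gamma0 N #>\<^bsub>SL2Z\<^esub> (SOME A. Q p A)) ` ({0..<int N} \<times> {0..<int N})"
      unfolding B_def by blast
  qed
  thus ?thesis by (rule finite_subset) auto
qed

text \<open>The norm needs one function for each coset. The arbitrary representative is harmless for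
  a form with trivial character, by \<open>coset_slash_eq\<close>.\<close>

definition coset_slash :: "nat \<Rightarrow> (complex \<Rightarrow> complex) \<Rightarrow> (int ^ 2 ^ 2) set \<Rightarrow> complex \<Rightarrow> complex" where
  "coset_slash k f c = slash k f (SOME A. A \<in> c)"

lemma coset_slash_eq:
  assumes f: "modular_form k N (\<lambda>_. 1) f" and A: "det A = 1" and z: "Im z > 0"
  shows "coset_slash k f (Gamma0 N #>\<^bsub>SL2Z\<^esub> A) z = slash k f A z"
proof -
  have "mat 1 \<in> Gamma0 N" by (simp add: Gamma0_def) (simp add: mat_def)
  hence "mat 1 ** A \<in> Gamma0 N #>\<^bsub>SL2Z\<^esub> A" by (force simp: r_coset_def)
  hence "(SOME A'. A' \<in> Gamma0 N #>\<^bsub>SL2Z\<^esub> A) \<in> Gamma0 N #>\<^bsub>SL2Z\<^esub> A" by (rule someI)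
  then obtain C where C: "C \<in> Gamma0 N" "(SOME A'. A' \<in> Gamma0 N #>\<^bsub>SL2Z\<^esub> A) = C ** A"
    by (auto simp: r_coset_def)
  have w: "Im (moebius A z) > 0" by (rule Im_moebius_pos[OF A z])
  have "slash k f (C ** A) z = slash k f C (moebius A z) / moebius_den A z ^ k"
    unfolding slash_mult[OF Gamma0_det[OF C(1)] A z] by (simp add: slash_def)
  also have "slash k f C (moebius A z) = f (moebius A z)"
    using modular_formD(2)[OF f C(1) w] moebius_den_nonzero[OF Gamma0_det[OF C(1)] w] by (simp add: slash_def)
  finally show ?thesis by (simp add: coset_slash_def C slash_def)
qed

lemma holomorphic_slash:
  assumes f: "f holomorphic_on upper_half_plane" and A: "det A = 1"
  shows "slash k f A holomorphic_on upper_half_plane"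
proof -
  have "moebius_num A holomorphic_on upper_half_plane" "moebius_den A holomorphic_on upper_half_plane"
    unfolding moebius_num_def moebius_den_def by (intro holomorphic_intros)+
  moreover from this have "(\<lambda>z. moebius A z) holomorphic_on upper_half_plane"
    using moebius_den_nonzero[OF A] by (intro holomorphic_intros) auto
  from holomorphic_on_compose_gen[OF this f] have "(\<lambda>z. f (moebius A z)) holomorphic_on upper_half_plane"
    using Im_moebius_pos[OF A] by (simp add: o_def image_subset_iff)
  ultimately show ?thesis
    unfolding slash_def using moebius_den_nonzero[OF A] by (intro holomorphic_intros) auto
qed

text \<open>No zero divisors among holomorphic functions on a connected open set: where one factor
  is nonzero the remaining product vanishes, hence it vanishes everywhere by analytic
  continuation.\<close>

lemma holomorphic_prod_eq_0:
  assumes "finite I" "open S" "connected S" "S \<noteq> {}"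
    and "\<And>i. i \<in> I \<Longrightarrow> f i holomorphic_on S"
    and "\<And>z. z \<in> S \<Longrightarrow> (\<Prod>i\<in>I. f i z) = (0 :: complex)"
  shows "\<exists>i\<in>I. \<forall>z\<in>S. f i z = 0"
  using assms(1,5,6)
proof (induction I rule: finite_induct)
  case empty
  thus ?case using assms(4) by auto
next
  case (insert i I)
  show ?case
  proof (cases "\<forall>z\<in>S. f i z = 0")
    case False
    define V where "V = S \<inter> f i -` (- {0})"
    have V: "open V" unfolding V_def
      using insert.prems(1)[of i] assms(2)
      by (intro continuous_open_preimage holomorphic_on_imp_continuous_on) auto
    have P0: "(\<Prod>j\<in>I. f j z) = 0" if "z \<in> S" for z
    proof (rule analytic_continuation_open[of V S "\<lambda>z. \<Prod>j\<in>I. f j z" "\<lambda>_. 0"])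
      show "V \<noteq> {}" using False by (auto simp: V_def)
      show "(\<lambda>z. \<Prod>j\<in>I. f j z) holomorphic_on S"
        using insert.prems(1) by (intro holomorphic_intros) auto
      show "(\<Prod>j\<in>I. f j z) = 0" if "z \<in> V" for z
        using insert.prems(2)[of z] insert.hyps that by (auto simp: V_def)
    qed (use V assms that in \<open>auto simp: V_def\<close>)
    thus ?thesis using insert.IH insert.prems(1) by auto
  qed auto
qed

lemma q_expansion_decay:
  assumes f: "q_expansion f A" and zero: "\<And>j. j < n \<Longrightarrow> fps_nth A j = 0"
  obtains C where "C \<ge> 0" "\<And>z. Im z > 1 \<Longrightarrow> norm (f z) \<le> C * norm (nome z) ^ n"
proof -
  have A: "A = fps_shift n A * fps_X ^ n"
    by (rule fps_ext) (use zero in \<open>simp add: fps_X_power_mult_right_nth\<close>)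
  have r: "exp (- 2 * pi) < (1 :: real)" by simp
  obtain C where C: "\<And>q. norm q \<le> exp (- 2 * pi) \<Longrightarrow> norm (eval_fps (fps_shift n A) q) \<le> C"
    using eval_fps_bounded[OF _ r, of "fps_shift n A"] f by (auto simp: q_expansion_def)
  show ?thesis
  proof
    show "C \<ge> 0" by (rule order.trans[OF norm_ge_zero C[of 0]]) simp
    fix z assume z: "Im z > 1"
    hence z0: "Im z > 0" by simp
    have "f z = eval_fps (fps_shift n A * fps_X ^ n) (nome z)"
      using q_expansion_eval[OF f z0] A by simp
    also have "\<dots> = eval_fps (fps_shift n A) (nome z) * nome z ^ n"
      using q_expansion_conv[OF f z0] by (subst eval_fps_mult) auto
    finally show "norm (f z) \<le> C * norm (nome z) ^ n"
      using C[of "nome z"] norm_nome_le[of 1 z] z by (simp add: norm_mult norm_power mult_right_mono)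
  qed
qed

text \<open>\<Delta>/q has a bounded inverse near the cusp, so dividing by \<Delta> costs exactly
  one factor q.\<close>

lemma discriminant_lower_bound:
  obtains D where "D \<ge> 0" "\<And>z. Im z > 1 \<Longrightarrow> norm (nome z) \<le> D * norm (discriminant z)"
proof -
  define r where "r = exp (- 2 * pi)"
  have "(\<lambda>q. inverse (euler_phi q ^ 24)) holomorphic_on ball 0 1"
    using euler_phi_nonzero by (intro holomorphic_intros holomorphic_euler_phi) auto
  moreover have "cball 0 r \<subseteq> (ball 0 1 :: complex set)" by (simp add: r_def cball_subset_ball_iff)
  ultimately have "continuous_on (cball 0 r) (\<lambda>q. inverse (euler_phi q ^ 24))"
    by (intro holomorphic_on_imp_continuous_on) (rule holomorphic_on_subset)
  hence "bounded ((\<lambda>q. inverse (euler_phi q ^ 24)) ` cball 0 r)"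
    by (intro compact_imp_bounded compact_continuous_image) auto
  then obtain D where "\<forall>x\<in>(\<lambda>q. inverse (euler_phi q ^ 24)) ` cball 0 r. norm x \<le> D"
    unfolding bounded_iff by blast
  hence D: "norm (inverse (euler_phi q ^ 24)) \<le> D" if "norm q \<le> r" for q using that by auto
  show ?thesis
  proof
    show "D \<ge> 0" by (rule order.trans[OF norm_ge_zero D[of 0]]) (simp add: r_def)
    fix z assume z: "Im z > 1"
    have p: "euler_phi (nome z) \<noteq> 0" using z by (intro euler_phi_nonzero norm_nome_less_1) simp
    have "nome z = inverse (euler_phi (nome z) ^ 24) * discriminant z"
      using p by (simp add: discriminant_def)
    hence "norm (nome z) = norm (inverse (euler_phi (nome z) ^ 24)) * norm (discriminant z)"
      by (metis norm_mult)
    also have "\<dots> \<le> D * norm (discriminant z)"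
      using D[of "nome z"] norm_nome_le[of 1 z] z by (intro mult_right_mono) (auto simp: r_def)
    finally show "norm (nome z) \<le> D * norm (discriminant z)" .
  qed
qed

text \<open>The product \<open>P\<close> of the conjugates over all cosets has level one and weight
  w, which is k times the index. At infinity it is as small as f, because the other conjugates are
  bounded. Comparing its 12th power with \<Delta>^w avoids asking that 12 divide w; if 12 n > w, the
  quotient \<open>U\<close> decays and must be 0.\<close>

theorem valence_bound:
  assumes f: "modular_form k N (\<lambda>_. 1) f" and N: "N > 0" and A: "q_expansion f A"
    and nz: "Im z0 > 0" "f z0 \<noteq> 0" and zero: "\<And>j. j < n \<Longrightarrow> fps_nth A j = 0"
  shows "12 * n \<le> k * Gamma0_index N"
proof (rule ccontr)
  assume less: "\<not> 12 * n \<le> k * Gamma0_index N"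
  interpret group SL2Z by (rule group_SL2Z)
  define C where "C = rcosets\<^bsub>SL2Z\<^esub> (Gamma0 N)"
  define w where "w = k * card C"
  have fin: "finite C" unfolding C_def by (rule finite_rcosets_Gamma0[OF N])
  have w: "w < 12 * n" using less by (simp add: Gamma0_index_def C_def w_def)
  define h where "h = coset_slash k f"
  define P where "P = (\<lambda>z. \<Prod>c\<in>C. h c z)"
  have sub: "Gamma0 N \<subseteq> carrier SL2Z" by (rule subgroup.subset[OF subgroup_Gamma0])
  have C: "\<exists>B. det B = 1 \<and> c = Gamma0 N #>\<^bsub>SL2Z\<^esub> B" if "c \<in> C" for c
    using that by (auto simp: C_def RCOSETS_def)
  have inC: "Gamma0 N #>\<^bsub>SL2Z\<^esub> B \<in> C" if "det B = 1" for B
    using that by (auto simp: C_def RCOSETS_def)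
  have assoc: "(Gamma0 N #>\<^bsub>SL2Z\<^esub> A) #>\<^bsub>SL2Z\<^esub> B = Gamma0 N #>\<^bsub>SL2Z\<^esub> (A ** B)"
    if "det A = 1" "det B = 1" for A B
    using coset_mult_assoc[OF sub, of A B] that by simp
  have h: "h (Gamma0 N #>\<^bsub>SL2Z\<^esub> B) z = slash k f B z" if "det B = 1" "Im z > 0" for B z
    unfolding h_def by (rule coset_slash_eq[OF f that])
  have hol_h: "h c holomorphic_on upper_half_plane" if "c \<in> C" for c
  proof -
    obtain B where B: "det B = 1" "c = Gamma0 N #>\<^bsub>SL2Z\<^esub> B" using C[OF \<open>c \<in> C\<close>] by blast
    show ?thesis
      by (rule holomorphic_transform[OF holomorphic_slash[OF modular_formD(1)[OF f] B(1)]]) (simp add: B h)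
  qed
  have bd_h: "bounded_at_i_infinity (h c)" if "c \<in> C" for c
  proof -
    obtain B where B: "det B = 1" "c = Gamma0 N #>\<^bsub>SL2Z\<^esub> B" using C[OF \<open>c \<in> C\<close>] by blast
    show ?thesis
      by (rule bounded_at_i_infinity_cong[OF modular_formD(3)[OF f B(1)]]) (simp add: B h)
  qed
  have hol_P: "P holomorphic_on upper_half_plane"
    unfolding P_def by (intro holomorphic_intros hol_h)
  have level_P: "level_one w P"
    unfolding level_one_def
  proof (intro allI impI)
    fix A :: "int ^ 2 ^ 2" and z assume A: "det A = 1" and z: "Im z > 0"
    obtain A' where A': "det A' = 1" "A ** A' = mat 1" "A' ** A = mat 1"
      using SL2Z_right_inverse[OF A] by blast
    \<comment> \<open>Right multiplication permutes the cosets, so that the product transforms under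
      the whole modular group.\<close>
    have bij: "bij_betw (\<lambda>c. c #>\<^bsub>SL2Z\<^esub> A) C C"
    proof (rule bij_betw_byWitness[where f' = "\<lambda>c. c #>\<^bsub>SL2Z\<^esub> A'"])
      show "\<forall>c\<in>C. (c #>\<^bsub>SL2Z\<^esub> A) #>\<^bsub>SL2Z\<^esub> A' = c"
      proof
        fix c assume "c \<in> C"
        then obtain B where "det B = 1" "c = Gamma0 N #>\<^bsub>SL2Z\<^esub> B" using C by blast
        thus "(c #>\<^bsub>SL2Z\<^esub> A) #>\<^bsub>SL2Z\<^esub> A' = c"
          using A A' by (simp add: assoc det_mul flip: matrix_mul_assoc)
      qed
      show "\<forall>c\<in>C. (c #>\<^bsub>SL2Z\<^esub> A') #>\<^bsub>SL2Z\<^esub> A = c"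
      proof
        fix c assume "c \<in> C"
        then obtain B where "det B = 1" "c = Gamma0 N #>\<^bsub>SL2Z\<^esub> B" using C by blast
        thus "(c #>\<^bsub>SL2Z\<^esub> A') #>\<^bsub>SL2Z\<^esub> A = c"
          using A A' by (simp add: assoc det_mul flip: matrix_mul_assoc)
      qed
      show "(\<lambda>c. c #>\<^bsub>SL2Z\<^esub> A) ` C \<subseteq> C"
        using C inC A by (force simp: assoc det_mul)
      show "(\<lambda>c. c #>\<^bsub>SL2Z\<^esub> A') ` C \<subseteq> C"
        using C inC A' by (force simp: assoc det_mul)
    qed
    have "h c (moebius A z) = moebius_den A z ^ k * h (c #>\<^bsub>SL2Z\<^esub> A) z" if "c \<in> C" for c
    proof -
      obtain B where B: "det B = 1" "c = Gamma0 N #>\<^bsub>SL2Z\<^esub> B" using C[OF \<open>c \<in> C\<close>] by blast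
      have "h (c #>\<^bsub>SL2Z\<^esub> A) z = slash k f (B ** A) z"
        unfolding B(2) assoc[OF B(1) A] using B A z by (simp add: h det_mul)
      also have "\<dots> = slash k f B (moebius A z) / moebius_den A z ^ k"
        unfolding slash_mult[OF B(1) A z] by (simp add: slash_def)
      also have "slash k f B (moebius A z) = h c (moebius A z)"
        unfolding B(2) by (rule h[symmetric, OF B(1) Im_moebius_pos[OF A z]])
      finally show ?thesis using moebius_den_nonzero[OF A z] by simp
    qed
    hence "P (moebius A z) = (\<Prod>c\<in>C. moebius_den A z ^ k * h (c #>\<^bsub>SL2Z\<^esub> A) z)"
      unfolding P_def by (intro prod.cong refl)
    also have "\<dots> = moebius_den A z ^ w * (\<Prod>c\<in>C. h (c #>\<^bsub>SL2Z\<^esub> A) z)"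
      by (simp add: prod.distrib w_def power_mult)
    also have "(\<Prod>c\<in>C. h (c #>\<^bsub>SL2Z\<^esub> A) z) = P z"
      unfolding P_def by (rule prod.reindex_bij_betw[OF bij])
    finally show "P (moebius A z) = moebius_den A z ^ w * P z" .
  qed
  define c1 where "c1 = Gamma0 N #>\<^bsub>SL2Z\<^esub> mat 1"
  have c1: "c1 \<in> C" unfolding c1_def by (rule inC) simp
  have h1: "h c1 z = f z" if "Im z > 0" for z
    unfolding c1_def using h[of "mat 1" z] that by (simp add: slash_def moebius_mat_1)
  have P_split: "P z = f z * (\<Prod>c\<in>C - {c1}. h c z)" if "Im z > 0" for z
    unfolding P_def using prod.remove[OF fin c1, of "\<lambda>c. h c z"] h1[OF that] by simp
  have "bounded_at_i_infinity (\<lambda>z. \<Prod>c\<in>C - {c1}. h c z)"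
    by (intro bounded_at_i_infinity_prod bd_h) auto
  then obtain B1 C1 where C1: "\<And>z. Im z > max 0 B1 \<Longrightarrow> norm (\<Prod>c\<in>C - {c1}. h c z) \<le> C1"
    by (auto simp: bounded_at_i_infinity_def)
  obtain C2 where C2: "C2 \<ge> 0" "\<And>z. Im z > 1 \<Longrightarrow> norm (f z) \<le> C2 * norm (nome z) ^ n"
    using q_expansion_decay[OF A zero] by blast
  obtain D where D: "D \<ge> 0" "\<And>z. Im z > 1 \<Longrightarrow> norm (nome z) \<le> D * norm (discriminant z)"
    using discriminant_lower_bound by blast
  define U where "U = (\<lambda>z. P z ^ 12 / discriminant z ^ w)"
  have bound: "norm (U z) \<le> (C2 * C1) ^ 12 * D ^ w * exp (- 2 * pi * Im z)" if z: "Im z > max 1 B1" for z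
  proof -
    define q where "q = norm (nome z)"
    have q: "0 < q" "q \<le> 1" using norm_nome_less_1[of z] z by (auto simp: q_def)
    have C1z: "norm (\<Prod>c\<in>C - {c1}. h c z) \<le> C1" using C1[of z] z by simp
    hence C1_nonneg: "0 \<le> C1" using norm_ge_zero order.trans by blast
    have "norm (P z) = norm (f z) * norm (\<Prod>c\<in>C - {c1}. h c z)"
      using P_split[of z] z by (simp add: norm_mult)
    also have "\<dots> \<le> (C2 * q ^ n) * C1"
      using C2(2)[of z] C1z z C1_nonneg C2(1) q by (intro mult_mono) (auto simp: q_def)
    finally have "norm (P z) ^ 12 \<le> ((C2 * q ^ n) * C1) ^ 12" by (intro power_mono) auto
    also have "\<dots> = (C2 * C1) ^ 12 * q ^ (12 * n)" by (simp add: power_mult_distrib power_mult mult.commute)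
    also have "\<dots> \<le> (C2 * C1) ^ 12 * q ^ (w + 1)"
      using q w C1_nonneg C2(1) by (intro mult_left_mono power_decreasing) auto
    finally have 1: "norm (P z) ^ 12 \<le> (C2 * C1) ^ 12 * q * q ^ w" by (simp add: mult_ac)
    have d0: "norm (discriminant z) > 0" using discriminant_nonzero[of z] z by simp
    have 2: "q ^ w \<le> D ^ w * norm (discriminant z) ^ w"
      unfolding power_mult_distrib[symmetric] using D(2)[of z] z q by (intro power_mono) (auto simp: q_def)
    have "norm (P z) ^ 12 \<le> (C2 * C1) ^ 12 * q * (D ^ w * norm (discriminant z) ^ w)"
      using 1 mult_left_mono[OF 2, of "(C2 * C1) ^ 12 * q"] q C1_nonneg C2(1) by simp
    hence "norm (P z) ^ 12 / norm (discriminant z) ^ w \<le> (C2 * C1) ^ 12 * D ^ w * q"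
      using d0 by (simp add: divide_le_eq mult_ac)
    thus ?thesis by (simp add: U_def norm_divide norm_power q_def norm_nome)
  qed
  have U0: "U z = 0" if "Im z > 0" for z
  proof (rule level_zero_vanishes[OF _ _ _ that])
    show "U holomorphic_on upper_half_plane"
      unfolding U_def using discriminant_nonzero
      by (intro holomorphic_intros hol_P q_expansion_holomorphic[OF discriminant_q_expansion]) auto
    show "level_one 0 U"
      unfolding level_one_def
    proof (intro allI impI)
      fix A :: "int ^ 2 ^ 2" and z assume A: "det A = 1" and z: "Im z > 0"
      define j where "j = moebius_den A z"
      have j: "j \<noteq> 0" using moebius_den_nonzero[OF A z] by (simp add: j_def)
      have "P (moebius A z) = j ^ w * P z" "discriminant (moebius A z) = j ^ 12 * discriminant z"
        using level_P level_one_discriminant A z by (simp_all add: level_one_def j_def)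
      moreover have "(j ^ w) ^ 12 = (j ^ 12) ^ w" by (simp add: power_mult[symmetric] mult.commute)
      ultimately show "U (moebius A z) = moebius_den A z ^ 0 * U z"
        using j by (simp add: U_def power_mult_distrib)
    qed
    fix e :: real assume e: "e > 0"
    define K where "K = (C2 * C1) ^ 12 * D ^ w"
    have "((\<lambda>y. K * exp (- (2 * pi * y))) \<longlongrightarrow> K * 0) at_top"
      by (intro tendsto_mult tendsto_const filterlim_compose[OF exp_at_bot] filterlim_uminus_at_bot_at_top
         filterlim_compose[OF filterlim_uminus_at_bot_at_top] filterlim_tendsto_pos_mult_at_top[OF tendsto_const] filterlim_ident) auto
    hence "eventually (\<lambda>y. K * exp (- (2 * pi * y)) < e) at_top"
      using e by (intro order_tendstoD) auto
    then obtain Y where Y: "\<And>y. y \<ge> Y \<Longrightarrow> K * exp (- (2 * pi * y)) < e"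
      by (auto simp: eventually_at_top_linorder)
    show "\<exists>Y. \<forall>z. Im z > Y \<longrightarrow> norm (U z) < e"
    proof (intro exI allI impI)
      fix z assume "Im z > max Y (max 1 B1)"
      thus "norm (U z) < e" using bound[of z] Y[of "Im z"] by (simp add: K_def)
    qed
  qed
  have "\<exists>c\<in>C. \<forall>z\<in>upper_half_plane. h c z = 0"
  proof (rule holomorphic_prod_eq_0[OF fin open_uhp convex_connected[OF convex_uhp] _ hol_h])
    show "upper_half_plane \<noteq> {}" using nz(1) by (auto simp: upper_half_plane_def)
    show "(\<Prod>c\<in>C. h c z) = 0" if "z \<in> upper_half_plane" for z
      using U0[of z] discriminant_nonzero[of z] that by (simp add: U_def P_def)
  qed
  then obtain c where c: "c \<in> C" "\<And>z. Im z > 0 \<Longrightarrow> h c z = 0" by auto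
  obtain B where B: "det B = 1" "c = Gamma0 N #>\<^bsub>SL2Z\<^esub> B" using C[OF c(1)] by blast
  obtain B' where B': "det B' = 1" "B ** B' = mat 1" using SL2Z_right_inverse[OF B(1)] by blast
  \<comment> \<open>The vanishing conjugate is evaluated at the point that its matrix carries to
    \<open>z0\<close>.\<close>
  define z where "z = moebius B' z0"
  have z: "Im z > 0" unfolding z_def by (rule Im_moebius_pos[OF B'(1) nz(1)])
  have "slash k f B z = 0" using c(2)[OF z] h[OF B(1) z] B(2) by simp
  hence "f (moebius B z) = 0" using moebius_den_nonzero[OF B(1) z] by (simp add: slash_def)
  moreover have "moebius B z = z0"
    unfolding z_def moebius_mult[OF B(1) B'(1) nz(1), symmetric] B'(2) by (simp add: moebius_mat_1)
  ultimately show False using nz(2) by simp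
qed

section \<open>Power series modulo a prime ideal\<close>

text \<open>A ring with a prime ideal given as subsets of \<complex> with closure conditions, so
  that coefficients of complex power series can be used directly.\<close>

locale subring_prime =
  fixes R P :: "complex set"
  assumes R_1: "1 \<in> R" and R_add: "a \<in> R \<Longrightarrow> b \<in> R \<Longrightarrow> a + b \<in> R"
    and R_uminus: "a \<in> R \<Longrightarrow> - a \<in> R" and R_mult: "a \<in> R \<Longrightarrow> b \<in> R \<Longrightarrow> a * b \<in> R"
    and P_subset: "P \<subseteq> R" and P_0: "0 \<in> P" and P_1: "1 \<notin> P"
    and P_add: "a \<in> P \<Longrightarrow> b \<in> P \<Longrightarrow> a + b \<in> P"
    and P_mult: "r \<in> R \<Longrightarrow> a \<in> P \<Longrightarrow> r * a \<in> P"
    and P_prime: "a \<in> R \<Longrightarrow> b \<in> R \<Longrightarrow> a * b \<in> P \<Longrightarrow> a \<in> P \<or> b \<in> P"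
begin

lemma R_0: "0 \<in> R" using P_0 P_subset by blast

lemma R_diff: "a \<in> R \<Longrightarrow> b \<in> R \<Longrightarrow> a - b \<in> R"
  using R_add[OF _ R_uminus] by fastforce

lemma P_uminus: "a \<in> P \<Longrightarrow> - a \<in> P"
  using P_mult[OF R_uminus[OF R_1]] by fastforce

lemma P_diff: "a \<in> P \<Longrightarrow> b \<in> P \<Longrightarrow> a - b \<in> P"
  using P_add[OF _ P_uminus] by fastforce

lemma P_mult_right: "a \<in> P \<Longrightarrow> r \<in> R \<Longrightarrow> a * r \<in> P"
  using P_mult[of r a] by (simp add: mult.commute)

lemma R_sum: "(\<And>i. i \<in> I \<Longrightarrow> a i \<in> R) \<Longrightarrow> sum a I \<in> R"
  by (induction I rule: infinite_finite_induct) (auto intro: R_0 R_add)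

lemma P_sum: "(\<And>i. i \<in> I \<Longrightarrow> a i \<in> P) \<Longrightarrow> sum a I \<in> P"
  by (induction I rule: infinite_finite_induct) (auto intro: P_0 P_add)

lemma R_of_nat: "of_nat n \<in> R"
  by (induction n) (auto intro: R_0 R_1 R_add)

lemma R_Ints: "a \<in> \<int> \<Longrightarrow> a \<in> R"
proof (elim Ints_cases)
  fix n assume "a = of_int n"
  thus "a \<in> R" using R_of_nat R_uminus by (cases n rule: int_cases2) auto
qed

definition R_fps :: "complex fps \<Rightarrow> bool" where
  "R_fps A \<longleftrightarrow> (\<forall>n. fps_nth A n \<in> R)"

definition P_fps :: "complex fps \<Rightarrow> bool" where
  "P_fps A \<longleftrightarrow> (\<forall>n. fps_nth A n \<in> P)"

text \<open>The order of the reduction in the power series ring over R/P, with integrality of the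
  series included.\<close>

definition P_order :: "complex fps \<Rightarrow> nat \<Rightarrow> bool" where
  "P_order A n \<longleftrightarrow> R_fps A \<and> (\<forall>j<n. fps_nth A j \<in> P) \<and> fps_nth A n \<notin> P"

lemma R_fps_integral: "integral_fps A \<Longrightarrow> R_fps A"
  by (simp add: R_fps_def integral_fps_def R_Ints)

lemma R_fps_add: "R_fps A \<Longrightarrow> R_fps B \<Longrightarrow> R_fps (A + B)"
  and R_fps_diff: "R_fps A \<Longrightarrow> R_fps B \<Longrightarrow> R_fps (A - B)"
  and R_fps_mult: "R_fps A \<Longrightarrow> R_fps B \<Longrightarrow> R_fps (A * B)"
  by (auto simp: R_fps_def fps_mult_nth intro!: R_add R_diff R_mult R_sum)

lemma R_fps_1: "R_fps 1" and R_fps_numeral: "R_fps (numeral v)"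
  by (rule R_fps_integral integral_fps_1 integral_fps_numeral)+

lemma R_fps_power: "R_fps A \<Longrightarrow> R_fps (A ^ n)"
  by (induction n) (auto intro: R_fps_1 R_fps_mult)

lemma P_fps_add: "P_fps A \<Longrightarrow> P_fps B \<Longrightarrow> P_fps (A + B)"
  by (auto simp: P_fps_def intro!: P_add)

lemma P_fps_mult: "R_fps A \<Longrightarrow> P_fps B \<Longrightarrow> P_fps (A * B)"
  by (auto simp: R_fps_def P_fps_def fps_mult_nth intro!: P_sum P_mult)

lemma P_fps_numeral: "numeral v \<in> P \<Longrightarrow> P_fps (numeral v)"
  by (simp add: P_fps_def fps_numeral_nth P_0)

lemma P_fps_power_diff_1:
  assumes "R_fps A" "P_fps (A - 1)"
  shows "P_fps (A ^ n - 1)"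
proof (induction n)
  case 0
  show ?case by (simp add: P_fps_def P_0)
next
  case (Suc n)
  have eq: "A ^ Suc n - 1 = A * (A ^ n - 1) + (A - 1)" by (simp add: algebra_simps)
  show ?case unfolding eq by (rule P_fps_add[OF P_fps_mult[OF assms(1) Suc] assms(2)])
qed

lemma P_order_1: "P_order 1 0"
  by (simp add: P_order_def R_fps_1 P_1)

lemma P_order_add:
  assumes "P_order A n" "P_fps B"
  shows "P_order (A + B) n"
proof -
  have "R_fps B" using assms(2) P_subset by (auto simp: R_fps_def P_fps_def)
  moreover have "fps_nth A n + fps_nth B n \<notin> P"
    using assms P_diff[of "fps_nth A n + fps_nth B n" "fps_nth B n"] by (auto simp: P_order_def P_fps_def)
  ultimately show ?thesis
    using assms by (auto simp: P_order_def P_fps_def intro: R_fps_add P_add)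
qed

text \<open>R/P is a domain, so the product of the leading coefficients stays nonzero; every other
  term of the convolution has a factor in \<open>P\<close>.\<close>

lemma P_order_mult:
  assumes A: "P_order A a" and B: "P_order B b"
  shows "P_order (A * B) (a + b)"
proof -
  have R: "fps_nth A i \<in> R" "fps_nth B i \<in> R" for i
    using A B by (auto simp: P_order_def R_fps_def)
  have small: "fps_nth A i * fps_nth B (n - i) \<in> P" if "i \<le> n" "i < a \<or> n - i < b" for i n
    using that A B R by (auto simp: P_order_def intro: P_mult P_mult_right)
  have "fps_nth (A * B) j \<in> P" if "j < a + b" for j
    unfolding fps_mult_nth using that by (intro P_sum small) auto
  moreover have "fps_nth (A * B) (a + b) \<notin> P"
  proof
    assume in_P: "fps_nth (A * B) (a + b) \<in> P"
    have eq: "fps_nth (A * B) (a + b) = fps_nth A a * fps_nth B b +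
        (\<Sum>i\<in>{0..a + b} - {a}. fps_nth A i * fps_nth B (a + b - i))"
      unfolding fps_mult_nth by (subst sum.remove[of _ a]) auto
    have "(\<Sum>i\<in>{0..a + b} - {a}. fps_nth A i * fps_nth B (a + b - i)) \<in> P"
      by (intro P_sum small) auto
    from P_diff[OF in_P this] have "fps_nth A a * fps_nth B b \<in> P"
      unfolding eq by simp
    hence "fps_nth A a \<in> P \<or> fps_nth B b \<in> P" by (rule P_prime[OF R])
    thus False using A B by (auto simp: P_order_def)
  qed
  ultimately show ?thesis
    using A B by (auto simp: P_order_def intro: R_fps_mult)
qed

lemma P_order_power: "P_order A a \<Longrightarrow> P_order (A ^ n) (n * a)"
  by (induction n) (auto intro: P_order_1 P_order_mult)

text \<open>Gaussian elimination without division: the pivots are units modulo \<open>P\<close>, so orders persist.\<close>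

lemma elimination:
  assumes closed: "\<And>A B x y. A \<in> S \<Longrightarrow> B \<in> S \<Longrightarrow> fps_const x * A - fps_const y * B \<in> S"
    and ex: "\<And>s. s < n \<Longrightarrow> \<exists>A\<in>S. P_order A s" and n: "n > 0"
  shows "\<exists>A\<in>S. (\<forall>j<n - 1. fps_nth A j = 0) \<and> fps_nth A (n - 1) \<noteq> 0"
proof -
  have "\<forall>s. i \<le> s \<and> s < n \<longrightarrow> (\<exists>A\<in>S. P_order A s \<and> (\<forall>j<i. fps_nth A j = 0))" if "i < n" for i
    using that
  proof (induction i)
    case 0
    thus ?case using ex by auto
  next
    case (Suc i)
    hence IH: "\<And>s. i \<le> s \<Longrightarrow> s < n \<Longrightarrow> \<exists>A\<in>S. P_order A s \<and> (\<forall>j<i. fps_nth A j = 0)" by simp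
    obtain A where A: "A \<in> S" "P_order A i" "\<And>j. j < i \<Longrightarrow> fps_nth A j = 0"
      using IH[of i] Suc.prems by auto
    show ?case
    proof (intro allI impI)
      fix s assume s: "Suc i \<le> s \<and> s < n"
      obtain B where B: "B \<in> S" "P_order B s" "\<And>j. j < i \<Longrightarrow> fps_nth B j = 0"
        using IH[of s] s by auto
      define x where "x = fps_nth A i"
      define y where "y = fps_nth B i"
      \<comment> \<open>Cross-multiplication cancels coefficient i. As s > i, the multiplier
        \<open>y\<close> lies in \<open>P\<close> while the pivot \<open>x\<close> does not, so
        \<open>D\<close> keeps the order s of \<open>B\<close>.\<close>
      define D where "D = fps_const x * B - fps_const y * A"
      have nth: "fps_nth D j = x * fps_nth B j - y * fps_nth A j" for j by (simp add: D_def)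
      have R: "fps_nth A j \<in> R" "fps_nth B j \<in> R" for j
        using A B by (auto simp: P_order_def R_fps_def)
      have x: "x \<in> R" "x \<notin> P" using A R by (auto simp: x_def P_order_def)
      have y: "y \<in> P" "y \<in> R" using B R s by (auto simp: y_def P_order_def)
      have yA: "y * fps_nth A j \<in> P" for j using y R by (intro P_mult_right)
      have "fps_nth D j \<in> P" if "j < s" for j
        unfolding nth by (rule P_diff[OF P_mult[OF x(1)] yA]) (use B that in \<open>simp add: P_order_def\<close>)
      moreover have "fps_nth D s \<notin> P"
      proof
        assume "fps_nth D s \<in> P"
        hence "fps_nth D s + y * fps_nth A s \<in> P" using yA by (rule P_add)
        hence "x * fps_nth B s \<in> P" by (simp add: nth)
        hence "x \<in> P \<or> fps_nth B s \<in> P" using x R by (intro P_prime)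
        thus False using x B by (auto simp: P_order_def)
      qed
      moreover have "R_fps D"
        unfolding R_fps_def nth using x y R by (auto intro: R_diff R_mult)
      moreover have "fps_nth D j = 0" if "j < Suc i" for j
        using that A(3)[of j] B(3)[of j] by (cases "j = i") (auto simp: nth x_def y_def)
      moreover have "D \<in> S" unfolding D_def by (rule closed) fact+
      ultimately show "\<exists>A\<in>S. P_order A s \<and> (\<forall>j<Suc i. fps_nth A j = 0)"
        by (auto simp: P_order_def)
    qed
  qed
  from this[of "n - 1"] obtain A where "A \<in> S" "P_order A (n - 1)" "\<forall>j<n - 1. fps_nth A j = 0"
    using n by auto
  moreover have "fps_nth A (n - 1) \<noteq> 0" using \<open>P_order A (n - 1)\<close> P_0 by (auto simp: P_order_def)
  ultimately show ?thesis by blast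
qed

end

section \<open>The bound of Sturm for two weights\<close>

lemma q_expansion_nonzero:
  assumes f: "q_expansion f A" and n: "fps_nth A n \<noteq> 0"
  obtains z where "Im z > 0" "f z \<noteq> 0"
proof (rule ccontr)
  assume "\<not> thesis"
  hence "f z = 0" if "Im z > 0" for z using that \<open>\<And>z. Im z > 0 \<Longrightarrow> f z \<noteq> 0 \<Longrightarrow> thesis\<close> by blast
  hence "q_expansion f 0" by (simp add: q_expansion_def)
  hence "fps_nth A = fps_nth 0"
    using q_expansion_fourier_coeff[OF f] q_expansion_fourier_coeff by metis
  thus False using n by simp
qed

text \<open>\<open>K\<close> and \<open>m\<close> are weight and order of one block, \<mu> is the
  index, and I = 12 m \<mu> + 12 blocks are used; \<open>le\<close> is the valence bound for the
  order m(I + 1) - 1. Integrality gives K \<mu> + 1 \<le> 12 m, so the blocks gain at least I, which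
  equals the overhead and leaves 12 m(I + 1) \<le> 12 m I.\<close>

lemma order_count_arith:
  fixes m K \<mu> :: nat
  assumes less: "K * \<mu> < 12 * m" and le: "12 * (m * (12 * m * \<mu> + 13) - 1) \<le> (K * (12 * m * \<mu> + 12) + 12 * m) * \<mu>"
  shows False
proof -
  define I where "I = 12 * m * \<mu> + 12"
  have "m > 0" using less by (cases m) auto
  have "12 * x \<le> y + 12" if "12 * (x - 1) \<le> y" for x y :: nat
    using that by arith
  from this[OF le] have "12 * (m * (I + 1)) \<le> (K * I + 12 * m) * \<mu> + 12"
    by (simp add: I_def numeral_eq_Suc)
  also have "\<dots> = K * \<mu> * I + I" by (simp add: I_def algebra_simps)
  also have "\<dots> = (K * \<mu> + 1) * I" by simp
  also have "\<dots> \<le> 12 * m * I" using less by (intro mult_right_mono) auto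
  finally show False using \<open>m > 0\<close> by simp
qed

context subring_prime
begin

text \<open>The exponent \<open>e\<close> kills the character, as \<open>valence_bound\<close>
  demands a trivial one. By \<open>six\<close>, \<open>eisenstein4\<close> is congruent to 1 modulo
  \<open>P\<close> and hence neutral for the order.\<close>

lemma sturm_bound:
  assumes f: "modular_form k N psi f" and N: "N > 0"
    and e: "e > 0" "\<And>d. coprime d (int N) \<Longrightarrow> psi d ^ e = 1"
    and A: "q_expansion f A" "P_order A m" and six: "6 \<in> P \<or> 2 \<in> P \<or> 3 \<in> P"
  shows "12 * m \<le> k * Gamma0_index N"
proof (rule ccontr)
  assume "\<not> 12 * m \<le> k * Gamma0_index N"
  define \<mu> where "\<mu> = Gamma0_index N"
  have less: "k * \<mu> < 12 * m" using \<open>\<not> _\<close> by (simp add: \<mu>_def)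
  \<comment> \<open>The factor 4 makes the weight \<open>K\<close> divisible by 4, so that powers of
    \<open>eisenstein4\<close> can fill up to weight \<open>W\<close>.\<close>
  define a where "a = 4 * e"
  have a: "a > 0" using e by (simp add: a_def)
  define K where "K = a * k"
  define m' where "m' = a * m"
  have less': "K * \<mu> < 12 * m'" using less a by (simp add: K_def m'_def)
  have m'0: "m' > 0" using less' by (cases m') auto
  \<comment> \<open>Large enough to absorb the overhead: 12 m' \<mu> for the weight reserved for the
    discriminant, and 12 because the top order is one less than the number of orders.\<close>
  define I where "I = 12 * m' * \<mu> + 12"
  define W where "W = K * I + 12 * m'"
  define S where "S = {B. \<exists>h. modular_form W N (\<lambda>_. 1) h \<and> q_expansion h B}"
  have closed: "fps_const x * B - fps_const y * C \<in> S" if "B \<in> S" "C \<in> S" for B C x y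
  proof -
    obtain h where h: "modular_form W N (\<lambda>_. 1) h" "q_expansion h B" using \<open>B \<in> S\<close> by (auto simp: S_def)
    obtain g where g: "modular_form W N (\<lambda>_. 1) g" "q_expansion g C" using \<open>C \<in> S\<close> by (auto simp: S_def)
    have "modular_form W N (\<lambda>_. 1) (\<lambda>z. x * h z - y * g z)"
      by (intro modular_form_diff modular_form_cmult h g)
    moreover have "q_expansion (\<lambda>z. x * h z - y * g z) (fps_const x * B - fps_const y * C)"
      by (intro q_expansion_diff q_expansion_mult q_expansion_const h g)
    ultimately show ?thesis by (auto simp: S_def)
  qed
  have fa: "modular_form K N (\<lambda>_. 1) (\<lambda>z. f z ^ a)"
    unfolding K_def
    by (rule modular_form_cong_character[OF modular_form_power[OF f]])
       (use e(2) in \<open>simp add: a_def power_mult power_mult[of _ 4 e] mult.commute[of 4 e]\<close>)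
  define D where "D = fps_X * euler_fps ^ 24"
  have D: "P_order D 1"
  proof -
    have "R_fps D" unfolding D_def
      by (intro R_fps_integral integral_fps_mult integral_fps_X integral_fps_power integral_euler_fps)
    thus ?thesis
      by (auto simp: P_order_def D_def P_0 P_1 fps_power_zeroth euler_fps_nth_0)
  qed
  obtain E B where E: "q_expansion eisenstein4 (1 + 48 * B)" and B: "integral_fps B"
    using eisenstein4_q_expansion by metis
  have "(48 :: complex) \<in> P"
  proof -
    have "(8 :: complex) \<in> R" "(24 :: complex) \<in> R" "(16 :: complex) \<in> R" by (simp_all add: R_Ints)
    hence "(8 :: complex) * 6 \<in> P \<or> (24 :: complex) * 2 \<in> P \<or> (16 :: complex) * 3 \<in> P"
      using six P_mult by blast
    thus ?thesis by simp
  qed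
  hence E4: "P_order (1 + 48 * B) 0"
    using P_fps_mult[OF R_fps_integral[OF B] P_fps_numeral] by (intro P_order_add P_order_1) (simp add: mult.commute)
  have ex: "\<exists>B\<in>S. P_order B s" if s: "s < m' * (I + 1)" for s
  proof -
    \<comment> \<open>Division with remainder: every power of f^a contributes order
      \<open>m'\<close>, the discriminant supplies the remainder, and \<open>eisenstein4\<close>
      raises the weight to \<open>W\<close> without changing the order.\<close>
    define i where "i = s div m'"
    define j where "j = s mod m'"
    have "i < I + 1" using s m'0 by (simp add: i_def less_mult_imp_div_less mult.commute)
    hence i: "i \<le> I" by simp
    have j: "j < m'" using m'0 by (simp add: j_def)
    have sij: "s = i * m' + j" by (simp add: i_def j_def)
    have le: "i * K + j * 12 \<le> W"
    proof -
      have "i * K \<le> K * I" using i by (simp add: mult.commute)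
      moreover have "j * 12 \<le> 12 * m'" using j by simp
      ultimately show ?thesis unfolding W_def by linarith
    qed
    have "4 dvd W - (i * K + j * 12)"
      by (intro dvd_diff_nat) (auto simp: W_def K_def a_def intro!: dvd_add dvd_mult)
    then obtain l where l: "W - (i * K + j * 12) = 4 * l" by (auto simp: dvd_def)
    have Wl: "W = i * K + j * 12 + l * 4" using l le by linarith
    define h where "h = (\<lambda>z. (f z ^ a) ^ i * discriminant z ^ j * eisenstein4 z ^ l)"
    have "modular_form (i * K + j * 12 + l * 4) N (\<lambda>_. (1 ^ i * 1 ^ j) * 1 ^ l) h"
      unfolding h_def
      by (intro modular_form_mult modular_form_power fa
          level_one_imp_modular_form[OF level_one_discriminant discriminant_q_expansion]
          level_one_imp_modular_form[OF level_one_eisenstein4 E])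
    hence "modular_form W N (\<lambda>_. 1) h" by (simp add: Wl)
    moreover have "q_expansion h ((A ^ a) ^ i * D ^ j * (1 + 48 * B) ^ l)"
      unfolding h_def D_def
      by (intro q_expansion_mult q_expansion_power A E discriminant_q_expansion)
    moreover have "P_order ((A ^ a) ^ i * D ^ j * (1 + 48 * B) ^ l) (i * (a * m) + j * 1 + l * 0)"
      by (intro P_order_mult P_order_power A D E4)
    hence "P_order ((A ^ a) ^ i * D ^ j * (1 + 48 * B) ^ l) s" by (simp add: sij m'_def)
    ultimately show ?thesis by (auto simp: S_def)
  qed
  have "m' * (I + 1) > 0" using m'0 by simp
  from elimination[OF closed ex this] obtain B where
    B: "B \<in> S" "\<forall>j<m' * (I + 1) - 1. fps_nth B j = 0" "fps_nth B (m' * (I + 1) - 1) \<noteq> 0" by blast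
  then obtain h where h: "modular_form W N (\<lambda>_. 1) h" "q_expansion h B" by (auto simp: S_def)
  obtain z where z: "Im z > 0" "h z \<noteq> 0" using q_expansion_nonzero[OF h(2) B(3)] by blast
  have "12 * (m' * (I + 1) - 1) \<le> W * \<mu>"
    unfolding \<mu>_def by (rule valence_bound[OF h(1) N h(2) z]) (use B(2) in blast)
  moreover have "I + 1 = 12 * m' * \<mu> + 13" by (simp add: I_def)
  ultimately have "12 * (m' * (12 * m' * \<mu> + 13) - 1) \<le> (K * (12 * m' * \<mu> + 12) + 12 * m') * \<mu>"
    by (simp only: W_def I_def)
  thus False by (rule order_count_arith[OF less'])
qed

end

section \<open>Characters, parity, and the passage to the ring of integers\<close>

lemma dirichlet_character_cong:
  assumes chi: "dirichlet_character N chi" and ab: "[a = b] (mod int N)"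
  shows "chi a = chi b"
proof -
  have 1: "chi (a + int N * int t) = chi a" for a t
  proof (induction t)
    case (Suc t)
    have "chi (a + int N * int (Suc t)) = chi ((a + int N * int t) + int N)" by (simp add: algebra_simps)
    thus ?case using Suc chi by (simp add: dirichlet_character_def)
  qed simp
  obtain k where k: "b = a + int N * k" using ab by (auto simp: cong_iff_lin)
  show ?thesis
  proof (cases "k \<ge> 0")
    case True
    thus ?thesis using 1[of a "nat k"] k by simp
  next
    case False
    thus ?thesis using 1[of b "nat (- k)"] k by simp
  qed
qed

lemma dirichlet_character_1:
  assumes "dirichlet_character N chi"
  shows "chi 1 = 1"
proof -
  have "chi (1 * 1) = chi 1 * chi 1" "chi 1 \<noteq> 0"
    using assms unfolding dirichlet_character_def by (blast, simp)
  thus ?thesis by simp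
qed

lemma dirichlet_character_power_totient:
  assumes chi: "dirichlet_character N chi" and N: "N > 0" and d: "coprime d (int N)"
  shows "chi d ^ totient N = 1"
proof -
  define n where "n = nat (d mod int N)"
  have n: "int n = d mod int N" using N by (simp add: n_def)
  have "coprime (int n) (int N)" unfolding n using d N by simp
  hence cop: "coprime n N" by (simp add: coprime_int_iff)
  have pow: "chi (int n ^ i) = chi (int n) ^ i" for i
    using chi dirichlet_character_1[OF chi] by (induction i) (auto simp: dirichlet_character_def)
  have "chi d = chi (int n)"
    by (rule dirichlet_character_cong[OF chi]) (simp add: n cong_def)
  hence "chi d ^ totient N = chi (int (n ^ totient N))" by (simp add: pow)
  also have "[n ^ totient N = 1] (mod N)" using cop by (rule euler_theorem)
  hence "[int (n ^ totient N) = int 1] (mod int N)" by (subst cong_int_iff)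
  hence "chi (int (n ^ totient N)) = chi 1"
    using dirichlet_character_cong[OF chi] by simp
  finally show ?thesis using dirichlet_character_1[OF chi] by simp
qed

text \<open>The matrix -1 lies in every \<open>Gamma0 N\<close> and fixes every z. Two nonzero forms
  with the same character thus have weights of equal parity.\<close>

lemma modular_form_parity:
  assumes f: "modular_form k N chi f" and z: "Im z > 0" "f z \<noteq> 0"
  shows "chi (- 1) * (- 1) ^ k = 1"
proof -
  define A :: "int ^ 2 ^ 2" where "A = vector [vector [- 1, 0], vector [0, - 1]]"
  have A: "A \<in> Gamma0 N" by (simp add: Gamma0_def) (simp add: A_def det_2)
  have "moebius_num A z = - z" "moebius_den A z = - 1" "A $ 2 $ 2 = - 1"
    by (simp_all add: A_def moebius_num_def moebius_den_def)
  hence "f z = chi (- 1) * (- 1) ^ k * f z"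
    using modular_formD(2)[OF f A z(1)] by simp
  thus ?thesis using z(2) by simp
qed

text \<open>The operations of \<open>ring_of_integers\<close> are those of \<complex>. Only the
  negative has to be identified, since \<open>a_inv\<close> is a description relative to the
  carrier.\<close>

lemma subring_primeI:
  assumes "primeideal P (ring_of_integers K)"
  shows "subring_prime (carrier (ring_of_integers K)) P"
proof -
  interpret primeideal P "ring_of_integers K" by (rule assms)
  have ops: "mult (ring_of_integers K) = (*)" "add (ring_of_integers K) = (+)"
    "one (ring_of_integers K) = 1" "zero (ring_of_integers K) = 0"
    by (simp_all add: ring_of_integers_def ring_of_type_algebra_def)
  show ?thesis
  proof
    show "- a \<in> carrier (ring_of_integers K)" if "a \<in> carrier (ring_of_integers K)" for a
    proof -
      have "a + a_inv (ring_of_integers K) a = 0" using r_neg[OF that] by (simp add: ops)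
      hence "a_inv (ring_of_integers K) a = - a" by (simp add: eq_neg_iff_add_eq_0 add.commute)
      thus ?thesis using a_inv_closed[OF that] by simp
    qed
    show "1 \<notin> P" using one_imp_carrier I_notcarr by (auto simp: ops)
  qed (use one_closed add.m_closed m_closed a_subset additive_subgroup.zero_closed[OF is_additive_subgroup]
        additive_subgroup.a_closed[OF is_additive_subgroup] I_l_closed I_prime in \<open>auto simp: ops\<close>)
qed

theorem mainTheorem6:
  fixes N k\<^sub>1 k\<^sub>2 p M :: nat
    and chi :: "int \<Rightarrow> complex"
    and f g :: "complex \<Rightarrow> complex"
    and K P :: "complex set"
  assumes "N \<ge> 1"
    and "dirichlet_character N chi"
    and "0 < k\<^sub>1" and "k\<^sub>1 \<le> k\<^sub>2"
    and "normalised_eigenform k\<^sub>1 N chi f"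
    and "normalised_eigenform k\<^sub>2 N chi g"
    and "number_field K"
    and "\<And>n. fourier_coeff f n \<in> carrier (ring_of_integers K)"
    and "\<And>n. fourier_coeff g n \<in> carrier (ring_of_integers K)"
    and "primeideal P (ring_of_integers K)" and "P \<noteq> {0}"
    and "{m :: int. of_int m \<in> P} = {m. int p dvd m}"
    and "p \<in> {2, 3}"
    and "\<not> forms_congruent P f g"
    and "p = 3 \<Longrightarrow> \<nexists>a. N = 3 ^ a \<Longrightarrow> M = N"
    and "p = 3 \<Longrightarrow> \<exists>a. N = 3 ^ a \<Longrightarrow> M = 2 * N"
    and "p = 2 \<Longrightarrow> 5 dvd N \<or> 7 dvd N \<or> 11 dvd N \<Longrightarrow> M = N"
    and "p = 2 \<Longrightarrow> \<not> (5 dvd N \<or> 7 dvd N \<or> 11 dvd N) \<Longrightarrow> M = 5 * N"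
  shows "\<exists>n :: nat.
           real n \<le> max (real (least_prime_primroot p N ^ 2))
                        (real k\<^sub>2 / 12 * real (Gamma0_index M)) \<and>
           fourier_coeff f n - fourier_coeff g n \<notin> P"
proof -
  interpret subring_prime "carrier (ring_of_integers K)" P
    using assms(10) by (rule subring_primeI)
  have M: "N dvd M \<and> M > 0"
    using assms(1,13,15-18) by (cases "p = 2"; cases "\<exists>a. N = 3 ^ a"; cases "5 dvd N \<or> 7 dvd N \<or> 11 dvd N") auto
  have chi1: "chi 1 = 1" by (rule dirichlet_character_1[OF assms(2)])
  have mf: "modular_form k\<^sub>1 N chi f" and mg: "modular_form k\<^sub>2 N chi g"
    using assms(5,6) by (auto simp: normalised_eigenform_def eigenform_def)
  note mfM = modular_form_level_mono[OF mf conjunct1[OF M]] and mgM = modular_form_level_mono[OF mg conjunct1[OF M]]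
  obtain A where A: "q_expansion f A" using modular_form_q_expansion[OF mf chi1] by blast
  obtain B where B: "q_expansion g B" using modular_form_q_expansion[OF mg chi1] by blast
  have cA: "fourier_coeff f = fps_nth A" and cB: "fourier_coeff g = fps_nth B"
    using q_expansion_fourier_coeff A B by blast+
  have RA: "R_fps A" and RB: "R_fps B"
    using assms(8,9) by (simp_all add: R_fps_def cA cB)
  \<comment> \<open>The least index at which the forms differ modulo \<open>P\<close>; it is the
    witness, and bounding it means bounding the order of f - g.\<close>
  define d where "d = (LEAST n. fps_nth (A - B) n \<notin> P)"
  have "\<exists>n. fps_nth (A - B) n \<notin> P"
    using assms(14) by (auto simp: forms_congruent_def cA cB)
  hence d: "fps_nth (A - B) d \<notin> P" unfolding d_def by (rule LeastI_ex)
  have "fps_nth (A - B) j \<in> P" if "j < d" for j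
    using not_less_Least[OF that[unfolded d_def]] by blast
  hence order: "P_order (A - B) d"
    using d RA RB by (simp add: P_order_def R_fps_diff)
  define r where "r = k\<^sub>2 - k\<^sub>1"
  have k2: "k\<^sub>2 = k\<^sub>1 + r" using assms(4) by (simp add: r_def)
  have "int p \<in> {m. int p dvd m}" by simp
  hence pP: "of_nat p \<in> P" using assms(12) by (metis mem_Collect_eq of_int_of_nat_eq)
  have tot: "totient N > 0" using assms(1) by simp
  \<comment> \<open>The level is now M, but the character still has modulus N: units modulo M are
    units modulo N, so \<open>totient N\<close> remains an exponent.\<close>
  have chi_pow: "(chi c ^ m) ^ totient N = 1" if "coprime c (int M)" for c m
  proof -
    have "coprime c (int N)"
      using that M by (meson coprime_divisors dvd_refl int_dvd_int_iff)
    hence "chi c ^ totient N = 1"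
      using dirichlet_character_power_totient[OF assms(2)] assms(1) by simp
    thus ?thesis by (metis mult.commute power_mult power_one)
  qed
  have "12 * d \<le> k\<^sub>2 * Gamma0_index M"
  proof (cases "p = 2")
    case True
    hence two: "(2 :: complex) \<in> P" using pP by simp
    obtain C where C: "integral_fps C" "q_expansion eisenstein4 (1 + 48 * C)"
      using eisenstein4_q_expansion by metis
    have RE: "R_fps (1 + 48 * C)"
      by (intro R_fps_integral integral_fps_add integral_fps_mult integral_fps_1 integral_fps_numeral C)
    have "P_fps ((24 * C) * 2)"
      by (intro P_fps_mult P_fps_numeral R_fps_mult R_fps_numeral R_fps_integral C two)
    hence E1: "P_fps ((1 + 48 * C) ^ r - 1)"
      by (intro P_fps_power_diff_1 RE) (simp add: mult.commute)
    define F where "F = A ^ 4 * (1 + 48 * C) ^ r - B ^ 4"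
    define H where "H = (\<lambda>z. f z ^ 4 * eisenstein4 z ^ r - g z ^ 4)"
    have "modular_form (4 * k\<^sub>1 + r * 4) M (\<lambda>c. chi c ^ 4 * 1 ^ r) (\<lambda>z. f z ^ 4 * eisenstein4 z ^ r)"
      by (intro modular_form_mult modular_form_power mfM level_one_imp_modular_form[OF level_one_eisenstein4 C(2)])
    hence "modular_form (4 * k\<^sub>2) M (\<lambda>c. chi c ^ 4) (\<lambda>z. f z ^ 4 * eisenstein4 z ^ r)"
      by (simp add: k2 algebra_simps)
    hence H: "modular_form (4 * k\<^sub>2) M (\<lambda>c. chi c ^ 4) H"
      unfolding H_def by (intro modular_form_diff modular_form_power mgM)
    have HF: "q_expansion H F"
      unfolding H_def F_def by (intro q_expansion_diff q_expansion_mult q_expansion_power A B C)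
    \<comment> \<open>The binomial expansion over \<int>: the mixed terms are even, and the wrong
      sign of B^4 costs 2 B^4, so everything but (A - B)^4 vanishes modulo \<open>P\<close>.\<close>
    have F: "F = (A - B) ^ 4 + ((2 * A ^ 3 * B - 3 * A ^ 2 * B ^ 2 + 2 * A * B ^ 3 - B ^ 4) * 2
        + A ^ 4 * ((1 + 48 * C) ^ r - 1))"
      unfolding F_def by (simp add: algebra_simps numeral_eq_Suc)
    have "P_order F (4 * d)"
      unfolding F
      by (intro P_order_add P_order_power order P_fps_add P_fps_mult P_fps_numeral two E1
          R_fps_add R_fps_diff R_fps_mult R_fps_power R_fps_numeral RA RB)
    \<comment> \<open>Order and weight both carry the factor 4, so passing to fourth powers loses
      nothing.\<close>
    hence "12 * (4 * d) \<le> (4 * k\<^sub>2) * Gamma0_index M"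
      by (intro sturm_bound[OF H conjunct2[OF M] tot chi_pow HF]) (use two in auto)
    thus ?thesis by simp
  next
    case False
    hence three: "(3 :: complex) \<in> P" using pP assms(13) by simp
    obtain z where z: "Im z > 0" "f z \<noteq> 0"
      using assms(5) by (auto simp: normalised_eigenform_def eigenform_def)
    obtain z' where z': "Im z' > 0" "g z' \<noteq> 0"
      using assms(6) by (auto simp: normalised_eigenform_def eigenform_def)
    \<comment> \<open>Comparing the parity relations of f and g gives (-1)^r = 1. An even r is
      required because the correcting factor has weight 6 and 3 r must be a multiple of it.\<close>
    have "(chi (- 1) * (- 1) ^ k\<^sub>1) * (- 1) ^ r = 1"
      using modular_form_parity[OF mg z'] by (simp add: k2 power_add mult.assoc)
    hence "(- 1 :: complex) ^ r = 1"
      unfolding modular_form_parity[OF mf z] by simp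
    hence "even r" by (cases "even r") auto
    then obtain s where s: "r = 2 * s" by (elim evenE)
    obtain C where C: "integral_fps C" "q_expansion eisenstein6 (1 + 3 * C)"
      using eisenstein6_q_expansion by metis
    have RE: "R_fps (1 + 3 * C)"
      by (intro R_fps_integral integral_fps_add integral_fps_mult integral_fps_1 integral_fps_numeral C)
    have "P_fps (C * 3)"
      by (intro P_fps_mult P_fps_numeral R_fps_integral C three)
    hence E1: "P_fps ((1 + 3 * C) ^ s - 1)"
      by (intro P_fps_power_diff_1 RE) (simp add: mult.commute)
    define F where "F = A ^ 3 * (1 + 3 * C) ^ s - B ^ 3"
    define H where "H = (\<lambda>z. f z ^ 3 * eisenstein6 z ^ s - g z ^ 3)"
    have "modular_form (3 * k\<^sub>1 + s * 6) M (\<lambda>c. chi c ^ 3 * 1 ^ s) (\<lambda>z. f z ^ 3 * eisenstein6 z ^ s)"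
      by (intro modular_form_mult modular_form_power mfM level_one_imp_modular_form[OF level_one_eisenstein6 C(2)])
    hence "modular_form (3 * k\<^sub>2) M (\<lambda>c. chi c ^ 3) (\<lambda>z. f z ^ 3 * eisenstein6 z ^ s)"
      by (simp add: k2 s algebra_simps)
    hence H: "modular_form (3 * k\<^sub>2) M (\<lambda>c. chi c ^ 3) H"
      unfolding H_def by (intro modular_form_diff modular_form_power mgM)
    have HF: "q_expansion H F"
      unfolding H_def F_def by (intro q_expansion_diff q_expansion_mult q_expansion_power A B C)
    \<comment> \<open>For the odd exponent the sign of B^3 already agrees, and the mixed terms are
      divisible by 3.\<close>
    have F: "F = (A - B) ^ 3 + ((A ^ 2 * B - A * B ^ 2) * 3 + A ^ 3 * ((1 + 3 * C) ^ s - 1))"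
      unfolding F_def by (simp add: algebra_simps numeral_eq_Suc)
    have "P_order F (3 * d)"
      unfolding F
      by (intro P_order_add P_order_power order P_fps_add P_fps_mult P_fps_numeral three E1
          R_fps_add R_fps_diff R_fps_mult R_fps_power R_fps_numeral RA RB)
    hence "12 * (3 * d) \<le> (3 * k\<^sub>2) * Gamma0_index M"
      by (intro sturm_bound[OF H conjunct2[OF M] tot chi_pow HF]) (use three in auto)
    thus ?thesis by simp
  qed
  hence "real (12 * d) \<le> real (k\<^sub>2 * Gamma0_index M)" by (simp only: of_nat_le_iff)
  hence "real d \<le> real k\<^sub>2 / 12 * real (Gamma0_index M)" by simp
  moreover have "fourier_coeff f d - fourier_coeff g d \<notin> P" using d by (simp add: cA cB)
  ultimately show ?thesis by (intro exI[of _ d]) simp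
qed

end
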